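(* Let $c^v_n$ and $c^e_n$ be the sums of all labelled 4-point, respectively 2-point, generating ribbon graphs with exactly $n$ internal faces, with $c^v_0=v$ (the single four-valent vertex) and $c^e_0=\mathbb{1}$ (the open edge). For every $n\ge1$ and $\bullet\in\{e,v\}$, $$\Delta(c^\bullet_n)=\sum_{k=0}^nP^\bullet_{n,k}\otimes c^\bullet_{n-k},$$ where the $P^\bullet_{n,k}$ are polynomials of loop order $k$ in the $c^v_i,c^e_j$, given for $0<k<n$ by $$P^v_{n,k}=\sum_{j=0}^kQ^v_{n-k+1,j}\,Q^e_{2(n-k),k-j},\qquad P^e_{n,k}=\sum_{j=0}^kQ^v_{n-k,j}\,Q^e_{2(n-k)-1,k-j},$$ with $$Q^v_{k,j}=\sum_{\substack{l_1+\dots+l_k=j\\ l_i\ge0}}c^v_{l_1}\cdots c^v_{l_k},\qquad Q^e_{k,j}=\sum_{\substack{s_1,\dots,s_j\ge0\\ 1s_1+2s_2+\dots+js_j=j}}\frac{(s_1+\dots+s_j+k-1)!}{s_1!\cdots s_j!\,(k-1)!}\prod_{i=1}^j(c^e_i)^{s_i}$$ (so $Q^e_{k,0}=\mathbb{1}$), and in the trivial cases by $P^\bullet_{n,n}=c^\bullet_n$ and $P^\bullet_{n,0}=\mathrm{skl}(c^\bullet_n)$, the common skeleton of the graphs in $c^\bullet_n$, i.e. $P^v_{n,0}=v^{n+1}$ and $P^e_{n,0}=v^n$.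
   Context: A ribbon graph is a triple $G=(\mathcal{H},\sigma,\alpha)$ of a finite set $\mathcal{H}$ of half edges, a permutation $\sigma$ and an involution $\alpha$ of $\mathcal{H}$ (fixed points allowed). Cycles of $\sigma$ are vertices (degree = length), 2-cycles of $\alpha$ are internal edges, fixed points of $\alpha$ are external half edges. A cycle of $\sigma^{-1}\circ\alpha$ is an internal face if it contains no external half edge, otherwise a boundary, whose length is its number of external half edges. $F_G$ is the number of internal faces ("loop order"). $G$ is connected if $\langle\sigma,\alpha\rangle$ is transitive; its genus $g$ is given by $2-2g=|\mathcal{C}(\sigma)|-|\{\text{internal edges}\}|+|\mathcal{C}(\sigma^{-1}\alpha)|$, with $\mathcal{C}(\cdot)$ the set of cycles. Bridgeless: cutting any one internal edge does not disconnect a component. The $n$-point generating graphs ($n=2,4$) are the connected bridgeless ribbon graphs of genus $0$ with exactly one boundary, of length $n$, and all vertices of degree 4; the single vertex $v$ without internal edges is a 4-point one. A labelled graph is one together with a distinguished external half edge, up to isomorphisms (bijections intertwining $\sigma$ and $\alpha$) preserving it. $\mathcal{H}_{CK}$ is the commutative $\mathbb{Q}$-algebra freely generated by the isomorphism classes (forgetting labels) of 2- and 4-point generating graphs, $v$ included as a generator; product = disjoint union, $\mathbb{1}$ = empty graph = open edge. Sums over labelled graphs are understood in $\mathcal{H}_{CK}$ by sending each labelled graph to its class (so a class occurs once per inequivalent labelling). The skeleton $\mathrm{skl}(\mathcal{H},\sigma,\alpha)=(\mathcal{H},\sigma,\mathrm{id})$ deletes all internal edges. $H=(\mathcal{H},\sigma,\alpha')\subset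 G$ is a ribbon subgraph iff the 2-cycles of $\alpha'$ are among those of $\alpha$. $G/H$ has as half edges the fixed points of $\alpha'$, as vertex cycles those of $\alpha'\circ\sigma$ with all other half edges deleted, and as involution the restriction of $\alpha$. $\pi$ deletes all bivalent vertices, merging adjacent edges (an open edge so obtained is $\mathbb{1}$). The coproduct is $\Delta(G)=\sum_{H}H\otimes\pi(G/H)$ over all $H\subset G$ all of whose components are generators (components $v$ allowed), extended linearly. *)

theory Defs
  imports Complex_Main "HOL-Combinatorics.Orbits" "HOL-Library.Poly_Mapping" "HOL-Library.Multiset"
begin

section \<open>Ribbon graphs\<close>

record 'h ribbon =
  half_edges :: "'h set"
  vrot :: "'h \<Rightarrow> 'h"  \<comment> \<open>the permutation \<open>\<sigma>\<close>\<close>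
  flip :: "'h \<Rightarrow> 'h"  \<comment> \<open>the involution \<open>\<alpha>\<close>\<close>

text \<open>\<open>permutes\<close> forces both maps to be the identity outside the half edges, so that the record
  carries no information besides the triple \<open>(H, \<sigma>, \<alpha>)\<close> and equality of records is equality of triples.\<close>

definition ribbon_graph :: "'h ribbon \<Rightarrow> bool" where
  "ribbon_graph G \<longleftrightarrow> finite (half_edges G) \<and> vrot G permutes half_edges G \<and>
     flip G permutes half_edges G \<and> (\<forall>h. flip G (flip G h) = h)"

definition cycles_of :: "('h \<Rightarrow> 'h) \<Rightarrow> 'h set \<Rightarrow> 'h set set" where
  "cycles_of p S = orbit p ` S"

definition vertices :: "'h ribbon \<Rightarrow> 'h set set" where
  "vertices G = cycles_of (vrot G) (half_edges G)"

definition internal_edges :: "'h ribbon \<Rightarrow> 'h set set" where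
  "internal_edges G = {c \<in> cycles_of (flip G) (half_edges G). card c = 2}"

definition external :: "'h ribbon \<Rightarrow> 'h set" where
  "external G = {h \<in> half_edges G. flip G h = h}"

definition faces :: "'h ribbon \<Rightarrow> 'h set set" where
  "faces G = cycles_of (inv (vrot G) \<circ> flip G) (half_edges G)"

definition internal_faces :: "'h ribbon \<Rightarrow> 'h set set" where
  "internal_faces G = {f \<in> faces G. f \<inter> external G = {}}"

definition boundaries :: "'h ribbon \<Rightarrow> 'h set set" where
  "boundaries G = {f \<in> faces G. f \<inter> external G \<noteq> {}}"

definition loop_number :: "'h ribbon \<Rightarrow> nat" where
  "loop_number G = card (internal_faces G)"

text \<open>Two half edges are linked iff they lie in one orbit of the group generated by \<open>\<sigma>\<close> and \<open>\<alpha>\<close>.\<close>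

definition linked :: "'h ribbon \<Rightarrow> ('h \<times> 'h) set" where
  "linked G = (let r = {(h, vrot G h) | h. h \<in> half_edges G} \<union> {(h, flip G h) | h. h \<in> half_edges G}
     in (r \<union> r\<inverse>)\<^sup>*)"

definition components :: "'h ribbon \<Rightarrow> 'h set set" where
  "components G = (\<lambda>h. linked G `` {h}) ` half_edges G"

definition connected_ribbon :: "'h ribbon \<Rightarrow> bool" where
  "connected_ribbon G \<longleftrightarrow> (\<forall>x\<in>half_edges G. \<forall>y\<in>half_edges G. (x, y) \<in> linked G)"

definition genus :: "'h ribbon \<Rightarrow> rat" where
  "genus G = (2 - (of_nat (card (vertices G)) - of_nat (card (internal_edges G))
                   + of_nat (card (faces G)))) / 2"

text \<open>Cutting an internal edge turns its two half edges into external ones.\<close>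

definition cut_edge :: "'h ribbon \<Rightarrow> 'h set \<Rightarrow> 'h ribbon" where
  "cut_edge G e = G\<lparr>flip := (\<lambda>h. if h \<in> e then h else flip G h)\<rparr>"

definition bridgeless :: "'h ribbon \<Rightarrow> bool" where
  "bridgeless G \<longleftrightarrow> (\<forall>e\<in>internal_edges G. components (cut_edge G e) = components G)"

definition generating_graph :: "nat \<Rightarrow> 'h ribbon \<Rightarrow> bool" where
  "generating_graph n G \<longleftrightarrow> ribbon_graph G \<and> connected_ribbon G \<and> bridgeless G \<and> genus G = 0 \<and>
     (\<exists>b. boundaries G = {b} \<and> card (b \<inter> external G) = n) \<and> (\<forall>w\<in>vertices G. card w = 4)"

definition is_generator :: "'h ribbon \<Rightarrow> bool" where
  "is_generator G \<longleftrightarrow> generating_graph 2 G \<or> generating_graph 4 G"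

definition ribbon_iso :: "('h \<Rightarrow> 'k) \<Rightarrow> 'h ribbon \<Rightarrow> 'k ribbon \<Rightarrow> bool" where
  "ribbon_iso f G G' \<longleftrightarrow> bij_betw f (half_edges G) (half_edges G') \<and>
     (\<forall>h\<in>half_edges G. f (vrot G h) = vrot G' (f h) \<and> f (flip G h) = flip G' (f h))"

definition subribbon :: "'h ribbon \<Rightarrow> 'h ribbon \<Rightarrow> bool" where
  "subribbon H G \<longleftrightarrow> ribbon_graph H \<and> half_edges H = half_edges G \<and> vrot H = vrot G \<and>
     internal_edges H \<subseteq> internal_edges G"

definition skl :: "'h ribbon \<Rightarrow> 'h ribbon" where
  "skl G = G\<lparr>flip := id\<rparr>"

definition component_graph :: "'h ribbon \<Rightarrow> 'h set \<Rightarrow> 'h ribbon" where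
  "component_graph G C =
     \<lparr>half_edges = C, vrot = perm_restrict (vrot G) C, flip = perm_restrict (flip G) C\<rparr>"

text \<open>Deleting from the cycles of \<open>p\<close> all elements outside \<open>S\<close>: each element of \<open>S\<close> is sent to the
  next element of \<open>S\<close> on its cycle.\<close>

definition delete_outside :: "('h \<Rightarrow> 'h) \<Rightarrow> 'h set \<Rightarrow> 'h \<Rightarrow> 'h" where
  "delete_outside p S x =
     (if x \<in> S then (p ^^ (LEAST m. 0 < m \<and> (p ^^ m) x \<in> S)) x else x)"

definition contract :: "'h ribbon \<Rightarrow> 'h ribbon \<Rightarrow> 'h ribbon" where
  "contract G H =
     \<lparr>half_edges = external H,
      vrot = delete_outside (flip H \<circ> vrot G) (external H),
      flip = perm_restrict (flip G) (external H)\<rparr>"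

definition bivalent :: "'h ribbon \<Rightarrow> 'h set" where
  "bivalent G = \<Union>{w \<in> vertices G. card w = 2}"

text \<open>To find the new partner of a half edge \<open>x\<close> at a surviving vertex, follow the edge \<open>\<alpha>\<close>;
  whenever this leads to a bivalent vertex, cross it with \<open>\<sigma>\<close> and follow \<open>\<alpha>\<close> again, until a
  surviving half edge is reached. If the chain ends in an external half edge of a bivalent vertex,
  \<open>\<alpha>\<close> reflects the walk there, so that it returns to \<open>x\<close>, which thus becomes external. An open edge
  or a closed circle of bivalent vertices leaves nothing behind, i.e. gives the empty graph.\<close>

definition delete_bivalent :: "'h ribbon \<Rightarrow> 'h ribbon" where
  "delete_bivalent G =
     \<lparr>half_edges = half_edges G - bivalent G,
      vrot = perm_restrict (vrot G) (half_edges G - bivalent G),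
      flip = delete_outside (\<lambda>h. flip G (if h \<in> bivalent G then vrot G h else h))
               (half_edges G - bivalent G)\<rparr>"

section \<open>The algebra of generating graphs\<close>

text \<open>Every finite ribbon graph is isomorphic to one whose half edges are natural numbers, so
  isomorphism classes are taken among the latter.\<close>

definition iso_class :: "nat ribbon \<Rightarrow> nat ribbon set" where
  "iso_class G = {G'. ribbon_graph G' \<and> (\<exists>f. ribbon_iso f G G')}"

definition vertex4 :: "nat ribbon" where
  "vertex4 = \<lparr>half_edges = {0, 1, 2, 3},
     vrot = (\<lambda>h. if h < 3 then h + 1 else if h = 3 then 0 else h), flip = id\<rparr>"

lemma generating_graph_vertex4: "generating_graph 4 vertex4"
proof -
  let ?s = "vrot vertex4"
  have s: "?s 0 = 1" "?s 1 = 2" "?s 2 = 3" "?s 3 = 0" "\<And>h. h > 3 \<Longrightarrow> ?s h = h"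
    by (auto simp: vertex4_def)
  have H: "half_edges vertex4 = {0, 1, 2, 3}" and fl: "flip vertex4 = id"
    by (auto simp: vertex4_def)
  have inj: "inj_on ?s {0, 1, 2, 3}"
    using s by (auto simp: inj_on_def)
  have "bij_betw ?s {0, 1, 2, 3} {0, 1, 2, 3}"
    unfolding bij_betw_def image_insert image_empty s using inj by (simp add: insert_commute)
  moreover have "?s h = h" if "h \<notin> {0, 1, 2, 3}" for h
    using that by (auto simp: vertex4_def)
  ultimately have perm: "?s permutes {0, 1, 2, 3}"
    by (rule bij_imp_permutes)
  then have pm: "permutation ?s"
    unfolding permutation_permutes by (intro exI[of _ "{0, 1, 2, 3}"] conjI) simp_all
  have pow: "(?s ^^ 1) 0 = 1" "(?s ^^ 2) 0 = 2" "(?s ^^ 3) 0 = 3" "(?s ^^ 4) 0 = 0"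
    using s by (simp_all add: eval_nat_numeral)
  have four: "{m::nat. m < 4} = {0, 1, 2, 3}"
    by auto
  have "orbit ?s 0 = (\<lambda>m. (?s ^^ m) 0) ` {m. m < 4}"
    using orbit_altdef_bounded[OF pow(4)] by (simp add: image_Collect)
  also have "\<dots> = {0, 1, 2, 3}"
    unfolding four image_insert image_empty pow funpow_0 ..
  finally have orb0: "orbit ?s 0 = {0, 1, 2, 3}" .
  have orb1: "orbit ?s 1 = {0, 1, 2, 3}"
    using permutation_orbit_step[OF pm, of 0] unfolding s orb0 .
  have orb2: "orbit ?s 2 = {0, 1, 2, 3}"
    using permutation_orbit_step[OF pm, of 1] unfolding s orb1 .
  have orb3: "orbit ?s 3 = {0, 1, 2, 3}"
    using permutation_orbit_step[OF pm, of 2] unfolding s orb2 .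
  note orb = orb0 orb1 orb2 orb3
  have vs: "vertices vertex4 = {{0, 1, 2, 3}}"
    unfolding vertices_def cycles_of_def H image_insert image_empty orb by simp
  have fs: "faces vertex4 = {{0, 1, 2, 3}}"
    unfolding faces_def cycles_of_def H fl comp_id orbit_inv_eq[OF pm] image_insert image_empty orb
    by simp
  have "orbit (id :: nat \<Rightarrow> nat) h = {h}" for h
    by (auto simp: orbit_altdef)
  then have ie: "internal_edges vertex4 = {}"
    unfolding internal_edges_def cycles_of_def fl by (auto simp: image_iff)
  have ex: "external vertex4 = {0, 1, 2, 3}"
    by (auto simp: external_def H fl)
  have conn: "connected_ribbon vertex4"
  proof -
    define r where "r = {(h, ?s h) | h. h \<in> half_edges vertex4} \<union>
      {(h, flip vertex4 h) | h. h \<in> half_edges vertex4}"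
    have l: "linked vertex4 = (r \<union> r\<inverse>)\<^sup>*"
      by (simp add: linked_def r_def Let_def)
    have "(0, 1) \<in> r" "(1, 2) \<in> r" "(2, 3) \<in> r"
      unfolding r_def H using s by force+
    then have "(0, 1) \<in> (r \<union> r\<inverse>)\<^sup>*" "(1, 2) \<in> (r \<union> r\<inverse>)\<^sup>*" "(2, 3) \<in> (r \<union> r\<inverse>)\<^sup>*"
      by blast+
    then have a: "(0, h) \<in> (r \<union> r\<inverse>)\<^sup>*" if "h \<in> {0, 1, 2, 3}" for h
      using that by (metis insertE singletonD rtrancl.rtrancl_refl rtrancl_trans)
    have "sym ((r \<union> r\<inverse>)\<^sup>*)"
      by (intro sym_rtrancl) (auto simp: sym_def)
    then have b: "(h, 0) \<in> (r \<union> r\<inverse>)\<^sup>*" if "h \<in> {0, 1, 2, 3}" for h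
      using a[OF that] by (rule symD)
    show ?thesis
      unfolding connected_ribbon_def l H using rtrancl_trans[OF b a] by blast
  qed
  have bd: "boundaries vertex4 = {{0, 1, 2, 3}}"
    unfolding boundaries_def fs ex by auto
  show ?thesis
    unfolding generating_graph_def
    using perm conn by (simp add: ribbon_graph_def H fl bd ex vs ie bridgeless_def genus_def fs permutes_id)
qed

typedef generator = "{iso_class G | G. is_generator G}"
  using generating_graph_vertex4 by (auto simp: is_generator_def)

definition generator_of :: "nat ribbon \<Rightarrow> generator" where
  "generator_of G = Abs_generator (iso_class G)"

text \<open>\<open>hck\<close> is the monoid algebra over the free commutative monoid on the generators, i.e. the free
  commutative algebra; \<open>hck2\<close> realises \<open>hck \<otimes> hck\<close> by its basis of pairs of monomials.\<close>

type_synonym monomial = "generator multiset"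
type_synonym hck = "monomial \<Rightarrow>\<^sub>0 rat"
type_synonym hck2 = "(monomial \<times> monomial) \<Rightarrow>\<^sub>0 rat"

definition tensor :: "hck \<Rightarrow> hck \<Rightarrow> hck2"  (infixl "\<otimes>" 72) where
  "a \<otimes> b = (\<Sum>s\<in>Poly_Mapping.keys a. \<Sum>t\<in>Poly_Mapping.keys b.
     Poly_Mapping.single (s, t) (Poly_Mapping.lookup a s * Poly_Mapping.lookup b t))"

abbreviation scalar :: "rat \<Rightarrow> hck" where
  "scalar q \<equiv> Poly_Mapping.single 0 q"

definition all_generators :: "'h ribbon \<Rightarrow> bool" where
  "all_generators G \<longleftrightarrow> ribbon_graph G \<and> (\<forall>C\<in>components G. is_generator (component_graph G C))"

definition monomial_of :: "nat ribbon \<Rightarrow> monomial" where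
  "monomial_of G = image_mset (\<lambda>C. generator_of (component_graph G C)) (mset_set (components G))"

text \<open>The element of the algebra represented by a disjoint union of generators; the empty graph gives
  \<open>1\<close>. If some component is not a generator, the value involves unspecified values of
  \<^term>\<open>Abs_generator\<close>.\<close>

definition graph_elem :: "nat ribbon \<Rightarrow> hck" where
  "graph_elem G = Poly_Mapping.single (monomial_of G) 1"

definition coproduct_graph :: "nat ribbon \<Rightarrow> hck2" where
  "coproduct_graph G = (\<Sum>H | subribbon H G \<and> all_generators H.
     graph_elem H \<otimes> graph_elem (delete_bivalent (contract G H)))"

definition monomial_graph :: "monomial \<Rightarrow> nat ribbon" where
  "monomial_graph m = (SOME G. all_generators G \<and> monomial_of G = m)"

definition coproduct :: "hck \<Rightarrow> hck2"  ("\<Delta>") where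
  "\<Delta> x = (\<Sum>m\<in>Poly_Mapping.keys x.
     Poly_Mapping.map ((*) (Poly_Mapping.lookup x m)) (coproduct_graph (monomial_graph m)))"

section \<open>Sums of labelled graphs\<close>

definition labelled_class :: "nat ribbon \<Rightarrow> nat \<Rightarrow> (nat ribbon \<times> nat) set" where
  "labelled_class G h = {(G', h'). ribbon_graph G' \<and> (\<exists>f. ribbon_iso f G G' \<and> f h = h')}"

definition labelled_graphs :: "nat \<Rightarrow> nat \<Rightarrow> (nat ribbon \<times> nat) set set" where
  "labelled_graphs p n =
     {labelled_class G h | G h. generating_graph p G \<and> loop_number G = n \<and> h \<in> external G}"

definition labelled_sum :: "nat \<Rightarrow> nat \<Rightarrow> hck" where
  "labelled_sum p n = (\<Sum>L\<in>labelled_graphs p n. graph_elem (fst (SOME x. x \<in> L)))"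

definition c_v :: "nat \<Rightarrow> hck" where
  "c_v n = (if n = 0 then graph_elem vertex4 else labelled_sum 4 n)"

definition c_e :: "nat \<Rightarrow> hck" where
  "c_e n = (if n = 0 then 1 else labelled_sum 2 n)"

definition Q_v :: "nat \<Rightarrow> nat \<Rightarrow> hck" where
  "Q_v k j = (\<Sum>l | l \<in> {1..k} \<rightarrow>\<^sub>E UNIV \<and> (\<Sum>i=1..k. l i) = j. \<Prod>i=1..k. c_v (l i))"

definition Q_e :: "nat \<Rightarrow> nat \<Rightarrow> hck" where
  "Q_e k j = (\<Sum>s | s \<in> {1..j} \<rightarrow>\<^sub>E UNIV \<and> (\<Sum>i=1..j. i * s i) = j.
     scalar (fact ((\<Sum>i=1..j. s i) + k - 1) / ((\<Prod>i=1..j. fact (s i)) * fact (k - 1)))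
       * (\<Prod>i=1..j. c_e i ^ s i))"

definition P_v :: "nat \<Rightarrow> nat \<Rightarrow> hck" where
  "P_v n k = (if k = 0 then c_v 0 ^ (n + 1) else if k = n then c_v n
     else \<Sum>j=0..k. Q_v (n - k + 1) j * Q_e (2 * (n - k)) (k - j))"

definition P_e :: "nat \<Rightarrow> nat \<Rightarrow> hck" where
  "P_e n k = (if k = 0 then c_v 0 ^ n else if k = n then c_e n
     else \<Sum>j=0..k. Q_v (n - k) j * Q_e (2 * (n - k) - 1) (k - j))"

text \<open>Polynomials in the \<open>c_v i\<close> and \<open>c_e j\<close>: the subalgebra they generate.\<close>

inductive_set c_polynomials :: "hck set" where
  "scalar q \<in> c_polynomials"
| "c_v i \<in> c_polynomials"
| "c_e i \<in> c_polynomials"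
| "p \<in> c_polynomials \<Longrightarrow> q \<in> c_polynomials \<Longrightarrow> p + q \<in> c_polynomials"
| "p \<in> c_polynomials \<Longrightarrow> q \<in> c_polynomials \<Longrightarrow> p * q \<in> c_polynomials"

definition has_loop_order :: "nat \<Rightarrow> hck \<Rightarrow> bool" where
  "has_loop_order k p \<longleftrightarrow> (\<forall>m\<in>Poly_Mapping.keys p.
     (\<Sum>g\<in>#m. loop_number (SOME G. G \<in> Rep_generator g)) = k)"

end

theory Submission
  imports Defs "HOL-Computational_Algebra.Formal_Power_Series"
begin

text \<open>On a fixed set of \<open>N\<close> half edges every rooted connected graph has exactly \<open>N!\<close> labelled copies, since
  an automorphism fixing a half edge is trivial; so \<open>p / N!\<close> times a sum over all \<open>p\<close>-point graphs on
  that set is a sum over labelled graphs. In the coproduct one obtains a sum over pairs \<open>H \<subset> G\<close>. For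
  given \<open>H\<close>, the graph \<open>G\<close> is determined by \<open>K = G/H\<close>, a graph on the external half edges of \<open>H\<close> whose
  rotation is prescribed by \<open>H\<close>, and \<open>G\<close> is connected, bridgeless and planar with one boundary iff \<open>K\<close>
  is. The sum over \<open>K\<close> depends only on the numbers \<open>a\<close> and \<open>b\<close> of 4-point and 2-point components of
  \<open>H\<close>: deleting the bivalent vertices one by one, each of which can sit in two ways on any internal
  edge, reduces it to \<open>2\<^sup>b k (k + 1) \<dots> (k + b - 1)\<close> times the case \<open>b = 0\<close>, where \<open>k\<close> is the number of
  internal edges of \<open>\<pi> K\<close>; for \<open>b = 0\<close> it is again a sum over labelled graphs. The sum over \<open>H\<close> is a
  product of exponential generating functions. The factor \<open>k (k + 1) \<dots> (k + b - 1) / b!\<close> turns the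
  powers of the series of the \<open>c\<^sup>e\<close> into the multinomial coefficients of \<open>Q\<^sup>e\<close>.\<close>

section \<open>First returns of a permutation to a subset\<close>

text \<open>The link between \<open>H\<close> and \<open>K\<close> is a first-return map. A
  generator has exactly one boundary, so the face permutation of \<open>H\<close>, followed until it
  next meets an external half edge, permutes the external half edges of each component in a single
  cycle, of length 4 or 2; these cycles are the vertices of \<open>K\<close>. Faces of
  \<open>K\<close> and the deletion of bivalent vertices are handled by composing such maps. By
  Euler's formula there are \<open>n + 1\<close> vertices for 4-point and \<open>n\<close> for
  2-point graphs, so power series are graded by vertices. With \<open>a\<close> 4-point components
  in \<open>H\<close>, \<open>K\<close> stripped of bivalent vertices has \<open>2a - p/2\<close>
  internal edges; for \<open>a = n - k + 1\<close> or \<open>a = n - k\<close> these are the indices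
  \<open>2(n-k)\<close> and \<open>2(n-k) - 1\<close> of \<open>Q^e\<close>. The factor
  \<open>4^a a! 2^b\<close> in the sum over \<open>K\<close> cancels against the weight
  \<open>4^a a! 2^b b!\<close> in the count of the unions \<open>H\<close>, so only
  \<open>b!\<close> is left. The exception \<open>a = 0\<close> means that \<open>H = G\<close> is a
  2-point graph, contracted to the open edge; it supplies \<open>P^e_{n,n}\<close>, whereas
  \<open>P^v_{n,n}\<close> is the regular case \<open>a = 1\<close> with no internal edge.\<close>

lemma delete_outside_eqI:
  assumes "x \<in> S" "0 < m" "(p ^^ m) x \<in> S" "\<And>i. 0 < i \<Longrightarrow> i < m \<Longrightarrow> (p ^^ i) x \<notin> S"
  shows "delete_outside p S x = (p ^^ m) x"
proof -
  have "(LEAST m. 0 < m \<and> (p ^^ m) x \<in> S) = m"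
    using assms(2-4) by (metis (no_types, lifting) Least_equality not_le)
  then show ?thesis using assms(1) by (simp add: delete_outside_def)
qed

lemma delete_outside_step1: "x \<in> S \<Longrightarrow> p x \<in> S \<Longrightarrow> delete_outside p S x = p x"
  using delete_outside_eqI[of x S 1 p] by simp

lemma delete_outside_step2:
  assumes "x \<in> S" "p x \<notin> S" "p (p x) \<in> S" shows "delete_outside p S x = p (p x)"
proof -
  have "(p ^^ i) x \<notin> S" if "0 < i" "i < 2" for i
  proof -
    have "i = 1" using that by simp
    then show ?thesis using assms(2) by simp
  qed
  then show ?thesis using delete_outside_eqI[of x S 2 p] assms by (simp add: numeral_2_eq_2)
qed

lemma delete_outsideE:
  assumes "p permutes X" "finite X" "x \<in> S"
  obtains m where "0 < m" "(p ^^ m) x \<in> S" "\<And>i. 0 < i \<Longrightarrow> i < m \<Longrightarrow> (p ^^ i) x \<notin> S"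
    "delete_outside p S x = (p ^^ m) x"
proof -
  have "permutation p" using assms permutation_permutes by blast
  then obtain n where n: "(p ^^ n) x = x" "0 < n" using permutation_self by metis
  define m where "m = (LEAST m. 0 < m \<and> (p ^^ m) x \<in> S)"
  have "0 < m \<and> (p ^^ m) x \<in> S"
    unfolding m_def by (rule LeastI[of _ n]) (use n assms(3) in auto)
  moreover have "\<not> (0 < i \<and> (p ^^ i) x \<in> S)" if "i < m" for i
    using that unfolding m_def by (rule not_less_Least)
  ultimately show ?thesis
    using that assms(3) by (auto simp: delete_outside_def m_def[symmetric])
qed

text \<open>Injectivity by cancellation: if the first returns of \<open>x\<close> and
  \<open>y\<close> after \<open>m <= n\<close> steps coincide, cancelling \<open>p ^^ m\<close> puts
  \<open>x\<close> on the walk of \<open>y\<close> at time \<open>n - m\<close>, too early for a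
  return unless \<open>m = n\<close>. Finiteness of \<open>S\<close> then gives
  surjectivity.\<close>

lemma delete_outside_permutes:
  assumes p: "p permutes X" "finite X" and S: "S \<subseteq> X"
  shows "delete_outside p S permutes S"
proof -
  let ?q = "delete_outside p S"
  have fin: "finite S" using p S finite_subset by blast
  have le: "x = y" if x: "x \<in> S" "y \<in> S" "(p ^^ m) x = (p ^^ n) y" "m \<le> n" "0 < m"
    "\<And>i. 0 < i \<Longrightarrow> i < n \<Longrightarrow> (p ^^ i) y \<notin> S" for x y m n
  proof -
    have "bij (p ^^ m)" using p(1) by (simp add: bij_fn permutes_bij)
    moreover have "(p ^^ m) ((p ^^ (n - m)) y) = (p ^^ m) x"
      using that by (metis funpow_add le_add_diff_inverse o_apply)
    ultimately have "(p ^^ (n - m)) y = x" by (metis bij_is_inj injD)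
    then show ?thesis using that(6)[of "n - m"] x by (cases "n = m") auto
  qed
  have inj: "inj_on ?q S"
  proof (rule inj_onI)
    fix x y assume xy: "x \<in> S" "y \<in> S" "?q x = ?q y"
    from p xy(1) obtain m where m: "0 < m" "(p ^^ m) x \<in> S" "\<And>i. 0 < i \<Longrightarrow> i < m \<Longrightarrow> (p ^^ i) x \<notin> S"
      "?q x = (p ^^ m) x" by (rule delete_outsideE) blast
    from p xy(2) obtain n where n: "0 < n" "(p ^^ n) y \<in> S" "\<And>i. 0 < i \<Longrightarrow> i < n \<Longrightarrow> (p ^^ i) y \<notin> S"
      "?q y = (p ^^ n) y" by (rule delete_outsideE) blast
    show "x = y"
      using le[of x y m n] le[of y x n m] xy m n by (metis linear)
  qed
  have "?q x \<in> S" if "x \<in> S" for x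
    using p that by (rule delete_outsideE) simp
  then have "?q ` S = S" using inj fin by (metis endo_inj_surj image_subsetI)
  then show ?thesis
    using inj by (intro bij_imp_permutes) (auto simp: bij_betw_def delete_outside_def)
qed

text \<open>Between two visits to \<open>S\<close> the first-return map only skips points outside
  \<open>S\<close>. For the harder inclusion the induction is on the number of
  \<open>p\<close>-steps from \<open>x\<close> to \<open>y\<close>, one return being removed at a
  time.\<close>

lemma orbit_delete_outside:
  assumes p: "p permutes X" "finite X" and x: "x \<in> S"
  shows "orbit (delete_outside p S) x = orbit p x \<inter> S"
proof (intro equalityI subsetI)
  let ?q = "delete_outside p S"
  fix y assume "y \<in> orbit ?q x"
  then show "y \<in> orbit p x \<inter> S"
  proof induction
    case base
    from p x obtain m where "0 < m" "(p ^^ m) x \<in> S" "?q x = (p ^^ m) x"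
      by (rule delete_outsideE) blast
    then show ?case by (auto simp: orbit_altdef)
  next
    case (step y)
    from p IntD2[OF step.IH] obtain m where m: "0 < m" "(p ^^ m) y \<in> S" "?q y = (p ^^ m) y"
      by (rule delete_outsideE) blast
    then have "?q y \<in> orbit p y" by (auto simp: orbit_altdef)
    then show ?case using m step.IH orbit_trans by fastforce
  qed
next
  let ?q = "delete_outside p S"
  fix y assume y: "y \<in> orbit p x \<inter> S"
  then obtain n where "0 < n" "y = (p ^^ n) x" by (auto simp: orbit_altdef)
  then show "y \<in> orbit ?q x" using y x
  proof (induction n arbitrary: x rule: less_induct)
    case (less n)
    from p less.prems(4) obtain m where m: "0 < m" "(p ^^ m) x \<in> S"
      "\<And>i. 0 < i \<Longrightarrow> i < m \<Longrightarrow> (p ^^ i) x \<notin> S" "?q x = (p ^^ m) x"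
      by (rule delete_outsideE) blast
    have mn: "m \<le> n" using m(3)[of n] less.prems by (meson IntD2 not_le)
    show ?case
    proof (cases "m = n")
      case True then show ?thesis using m less.prems by (metis orbit.base)
    next
      case False
      have e: "(p ^^ (n - m)) (?q x) = y" using less.prems(2) m(4) mn
        by (metis funpow_add le_add_diff_inverse2 o_apply)
      have "y \<in> orbit ?q (?q x)"
      proof (rule less.IH)
        show "n - m < n" using m mn by simp
        show "0 < n - m" using False mn by simp
        show "y = (p ^^ (n - m)) (?q x)" using e by simp
        have "(p ^^ (n - m)) (?q x) \<in> orbit p (?q x)" using False mn
          unfolding orbit_altdef by (intro CollectI exI[of _ "n - m"]) auto
        then show "y \<in> orbit p (?q x) \<inter> S" using e less.prems by auto
        show "?q x \<in> S" using m by simp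
      qed
      then show ?thesis by (rule orbit_subset)
    qed
  qed
qed

text \<open>The first return to the smaller set is reached through successive visits to the larger
  one, so skipping in two stages equals skipping at once. This lets chains of bivalent vertices be
  shortened one vertex at a time.\<close>

lemma delete_outside_delete_outside:
  assumes p: "p permutes X" "finite X" and "S \<subseteq> X" "S' \<subseteq> S"
  shows "delete_outside (delete_outside p S) S' = delete_outside p S'"
proof
  let ?q = "delete_outside p S"
  fix x
  have main: "\<exists>M>0. (?q ^^ M) x = (p ^^ N) x \<and> (\<forall>i. 0 < i \<and> i < M \<longrightarrow> (?q ^^ i) x \<notin> S')"
    if "0 < N" "x \<in> S" "(p ^^ N) x \<in> S'" "\<And>i. 0 < i \<Longrightarrow> i < N \<Longrightarrow> (p ^^ i) x \<notin> S'" for N x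
    using that
  proof (induction N arbitrary: x rule: less_induct)
    case (less N)
    from p less.prems(2) obtain m where m: "0 < m" "(p ^^ m) x \<in> S"
      "\<And>i. 0 < i \<Longrightarrow> i < m \<Longrightarrow> (p ^^ i) x \<notin> S" "?q x = (p ^^ m) x"
      by (rule delete_outsideE) blast
    have mN: "m \<le> N" using m(3)[of N] less.prems assms(4) by (meson in_mono not_le)
    show ?case
    proof (cases "m = N")
      case True then show ?thesis using m by (intro exI[of _ 1]) auto
    next
      case False
      have e: "(p ^^ i) (?q x) = (p ^^ (i + m)) x" for i
        using m(4) by (metis funpow_add o_apply)
      have "\<exists>M>0. (?q ^^ M) (?q x) = (p ^^ (N - m)) (?q x) \<and>
          (\<forall>i. 0 < i \<and> i < M \<longrightarrow> (?q ^^ i) (?q x) \<notin> S')"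
      proof (rule less.IH)
        show "(p ^^ (N - m)) (?q x) \<in> S'" using e mN less.prems by auto
        show "(p ^^ i) (?q x) \<notin> S'" if "0 < i" "i < N - m" for i
          using that e less.prems(4)[of "i + m"] mN by auto
      qed (use m mN False in auto)
      then obtain M where M: "M > 0" "(?q ^^ M) (?q x) = (p ^^ (N - m)) (?q x)"
        "\<And>i. 0 < i \<Longrightarrow> i < M \<Longrightarrow> (?q ^^ i) (?q x) \<notin> S'" by blast
      have "?q x \<notin> S'" using m less.prems(4)[of m] mN False by auto
      have "(?q ^^ i) x \<notin> S'" if "0 < i" "i < Suc M" for i
        using that M(3)[of "i - 1"] \<open>?q x \<notin> S'\<close>
        by (cases i) (auto simp: funpow_Suc_right simp del: funpow.simps, metis funpow_0 gr0I)
      then show ?thesis using M e[of "N - m"] mN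
        by (intro exI[of _ "Suc M"]) (auto simp: funpow_Suc_right simp del: funpow.simps)
    qed
  qed
  show "delete_outside ?q S' x = delete_outside p S' x"
  proof (cases "x \<in> S'")
    case True
    from p True obtain N where N: "0 < N" "(p ^^ N) x \<in> S'"
      "\<And>i. 0 < i \<Longrightarrow> i < N \<Longrightarrow> (p ^^ i) x \<notin> S'" "delete_outside p S' x = (p ^^ N) x"
      by (rule delete_outsideE) blast
    with main[of N x] True assms(4) obtain M where "M > 0" "(?q ^^ M) x = (p ^^ N) x"
      "\<And>i. 0 < i \<Longrightarrow> i < M \<Longrightarrow> (?q ^^ i) x \<notin> S'" by blast
    then show ?thesis using delete_outside_eqI[of x S' M ?q] N True by simp
  qed (simp add: delete_outside_def)
qed

text \<open>As \<open>b\<close> fixes everything outside \<open>S\<close>, the two walks agree until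
  they first re-enter \<open>S\<close>, where \<open>b\<close> acts once on the result. With
  \<open>b = flip K\<close> this relates the face permutations of \<open>G\<close> and
  \<open>K\<close>.\<close>

lemma delete_outside_comp:
  assumes p: "p permutes X" "finite X" and b: "b permutes S"
  shows "delete_outside (b \<circ> p) S = b \<circ> delete_outside p S"
proof
  fix x
  show "delete_outside (b \<circ> p) S x = (b \<circ> delete_outside p S) x"
  proof (cases "x \<in> S")
    case True
    from p True obtain N where N: "0 < N" "(p ^^ N) x \<in> S"
      "\<And>i. 0 < i \<Longrightarrow> i < N \<Longrightarrow> (p ^^ i) x \<notin> S" "delete_outside p S x = (p ^^ N) x"
      by (rule delete_outsideE) blast
    have eq: "((b \<circ> p) ^^ i) x = (p ^^ i) x" if "i < N" for i
      using that
    proof (induction i)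
      case (Suc i)
      then have "(p ^^ Suc i) x \<notin> S" using N(3) by blast
      then show ?case using Suc permutes_not_in[OF b] by simp
    qed simp
    have "((b \<circ> p) ^^ N) x = b ((p ^^ N) x)"
      using eq[of "N - 1"] N(1) by (cases N) auto
    moreover have "b ((p ^^ N) x) \<in> S" using N(2) b by (simp add: permutes_in_image)
    ultimately show ?thesis using N eq True by (simp add: delete_outside_eqI[of x S N])
  qed (use permutes_not_in[OF b] in \<open>simp add: delete_outside_def\<close>)
qed

section \<open>Cycles of a finite permutation\<close>

lemma orbit_subset_closed:
  assumes "p ` A \<subseteq> A" "x \<in> A" shows "orbit p x \<subseteq> A"
proof
  fix y assume "y \<in> orbit p x" then show "y \<in> A" by induction (use assms in auto)
qed

lemma orbit_sym:
  assumes "p permutes X" "finite X" "y \<in> orbit p x"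
  shows "x \<in> orbit p y" "orbit p y = orbit p x"
proof -
  have "permutation p" using assms permutation_permutes by blast
  then have "cyclic_on p (orbit p x)" by (rule cyclic_on_orbit')
  then show "orbit p y = orbit p x" using assms orbit_cyclic_eq3 by metis
  then show "x \<in> orbit p y" using permutation_self_in_orbit[OF \<open>permutation p\<close>] by simp
qed

lemma self_in_orbit:
  assumes "p permutes X" "finite X" shows "x \<in> orbit p x"
  using assms permutation_permutes permutation_self_in_orbit by metis

lemma orbit_swapped_pair:
  assumes "p permutes X" "finite X" "p x = y" "p y = x"
  shows "orbit p x = {x, y}" "orbit p y = {x, y}"
proof -
  have "p ` {x, y} \<subseteq> {x, y}" using assms by simp
  moreover have "y \<in> orbit p x" "x \<in> orbit p y" using orbit.base[of p] assms by metis+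
  ultimately show "orbit p x = {x, y}" "orbit p y = {x, y}"
    using orbit_subset_closed[of p "{x, y}"] self_in_orbit[OF assms(1,2)] by (simp_all add: subset_antisym)
qed

lemma cycles_of_disjoint:
  assumes "p permutes X" "finite X" "c \<in> cycles_of p X" "d \<in> cycles_of p X" "c \<noteq> d"
  shows "c \<inter> d = {}"
proof (rule ccontr)
  assume "c \<inter> d \<noteq> {}"
  then obtain z where "z \<in> c" "z \<in> d" by blast
  then have "c = orbit p z" "d = orbit p z"
    using assms(3,4) orbit_sym(2)[OF assms(1,2)] by (auto simp: cycles_of_def)
  then show False using assms(5) by simp
qed

lemma Union_cycles_of:
  assumes "p permutes X" "finite X" shows "\<Union>(cycles_of p X) = X"
  using self_in_orbit[OF assms] permutes_orbit_subset[OF assms(1)] by (fastforce simp: cycles_of_def)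

lemma finite_cycles_of: "finite X \<Longrightarrow> finite (cycles_of p X)"
  by (simp add: cycles_of_def)

lemma sum_card_cycles_of:
  assumes "p permutes X" "finite X" shows "sum card (cycles_of p X) = card X"
proof -
  have "card (\<Union>(cycles_of p X)) = sum card (cycles_of p X)"
  proof (rule card_Union_disjoint)
    show "pairwise disjnt (cycles_of p X)"
      using cycles_of_disjoint[OF assms] unfolding pairwise_def disjnt_def by blast
    show "finite c" if "c \<in> cycles_of p X" for c
      using that Union_cycles_of[OF assms] assms(2) by (metis Union_upper finite_subset)
  qed
  then show ?thesis using Union_cycles_of[OF assms] by simp
qed

text \<open>Cycles that miss \<open>S\<close> disappear and the others shrink to their trace on
  \<open>S\<close>; different cycles keep different traces because they are disjoint.\<close>

lemma bij_betw_cycles_delete_outside: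
  assumes p: "p permutes X" "finite X" and S: "S \<subseteq> X"
  shows "bij_betw (\<lambda>c. c \<inter> S) {c \<in> cycles_of p X. c \<inter> S \<noteq> {}} (cycles_of (delete_outside p S) S)"
  unfolding bij_betw_def
proof
  show "inj_on (\<lambda>c. c \<inter> S) {c \<in> cycles_of p X. c \<inter> S \<noteq> {}}"
    using cycles_of_disjoint[OF p] by (fastforce intro!: inj_onI)
  show "(\<lambda>c. c \<inter> S) ` {c \<in> cycles_of p X. c \<inter> S \<noteq> {}} = cycles_of (delete_outside p S) S"
  proof (intro equalityI subsetI)
    fix d assume "d \<in> (\<lambda>c. c \<inter> S) ` {c \<in> cycles_of p X. c \<inter> S \<noteq> {}}"
    then obtain x z where "d = orbit p x \<inter> S" "z \<in> orbit p x" "z \<in> S"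
      by (auto simp: cycles_of_def)
    then show "d \<in> cycles_of (delete_outside p S) S"
      using orbit_sym(2)[OF p] orbit_delete_outside[OF p] by (auto simp: cycles_of_def)
  next
    fix d assume "d \<in> cycles_of (delete_outside p S) S"
    then obtain x where "x \<in> S" "d = orbit (delete_outside p S) x" by (auto simp: cycles_of_def)
    moreover have "x \<in> orbit p x \<inter> S" using self_in_orbit[OF p] \<open>x \<in> S\<close> by blast
    ultimately show "d \<in> (\<lambda>c. c \<inter> S) ` {c \<in> cycles_of p X. c \<inter> S \<noteq> {}}"
      using orbit_delete_outside[OF p] S
      by (intro image_eqI[of _ _ "orbit p x"]) (auto simp: cycles_of_def)
  qed
qed

text \<open>With \<open>S\<close> the surviving and \<open>T\<close> the external half edges this
  compares numbers of boundaries.\<close>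

lemma card_cycles_meeting:
  assumes p: "p permutes X" "finite X" and S: "S \<subseteq> X" and T: "T \<subseteq> S"
  shows "card {c \<in> cycles_of (delete_outside p S) S. c \<inter> T \<noteq> {}} = card {c \<in> cycles_of p X. c \<inter> T \<noteq> {}}"
proof -
  let ?q = "delete_outside p S"
  have B: "bij_betw (\<lambda>c. c \<inter> S) {c \<in> cycles_of p X. c \<inter> S \<noteq> {}} (cycles_of ?q S)"
    by (rule bij_betw_cycles_delete_outside[OF p S])
  have i: "c \<inter> S \<inter> T = c \<inter> T" for c using T by blast
  have "bij_betw (\<lambda>c. c \<inter> S) {c \<in> cycles_of p X. c \<inter> T \<noteq> {}} {c \<in> cycles_of ?q S. c \<inter> T \<noteq> {}}"
  proof (rule bij_betw_subset[OF B])
    show "{c \<in> cycles_of p X. c \<inter> T \<noteq> {}} \<subseteq> {c \<in> cycles_of p X. c \<inter> S \<noteq> {}}" using T by blast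
    have "{c \<in> cycles_of ?q S. c \<inter> T \<noteq> {}} =
        (\<lambda>c. c \<inter> S) ` {c \<in> {c \<in> cycles_of p X. c \<inter> S \<noteq> {}}. c \<inter> S \<inter> T \<noteq> {}}"
      unfolding bij_betw_imp_surj_on[OF B, symmetric] by blast
    also have "{c \<in> {c \<in> cycles_of p X. c \<inter> S \<noteq> {}}. c \<inter> S \<inter> T \<noteq> {}} = {c \<in> cycles_of p X. c \<inter> T \<noteq> {}}"
      unfolding i using T by auto
    finally show "(\<lambda>c. c \<inter> S) ` {c \<in> cycles_of p X. c \<inter> T \<noteq> {}} = {c \<in> cycles_of ?q S. c \<inter> T \<noteq> {}}"
      by (rule sym)
  qed
  from bij_betw_same_card[OF this] show ?thesis by (rule sym)
qed

lemma involution_permutes: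
  assumes "\<And>x. f (f x) = x" "\<And>x. x \<notin> S \<Longrightarrow> f x = x" shows "f permutes S"
  unfolding permutes_def using assms by metis

lemma involution_orbit:
  assumes "\<And>x. f (f x) = x" shows "orbit f x = {x, f x}"
proof (intro equalityI subsetI)
  fix y assume "y \<in> orbit f x" then show "y \<in> {x, f x}" by induction (use assms in auto)
next
  fix y assume "y \<in> {x, f x}" then show "y \<in> orbit f x" using assms orbit.intros by (metis insertE singletonD)
qed

section \<open>Closed sets of half edges\<close>

text \<open>Stable sets replace the path relation \<open>linked\<close>: components are the minimal
  nonempty ones, and connectedness and bridges become statements about which sets are stable. Such
  statements transfer easily between graphs with different half edges.\<close>

definition closed_in :: "'h ribbon \<Rightarrow> 'h set \<Rightarrow> bool" where
  "closed_in G A \<longleftrightarrow> A \<subseteq> half_edges G \<and> vrot G ` A \<subseteq> A \<and> flip G ` A \<subseteq> A"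

text \<open>Going forward along a finite cycle eventually returns, so forward closure already gives
  closure under the inverse.\<close>

lemma permutes_closed_iff:
  assumes "p permutes X" "finite X" "p ` A \<subseteq> A" shows "p x \<in> A \<longleftrightarrow> x \<in> A"
  using orbit_subset_closed[OF assms(3)] orbit_sym(1)[OF assms(1,2) orbit.base] assms(3) by blast

context
  fixes G :: "'h ribbon"
  assumes G: "ribbon_graph G"
begin

lemma ribbonD: "finite (half_edges G)" "vrot G permutes half_edges G" "flip G permutes half_edges G"
  "flip G (flip G h) = h"
  using G by (auto simp: ribbon_graph_def)

lemma vrot_in: "vrot G h \<in> half_edges G \<longleftrightarrow> h \<in> half_edges G"
  and flip_in: "flip G h \<in> half_edges G \<longleftrightarrow> h \<in> half_edges G"
  using ribbonD by (auto simp: permutes_in_image)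

lemma closed_in_half_edges: "closed_in G (half_edges G)"
  by (auto simp: closed_in_def vrot_in flip_in)

lemma closed_in_vrot: "closed_in G A \<Longrightarrow> vrot G x \<in> A \<longleftrightarrow> x \<in> A"
  and closed_in_flip: "closed_in G A \<Longrightarrow> flip G x \<in> A \<longleftrightarrow> x \<in> A"
  using ribbonD permutes_closed_iff unfolding closed_in_def by metis+

lemma closed_in_Diff: "closed_in G A \<Longrightarrow> closed_in G B \<Longrightarrow> closed_in G (A - B)"
  using closed_in_vrot closed_in_flip by (auto simp: closed_in_def[of G "A - B"]) (auto simp: closed_in_def)

lemma linked_iff:
  assumes x: "x \<in> half_edges G"
  shows "(x, y) \<in> linked G \<longleftrightarrow> (\<forall>A. closed_in G A \<longrightarrow> x \<in> A \<longrightarrow> y \<in> A)"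
proof
  assume "(x, y) \<in> linked G"
  then show "\<forall>A. closed_in G A \<longrightarrow> x \<in> A \<longrightarrow> y \<in> A"
    unfolding linked_def Let_def
    by (induction rule: rtrancl_induct) (auto simp: closed_in_vrot closed_in_flip)
next
  assume *: "\<forall>A. closed_in G A \<longrightarrow> x \<in> A \<longrightarrow> y \<in> A"
  let ?A = "{y \<in> half_edges G. (x, y) \<in> linked G}"
  have "(y, vrot G y) \<in> linked G" "(y, flip G y) \<in> linked G" if "y \<in> half_edges G" for y
    unfolding linked_def Let_def using that by blast+
  moreover have "trans (linked G)" by (simp add: linked_def Let_def trans_rtrancl)
  ultimately have "closed_in G ?A"
    unfolding closed_in_def by (auto simp: vrot_in flip_in dest: transD)
  moreover have "x \<in> ?A" using x by (auto simp: linked_def Let_def)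
  ultimately show "(x, y) \<in> linked G" using * by blast
qed

lemma linked_Image:
  assumes x: "x \<in> half_edges G"
  shows "closed_in G (linked G `` {x})" "x \<in> linked G `` {x}"
    "closed_in G A \<Longrightarrow> x \<in> A \<Longrightarrow> linked G `` {x} \<subseteq> A"
proof -
  have eq: "linked G `` {x} = \<Inter>{A. closed_in G A \<and> x \<in> A}"
    using linked_iff[OF x] by auto
  show "x \<in> linked G `` {x}" "closed_in G A \<Longrightarrow> x \<in> A \<Longrightarrow> linked G `` {x} \<subseteq> A"
    unfolding eq by blast+
  show "closed_in G (linked G `` {x})"
    unfolding eq closed_in_def[of G "\<Inter>_"] using closed_in_half_edges x closed_in_vrot closed_in_flip
    by auto
qed

lemma component_closed: "C \<in> components G \<Longrightarrow> closed_in G C"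
  and component_nonempty: "C \<in> components G \<Longrightarrow> C \<noteq> {}"
  and component_subset: "C \<in> components G \<Longrightarrow> C \<subseteq> half_edges G"
proof -
  assume "C \<in> components G"
  then obtain x where x: "x \<in> half_edges G" "C = linked G `` {x}" by (auto simp: components_def)
  show "closed_in G C" "C \<noteq> {}" using linked_Image(1,2)[OF x(1)] x(2) by auto
  then show "C \<subseteq> half_edges G" by (simp add: closed_in_def)
qed

text \<open>If the base point of the component were outside \<open>A\<close>, the complement of
  \<open>A\<close>, which is closed too, would contain the whole component including
  \<open>x\<close>.\<close>

lemma component_least:
  assumes C: "C \<in> components G" and A: "closed_in G A" and x: "x \<in> A" "x \<in> C"
  shows "C \<subseteq> A"
proof -
  obtain y where y: "y \<in> half_edges G" "C = linked G `` {y}" using C by (auto simp: components_def)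
  have "y \<in> A"
  proof (rule ccontr)
    assume "y \<notin> A"
    then have "C \<subseteq> half_edges G - A"
      unfolding y(2) using y(1) closed_in_Diff[OF closed_in_half_edges A] by (intro linked_Image(3)) auto
    then show False using x by blast
  qed
  then show ?thesis using linked_Image(3)[OF y(1) A] y(2) by blast
qed

lemma components_disjoint:
  "C \<in> components G \<Longrightarrow> D \<in> components G \<Longrightarrow> C \<noteq> D \<Longrightarrow> C \<inter> D = {}"
  using component_least component_closed by (metis disjoint_iff subset_antisym)

lemma Union_components: "\<Union>(components G) = half_edges G"
  using linked_Image by (auto simp: components_def closed_in_def)

lemma component_ex: "x \<in> half_edges G \<Longrightarrow> \<exists>C\<in>components G. x \<in> C"
  using Union_components by blast

lemma finite_components: "finite (components G)"
  using ribbonD by (simp add: components_def)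

lemma components_eqI:
  assumes "\<And>C. C \<in> \<C> \<Longrightarrow> closed_in G C" "\<And>C. C \<in> \<C> \<Longrightarrow> C \<noteq> {}" "\<Union>\<C> = half_edges G"
    "\<And>C A x. C \<in> \<C> \<Longrightarrow> closed_in G A \<Longrightarrow> x \<in> A \<Longrightarrow> x \<in> C \<Longrightarrow> C \<subseteq> A"
  shows "components G = \<C>"
proof -
  have 1: "linked G `` {x} = C" if "C \<in> \<C>" "x \<in> C" for C x
  proof -
    have "x \<in> half_edges G" using that assms(3) by blast
    then show ?thesis using linked_Image[of x] assms(1,4)[OF that(1)] that by (metis subset_antisym)
  qed
  show ?thesis
  proof (intro equalityI subsetI)
    fix D assume "D \<in> components G"
    then show "D \<in> \<C>" using 1 assms(3) by (fastforce simp: components_def)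
  next
    fix D assume "D \<in> \<C>"
    then show "D \<in> components G" using 1 assms(2)[of D] assms(3) unfolding components_def by blast
  qed
qed

lemma connected_ribbon_iff:
  "connected_ribbon G \<longleftrightarrow> (\<forall>A. closed_in G A \<longrightarrow> A \<noteq> {} \<longrightarrow> A = half_edges G)"
proof
  assume c: "connected_ribbon G"
  show "\<forall>A. closed_in G A \<longrightarrow> A \<noteq> {} \<longrightarrow> A = half_edges G"
  proof (intro allI impI)
    fix A assume A: "closed_in G A" "A \<noteq> {}"
    then obtain x where x: "x \<in> A" "x \<in> half_edges G" by (auto simp: closed_in_def)
    then have "half_edges G \<subseteq> A" using c A unfolding connected_ribbon_def using linked_iff by blast
    then show "A = half_edges G" using A by (auto simp: closed_in_def)
  qed
next
  assume *: "\<forall>A. closed_in G A \<longrightarrow> A \<noteq> {} \<longrightarrow> A = half_edges G"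
  then show "connected_ribbon G" unfolding connected_ribbon_def using linked_iff by blast
qed

lemma connected_components:
  assumes "connected_ribbon G" "half_edges G \<noteq> {}" shows "components G = {half_edges G}"
proof (rule components_eqI)
  have "A = half_edges G" if "closed_in G A" "x \<in> A" for A x
    using assms(1) that unfolding connected_ribbon_iff by blast
  then show "\<And>C A x. C \<in> {half_edges G} \<Longrightarrow> closed_in G A \<Longrightarrow> x \<in> A \<Longrightarrow> x \<in> C \<Longrightarrow> C \<subseteq> A"
    by blast
qed (use assms(2) closed_in_half_edges in simp_all)

lemma internal_edges_eq:
  "internal_edges G = {{x, flip G x} | x. x \<in> half_edges G \<and> flip G x \<noteq> x}"
proof -
  have o: "orbit (flip G) x = {x, flip G x}" for x using ribbonD by (intro involution_orbit) auto
  have "card {x, flip G x} = 2 \<longleftrightarrow> flip G x \<noteq> x" for x by (auto simp: card_insert_if)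
  then show ?thesis unfolding internal_edges_def cycles_of_def o by auto
qed

lemma card_internal_edges: "2 * card (internal_edges G) = card {x \<in> half_edges G. flip G x \<noteq> x}"
proof -
  have "card (\<Union>(internal_edges G)) = sum card (internal_edges G)"
  proof (rule card_Union_disjoint)
    show "pairwise disjnt (internal_edges G)"
      unfolding internal_edges_eq pairwise_def disjnt_def using ribbonD(4) by auto metis+
  qed (auto simp: internal_edges_eq)
  also have "\<dots> = (\<Sum>e\<in>internal_edges G. 2)" by (rule sum.cong) (auto simp: internal_edges_def)
  also have "\<Union>(internal_edges G) = {x \<in> half_edges G. flip G x \<noteq> x}"
    unfolding internal_edges_eq using ribbonD(4) flip_in by auto
  finally show ?thesis by simp
qed

lemma ribbon_graph_cut_edge:
  assumes "x \<in> half_edges G" shows "ribbon_graph (cut_edge G {x, flip G x})"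
proof -
  let ?f = "\<lambda>h. if h \<in> {x, flip G x} then h else flip G h"
  have inv: "?f (?f h) = h" for h using ribbonD(4) by auto metis
  have out: "?f h = h" if "h \<notin> half_edges G" for h using permutes_not_in[OF ribbonD(3) that] by simp
  have "?f permutes half_edges G" by (rule involution_permutes[OF inv out])
  then show ?thesis
    using ribbonD(1,2) by (simp add: ribbon_graph_def cut_edge_def) (metis ribbonD(4))
qed

lemma closed_in_cut_edge:
  "closed_in (cut_edge G e) A \<longleftrightarrow>
    A \<subseteq> half_edges G \<and> vrot G ` A \<subseteq> A \<and> (\<forall>h\<in>A. h \<notin> e \<longrightarrow> flip G h \<in> A)"
  by (auto simp: closed_in_def cut_edge_def)

end

text \<open>The closed sets are exactly the unions of components, so each of the two families
  determines the other.\<close>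

lemma components_eq_iff:
  assumes G: "ribbon_graph G" and G': "ribbon_graph G'" and h: "half_edges G = half_edges G'"
  shows "components G = components G' \<longleftrightarrow> (\<forall>A. closed_in G A \<longleftrightarrow> closed_in G' A)"
proof
  have char: "closed_in G A \<longleftrightarrow> A \<subseteq> half_edges G \<and> (\<forall>C\<in>components G. C \<inter> A \<noteq> {} \<longrightarrow> C \<subseteq> A)"
    if G: "ribbon_graph G" for G :: "'a ribbon" and A
  proof
    assume A: "closed_in G A"
    then have "A \<subseteq> half_edges G" by (simp add: closed_in_def)
    moreover have "C \<subseteq> A" if "C \<in> components G" "C \<inter> A \<noteq> {}" for C
      using component_least[OF G that(1) A] that(2) by blast
    ultimately show "A \<subseteq> half_edges G \<and> (\<forall>C\<in>components G. C \<inter> A \<noteq> {} \<longrightarrow> C \<subseteq> A)"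
      by blast
  next
    assume *: "A \<subseteq> half_edges G \<and> (\<forall>C\<in>components G. C \<inter> A \<noteq> {} \<longrightarrow> C \<subseteq> A)"
    have "vrot G x \<in> A \<and> flip G x \<in> A" if "x \<in> A" for x
    proof -
      have "x \<in> half_edges G" using * that by blast
      then obtain C where C: "C \<in> components G" "x \<in> C" using component_ex[OF G] by blast
      then have "vrot G x \<in> C" "flip G x \<in> C" "C \<subseteq> A"
        using * that component_closed[OF G C(1)] by (auto simp: closed_in_def)
      then show ?thesis by blast
    qed
    then show "closed_in G A" using * by (auto simp: closed_in_def)
  qed
  assume c: "components G = components G'"
  show "\<forall>A. closed_in G A \<longleftrightarrow> closed_in G' A"
    by (intro allI) (simp only: char[OF G] char[OF G'] h c)
next
  assume c: "\<forall>A. closed_in G A \<longleftrightarrow> closed_in G' A"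
  have "linked G `` {x} = linked G' `` {x}" if x: "x \<in> half_edges G'" for x
  proof -
    have x': "x \<in> half_edges G" using x by (simp only: h)
    show ?thesis
      by (intro set_eqI) (simp only: Image_singleton_iff linked_iff[OF G x'] linked_iff[OF G' x] c)
  qed
  then show "components G = components G'"
    unfolding components_def h by (rule image_cong[OF refl])
qed

text \<open>Cutting an edge can only create new closed sets, namely those that contain one end
  without the other; the components stay the same iff there are none. One implication suffices
  because \<open>x\<close> ranges over both ends of the edge.\<close>

lemma bridgeless_iff:
  assumes G: "ribbon_graph G"
  shows "bridgeless G \<longleftrightarrow> (\<forall>x\<in>half_edges G. \<forall>A. flip G x \<noteq> x \<longrightarrow>
    closed_in (cut_edge G {x, flip G x}) A \<longrightarrow> x \<in> A \<longrightarrow> flip G x \<in> A)"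
proof -
  have sym: "{flip G x, flip G (flip G x)} = {x, flip G x}" for x using ribbonD(4)[OF G] by auto
  have "components (cut_edge G {x, flip G x}) = components G \<longleftrightarrow>
      (\<forall>A. closed_in (cut_edge G {x, flip G x}) A \<longrightarrow> (x \<in> A \<longleftrightarrow> flip G x \<in> A))"
    if x: "x \<in> half_edges G" for x
  proof -
    have "(closed_in (cut_edge G {x, flip G x}) A \<longleftrightarrow> closed_in G A) \<longleftrightarrow>
      (closed_in (cut_edge G {x, flip G x}) A \<longrightarrow> (x \<in> A \<longleftrightarrow> flip G x \<in> A))" for A
      using closed_in_flip[OF G, of A x] ribbonD(4)[OF G]
      unfolding closed_in_cut_edge[OF G] by (auto simp: closed_in_def)
    then show ?thesis
      using components_eq_iff[OF ribbon_graph_cut_edge[OF G x] G] by (simp add: cut_edge_def)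
  qed
  then have "bridgeless G \<longleftrightarrow> (\<forall>x\<in>half_edges G. flip G x \<noteq> x \<longrightarrow>
      (\<forall>A. closed_in (cut_edge G {x, flip G x}) A \<longrightarrow> (x \<in> A \<longleftrightarrow> flip G x \<in> A)))"
    unfolding bridgeless_def internal_edges_eq[OF G] by (smt (verit, best) mem_Collect_eq)
  also have "\<dots> \<longleftrightarrow> (\<forall>x\<in>half_edges G. \<forall>A. flip G x \<noteq> x \<longrightarrow>
    closed_in (cut_edge G {x, flip G x}) A \<longrightarrow> x \<in> A \<longrightarrow> flip G x \<in> A)"
    using sym flip_in[OF G] ribbonD(4)[OF G] by (metis (no_types, opaque_lifting))
  finally show ?thesis .
qed

section \<open>Restricted permutations and counts over a partition\<close>

lemma perm_restrict_permutes:
  assumes "p permutes X" "finite X" "A \<subseteq> X" "p ` A \<subseteq> A"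
  shows "perm_restrict p A permutes A"
proof -
  have "inj_on p A" using assms(1) by (meson inj_on_subset permutes_inj subset_UNIV)
  moreover from this have "p ` A = A" using assms by (meson endo_inj_surj finite_subset)
  ultimately have "bij_betw (perm_restrict p A) A A"
    by (simp add: bij_betw_def perm_restrict_def cong: inj_on_cong image_cong)
  then show ?thesis by (rule bij_imp_permutes) (simp add: perm_restrict_def)
qed

lemma orbit_perm_restrict:
  assumes "p ` A \<subseteq> A" "x \<in> A" shows "orbit (perm_restrict p A) x = orbit p x"
  by (rule orbit_cong0[of _ A]) (use assms in \<open>auto simp: perm_restrict_def\<close>)

lemma cycles_of_perm_restrict:
  "p ` A \<subseteq> A \<Longrightarrow> cycles_of (perm_restrict p A) A = cycles_of p A"
  unfolding cycles_of_def by (intro image_cong refl orbit_perm_restrict)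

lemma card_cycles_of_partition:
  assumes fin: "finite \<C>" "\<And>C. C \<in> \<C> \<Longrightarrow> finite C"
    and cl: "\<And>C. C \<in> \<C> \<Longrightarrow> p ` C \<subseteq> C"
    and disj: "\<And>C D. C \<in> \<C> \<Longrightarrow> D \<in> \<C> \<Longrightarrow> C \<noteq> D \<Longrightarrow> C \<inter> D = {}"
  shows "card {c \<in> cycles_of p (\<Union>\<C>). P c} = (\<Sum>C\<in>\<C>. card {c \<in> cycles_of p C. P c})"
proof -
  have "{c \<in> cycles_of p (\<Union>\<C>). P c} = (\<Union>C\<in>\<C>. {c \<in> cycles_of p C. P c})"
    unfolding cycles_of_def by blast
  also have "card \<dots> = (\<Sum>C\<in>\<C>. card {c \<in> cycles_of p C. P c})"
  proof (rule card_UN_disjoint)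
    have sub: "c \<subseteq> C \<and> c \<noteq> {}" if "C \<in> \<C>" "c \<in> cycles_of p C" for c C
    proof -
      from that(2) obtain x where "x \<in> C" "c = orbit p x" by (auto simp: cycles_of_def)
      then show ?thesis using orbit_subset_closed[OF cl[OF that(1)]] orbit_nonempty[of p x] by simp
    qed
    show "\<forall>C\<in>\<C>. \<forall>D\<in>\<C>. C \<noteq> D \<longrightarrow> {c \<in> cycles_of p C. P c} \<inter> {c \<in> cycles_of p D. P c} = {}"
    proof (intro ballI impI equals0I)
      fix C D c assume "C \<in> \<C>" "D \<in> \<C>" "C \<noteq> D" "c \<in> {c \<in> cycles_of p C. P c} \<inter> {c \<in> cycles_of p D. P c}"
      moreover from this have "C \<inter> D = {}" by (intro disj)
      ultimately show False using sub[of C c] sub[of D c] by auto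
    qed
  qed (use fin in \<open>simp_all add: finite_cycles_of\<close>)
  finally show ?thesis .
qed

lemma card_Collect_partition:
  assumes fin: "finite \<C>" "\<And>C. C \<in> \<C> \<Longrightarrow> finite C"
    and disj: "\<And>C D. C \<in> \<C> \<Longrightarrow> D \<in> \<C> \<Longrightarrow> C \<noteq> D \<Longrightarrow> C \<inter> D = {}"
  shows "card {x \<in> \<Union>\<C>. P x} = (\<Sum>C\<in>\<C>. card {x \<in> C. P x})"
proof -
  have "{x \<in> \<Union>\<C>. P x} = (\<Union>C\<in>\<C>. {x \<in> C. P x})" by blast
  also have "card \<dots> = (\<Sum>C\<in>\<C>. card {x \<in> C. P x})"
  proof (rule card_UN_disjoint)
    show "\<forall>C\<in>\<C>. \<forall>D\<in>\<C>. C \<noteq> D \<longrightarrow> {x \<in> C. P x} \<inter> {x \<in> D. P x} = {}"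
    proof (intro ballI impI)
      fix C D assume "C \<in> \<C>" "D \<in> \<C>" "C \<noteq> D"
      then have "C \<inter> D = {}" by (rule disj)
      then show "{x \<in> C. P x} \<inter> {x \<in> D. P x} = {}" by auto
    qed
  qed (use fin in simp_all)
  finally show ?thesis .
qed

text \<open>\<open>flip G\<close> after \<open>vrot G\<close> is the inverse of the face permutation
  and so has the same cycles. In this form it matches the permutation from which
  \<open>contract\<close> builds its vertices.\<close>

lemma faces_eq:
  assumes "ribbon_graph G" shows "faces G = cycles_of (flip G \<circ> vrot G) (half_edges G)"
proof -
  note G = ribbonD[OF assms]
  have p: "flip G \<circ> vrot G permutes half_edges G" using G permutes_compose by blast
  have "inv (flip G) = flip G" using G(4) by (intro inv_equality) auto
  then have "inv (vrot G) \<circ> flip G = inv (flip G \<circ> vrot G)"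
    using G by (simp add: o_inv_distrib permutes_bij)
  moreover have "permutation (flip G \<circ> vrot G)" using p G(1) permutation_permutes by blast
  ultimately show ?thesis by (simp add: faces_def cycles_of_def orbit_inv_eq)
qed

lemma face_permutes:
  "ribbon_graph G \<Longrightarrow> flip G \<circ> vrot G permutes half_edges G"
  using ribbonD permutes_compose by blast

text \<open>Euler's relation without division or subtraction, so that later comparisons of counts
  are linear arithmetic over \<open>nat\<close>.\<close>

lemma genus_eq_0_iff:
  "genus G = 0 \<longleftrightarrow> card (vertices G) + card (faces G) = card (internal_edges G) + 2"
proof -
  have "genus G = 0 \<longleftrightarrow> (of_nat (card (vertices G) + card (faces G)) :: rat) =
      of_nat (card (internal_edges G) + 2)"
    by (auto simp: genus_def)
  then show ?thesis by (simp only: of_nat_eq_iff)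
qed

section \<open>Contraction of a union of generators\<close>

text \<open>A generating graph without the condition on degrees: contracted graphs also have
  bivalent vertices, and this weaker notion is the one that contraction and the removal of a
  bivalent vertex both respect.\<close>

definition planar_ribbon :: "nat \<Rightarrow> 'h ribbon \<Rightarrow> bool" where
  "planar_ribbon p G \<longleftrightarrow> ribbon_graph G \<and> connected_ribbon G \<and> bridgeless G \<and> genus G = 0 \<and>
     card (boundaries G) = 1 \<and> card (external G) = p"

text \<open>Every external half edge lies on some boundary, so a unique boundary contains them all
  and its length is their total number.\<close>

lemma boundary_condition_iff:
  assumes G: "ribbon_graph G"
  shows "(\<exists>b. boundaries G = {b} \<and> card (b \<inter> external G) = p) \<longleftrightarrow>
    card (boundaries G) = 1 \<and> card (external G) = p"
proof -
  have "external G \<subseteq> b" if "boundaries G = {b}" for b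
  proof
    fix x assume x: "x \<in> external G"
    then have "x \<in> \<Union>(faces G)"
      using Union_cycles_of[OF face_permutes[OF G]] ribbonD(1)[OF G] faces_eq[OF G]
      by (auto simp: external_def)
    then obtain f where "f \<in> faces G" "x \<in> f" by blast
    then have "f \<in> boundaries G" using x by (auto simp: boundaries_def)
    then show "x \<in> b" using that \<open>x \<in> f\<close> by blast
  qed
  then have "b \<inter> external G = external G" if "boundaries G = {b}" for b
    using that by blast
  then show ?thesis by (metis card_1_singletonE is_singletonI is_singleton_altdef)
qed

lemma generating_graph_iff:
  "generating_graph p G \<longleftrightarrow> planar_ribbon p G \<and> (\<forall>w\<in>vertices G. card w = 4)"
  using boundary_condition_iff[of G p] unfolding generating_graph_def planar_ribbon_def by blast

lemma card_faces:
  assumes "ribbon_graph G"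
  shows "card (faces G) = card (internal_faces G) + card (boundaries G)"
proof -
  have "finite (faces G)" using ribbonD(1)[OF assms] by (simp add: faces_def finite_cycles_of)
  moreover have "faces G = internal_faces G \<union> boundaries G" "internal_faces G \<inter> boundaries G = {}"
    by (auto simp: internal_faces_def boundaries_def)
  ultimately show ?thesis by (metis card_Un_disjoint finite_Un)
qed

lemma planar_ribbon_nonempty: "planar_ribbon p G \<Longrightarrow> half_edges G \<noteq> {}"
  unfolding planar_ribbon_def boundaries_def external_def by auto

lemma component_graph_simps [simp]:
  "half_edges (component_graph G A) = A"
  "vrot (component_graph G A) = perm_restrict (vrot G) A"
  "flip (component_graph G A) = perm_restrict (flip G) A"
  by (simp_all add: component_graph_def)

context
  fixes G :: "'h ribbon" and A
  assumes G: "ribbon_graph G" and A: "closed_in G A"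
begin

lemma ribbon_graph_component_graph: "ribbon_graph (component_graph G A)"
proof -
  have "A \<subseteq> half_edges G" using A by (simp add: closed_in_def)
  moreover have "perm_restrict (flip G) A (perm_restrict (flip G) A h) = h" for h
    using ribbonD(4)[OF G] closed_in_flip[OF G A] by (auto simp: perm_restrict_def)
  ultimately show ?thesis
    unfolding ribbon_graph_def
    using ribbonD[OF G] A perm_restrict_permutes[of _ "half_edges G" A] finite_subset[of A]
    by (simp add: closed_in_def)
qed

lemma vertices_component_graph: "vertices (component_graph G A) = cycles_of (vrot G) A"
  using A by (simp add: vertices_def closed_in_def cycles_of_perm_restrict)

lemma faces_component_graph: "faces (component_graph G A) = cycles_of (flip G \<circ> vrot G) A"
proof -
  have "perm_restrict (flip G) A \<circ> perm_restrict (vrot G) A = perm_restrict (flip G \<circ> vrot G) A"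
    using closed_in_vrot[OF G A] by (auto simp: perm_restrict_def)
  moreover have "(flip G \<circ> vrot G) ` A \<subseteq> A" using A by (auto simp: closed_in_def)
  ultimately show ?thesis
    by (simp add: faces_eq[OF ribbon_graph_component_graph] cycles_of_perm_restrict)
qed

lemma external_component_graph: "external (component_graph G A) = external G \<inter> A"
  using A by (auto simp: external_def perm_restrict_def closed_in_def)

lemma closed_in_component_graph: "closed_in (component_graph G A) B \<longleftrightarrow> closed_in G B \<and> B \<subseteq> A"
proof -
  have "perm_restrict p A ` B = p ` B" if "B \<subseteq> A" for p
    using that by (intro image_cong) (auto simp: perm_restrict_def)
  moreover have "B \<subseteq> half_edges G" if "B \<subseteq> A" using that A by (auto simp: closed_in_def)
  ultimately show ?thesis by (cases "B \<subseteq> A") (simp_all add: closed_in_def)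
qed

lemma components_component_graph:
  "components (component_graph G A) = {C \<in> components G. C \<subseteq> A}"
proof (rule components_eqI[OF ribbon_graph_component_graph])
  show "\<Union>{C \<in> components G. C \<subseteq> A} = half_edges (component_graph G A)"
  proof (intro equalityI subsetI)
    fix x assume "x \<in> half_edges (component_graph G A)"
    then have x: "x \<in> A" by simp
    then obtain C where C: "C \<in> components G" "x \<in> C"
      using A component_ex[OF G, of x] by (auto simp: closed_in_def)
    then show "x \<in> \<Union>{C \<in> components G. C \<subseteq> A}"
      using component_least[OF G C(1) A x C(2)] by blast
  qed auto
qed (use component_closed[OF G] component_nonempty[OF G] component_least[OF G] in
      \<open>auto simp: closed_in_component_graph\<close>)

end

lemma component_graph_component_graph: "component_graph (component_graph G A) B = component_graph G (A \<inter> B)"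
  if "B \<subseteq> A"
  using that by (simp add: component_graph_def perm_restrict_perm_restrict Int_absorb1)

lemma subribbonD:
  assumes "ribbon_graph G" "subribbon H G"
  shows "ribbon_graph H" "half_edges H = half_edges G" "vrot H = vrot G"
    "flip H h \<noteq> h \<Longrightarrow> flip G h = flip H h"
proof -
  show H: "ribbon_graph H" "half_edges H = half_edges G" "vrot H = vrot G"
    using assms(2) by (auto simp: subribbon_def)
  assume h: "flip H h \<noteq> h"
  then have "h \<in> half_edges H" using permutes_not_in[OF ribbonD(3)[OF H(1)]] by metis
  then have "{h, flip H h} \<in> internal_edges G"
    using assms(2) h by (auto simp: subribbon_def internal_edges_eq[OF H(1)])
  then show "flip G h = flip H h"
    using h ribbonD(4)[OF assms(1)] by (auto simp: internal_edges_eq[OF assms(1)] doubleton_eq_iff)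
qed

lemma contract_simps [simp]:
  "half_edges (contract G H) = external H"
  "vrot (contract G H) = delete_outside (flip H \<circ> vrot G) (external H)"
  "flip (contract G H) = perm_restrict (flip G) (external H)"
  by (simp_all add: contract_def)

lemma is_generatorD:
  assumes "is_generator G"
  shows "ribbon_graph G" "connected_ribbon G" "bridgeless G"
    "card (vertices G) + card (internal_faces G) = card (internal_edges G) + 1"
    "card (boundaries G) = 1"
proof -
  from assms obtain p where p: "planar_ribbon p G"
    by (auto simp: is_generator_def generating_graph_iff)
  then show G: "ribbon_graph G" "connected_ribbon G" "bridgeless G" "card (boundaries G) = 1"
    by (auto simp: planar_ribbon_def)
  show "card (vertices G) + card (internal_faces G) = card (internal_edges G) + 1"
    using p card_faces[OF G(1)] by (simp add: planar_ribbon_def genus_eq_0_iff)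
qed

text \<open>The abbreviation \<open>\<tau>\<close> is the rotation of the contracted graph: follow
  the faces of \<open>H\<close> and record only the external half edges. It depends on
  \<open>H\<close> alone, not on the graph that contains it.\<close>

locale generator_union =
  fixes H :: "'h ribbon"
  assumes all_gen: "all_generators H"
begin

abbreviation "X \<equiv> half_edges H"
abbreviation "E \<equiv> external H"
abbreviation "\<tau> \<equiv> delete_outside (flip H \<circ> vrot H) E"

lemma H: "ribbon_graph H" using all_gen by (simp add: all_generators_def)

lemma fin: "finite X" using ribbonD[OF H] by simp

lemma E_subset: "E \<subseteq> X" by (auto simp: external_def)

lemma pX: "flip H \<circ> vrot H permutes X" by (rule face_permutes[OF H])

lemma gen: "C \<in> components H \<Longrightarrow> is_generator (component_graph H C)"
  using all_gen by (simp add: all_generators_def)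

lemma tau_permutes: "\<tau> permutes E"
  using delete_outside_permutes[OF pX fin E_subset] .

lemma component_meets_E:
  assumes C: "C \<in> components H" shows "C \<inter> E \<noteq> {}"
proof -
  have "boundaries (component_graph H C) \<noteq> {}" using is_generatorD(5)[OF gen[OF C]] by auto
  then show ?thesis
    unfolding boundaries_def external_component_graph[OF H component_closed[OF H C]] by auto
qed

lemma orbit_in_component:
  assumes C: "C \<in> components H" and x: "x \<in> C" shows "orbit (flip H \<circ> vrot H) x \<subseteq> C"
  by (rule orbit_subset_closed) (use component_closed[OF H C] x in \<open>auto simp: closed_in_def\<close>)

text \<open>All external half edges of a generator lie on its single boundary, so the face cycle
  through one of them passes through the others. This is where the condition of exactly one boundary
  enters.\<close>

lemma tau_orbit:
  assumes C: "C \<in> components H" and x: "x \<in> C" "x \<in> E"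
  shows "orbit \<tau> x = C \<inter> E"
proof -
  let ?p = "flip H \<circ> vrot H"
  have b: "orbit ?p y \<in> boundaries (component_graph H C)" if "y \<in> C" "y \<in> E" for y
    using that self_in_orbit[OF pX fin, of y]
    unfolding boundaries_def external_component_graph[OF H component_closed[OF H C]]
      faces_component_graph[OF H component_closed[OF H C]] cycles_of_def by blast
  have "y \<in> orbit ?p x" if "y \<in> C" "y \<in> E" for y
  proof -
    have "orbit ?p y = orbit ?p x"
      using b[OF x] b[OF that] is_generatorD(5)[OF gen[OF C]] by (metis card_1_singletonE singletonD)
    then show ?thesis using self_in_orbit[OF pX fin, of y] by simp
  qed
  then show ?thesis
    using orbit_delete_outside[OF pX fin x(2)] orbit_in_component[OF C x(1)] by blast
qed

lemma bij_betw_components_cycles: "bij_betw (\<lambda>C. C \<inter> E) (components H) (cycles_of \<tau> E)"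
  unfolding bij_betw_def
proof
  show "inj_on (\<lambda>C. C \<inter> E) (components H)"
  proof (rule inj_onI)
    fix C D assume "C \<in> components H" "D \<in> components H" "C \<inter> E = D \<inter> E"
    then show "C = D" using component_meets_E[of C] components_disjoint[OF H, of C D] by blast
  qed
  show "(\<lambda>C. C \<inter> E) ` components H = cycles_of \<tau> E"
  proof (intro equalityI subsetI)
    fix c assume "c \<in> (\<lambda>C. C \<inter> E) ` components H"
    then obtain C where C: "C \<in> components H" "c = C \<inter> E" by blast
    then obtain x where x: "x \<in> C" "x \<in> E" using component_meets_E by blast
    then show "c \<in> cycles_of \<tau> E" using tau_orbit[OF C(1) x] C(2) unfolding cycles_of_def by blast
  next
    fix c assume "c \<in> cycles_of \<tau> E"
    then obtain x where x: "x \<in> E" "c = orbit \<tau> x" by (auto simp: cycles_of_def)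
    then obtain C where "C \<in> components H" "x \<in> C" using component_ex[OF H] E_subset by blast
    then show "c \<in> (\<lambda>C. C \<inter> E) ` components H" using tau_orbit x by blast
  qed
qed

text \<open>For a single generator the boundary accounts for one face, which leaves
  \<open>V + F = I + 1\<close> with \<open>F\<close> the number of internal faces; all three counts
  are additive over the components.\<close>

lemma euler_generator_union:
  "card (vertices H) + card (internal_faces H) = card (internal_edges H) + card (components H)"
proof -
  let ?\<C> = "components H"
  let ?p = "flip H \<circ> vrot H"
  have finC: "finite C" if "C \<in> ?\<C>" for C using that component_subset[OF H] fin finite_subset by metis
  note part = finite_components[OF H] finC
  have cl: "vrot H ` C \<subseteq> C" "?p ` C \<subseteq> C" if "C \<in> ?\<C>" for C
    using component_closed[OF H that] by (auto simp: closed_in_def)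
  have U: "\<Union>?\<C> = X" by (rule Union_components[OF H])
  have V: "card (vertices H) = (\<Sum>C\<in>?\<C>. card (vertices (component_graph H C)))"
    using card_cycles_of_partition[OF part cl(1) components_disjoint[OF H], where P = "\<lambda>_. True"]
    by (simp add: U vertices_def[of H] vertices_component_graph[OF H component_closed[OF H]])
  have "card {c \<in> cycles_of ?p X. c \<inter> E = {}} =
      (\<Sum>C\<in>?\<C>. card {c \<in> cycles_of ?p C. c \<inter> E = {}})"
    using card_cycles_of_partition[OF part cl(2) components_disjoint[OF H], where P = "\<lambda>c. c \<inter> E = {}"]
    by (simp add: U)
  also have "\<dots> = (\<Sum>C\<in>?\<C>. card (internal_faces (component_graph H C)))"
  proof (rule sum.cong[OF refl])
    fix C assume C: "C \<in> ?\<C>"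
    have "c \<subseteq> C" if "c \<in> cycles_of ?p C" for c
      using that orbit_in_component[OF C] by (auto simp: cycles_of_def)
    then have "{c \<in> cycles_of ?p C. c \<inter> E = {}} = internal_faces (component_graph H C)"
      unfolding internal_faces_def external_component_graph[OF H component_closed[OF H C]]
        faces_component_graph[OF H component_closed[OF H C]] by blast
    then show "card {c \<in> cycles_of ?p C. c \<inter> E = {}} = card (internal_faces (component_graph H C))"
      by simp
  qed
  finally have F: "card (internal_faces H) = (\<Sum>C\<in>?\<C>. card (internal_faces (component_graph H C)))"
    by (simp add: internal_faces_def[of H] faces_eq[OF H])
  have "2 * card (internal_edges H) = (\<Sum>C\<in>?\<C>. card {x \<in> C. flip H x \<noteq> x})"
    using card_Collect_partition[OF part components_disjoint[OF H], where P = "\<lambda>x. flip H x \<noteq> x"]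
    by (simp add: U card_internal_edges[OF H])
  also have "\<dots> = (\<Sum>C\<in>?\<C>. 2 * card (internal_edges (component_graph H C)))"
    by (rule sum.cong[OF refl], subst card_internal_edges)
      (auto simp: perm_restrict_def ribbon_graph_component_graph[OF H component_closed[OF H]]
        intro!: arg_cong[of _ _ card])
  finally have I: "card (internal_edges H) = (\<Sum>C\<in>?\<C>. card (internal_edges (component_graph H C)))"
    by (simp add: sum_distrib_left[symmetric])
  have "(\<Sum>C\<in>?\<C>. card (vertices (component_graph H C)) + card (internal_faces (component_graph H C)))
      = (\<Sum>C\<in>?\<C>. card (internal_edges (component_graph H C)) + 1)"
    by (rule sum.cong[OF refl]) (rule is_generatorD(4)[OF gen])
  then show ?thesis unfolding V F I sum.distrib by simp
qed

text \<open>The edge lies in one component, so a separating set, intersected with that component,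
  would exhibit a bridge of a generator.\<close>

lemma bridgeless_generator_union:
  assumes x: "flip H x \<noteq> x" "closed_in (cut_edge H {x, flip H x}) A" "x \<in> A"
  shows "flip H x \<in> A"
proof -
  have A: "A \<subseteq> X" "vrot H ` A \<subseteq> A" "\<And>h. h \<in> A \<Longrightarrow> h \<notin> {x, flip H x} \<Longrightarrow> flip H h \<in> A"
    using x(2) unfolding closed_in_cut_edge[OF H] by auto
  then obtain C where C: "C \<in> components H" "x \<in> C" using x component_ex[OF H] by blast
  let ?D = "component_graph H C"
  have D: "ribbon_graph ?D" using ribbon_graph_component_graph[OF H component_closed[OF H C(1)]] .
  have Ccl: "closed_in H C" using component_closed[OF H C(1)] .
  have fx: "flip ?D x = flip H x" using C by (simp add: perm_restrict_def)
  have "closed_in (cut_edge ?D {x, flip ?D x}) (A \<inter> C)"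
    unfolding fx closed_in_cut_edge[OF D] using A Ccl
    by (auto simp: closed_in_def perm_restrict_def)
  then show ?thesis
    using is_generatorD(3)[OF gen[OF C(1)]] x C unfolding bridgeless_iff[OF D]
    by (metis IntI IntD1 component_graph_simps(1) fx)
qed

text \<open>Carries closed sets of the contracted graph back to closed sets of the original graph;
  intersecting with \<open>E\<close> goes the other way.\<close>

definition sat :: "'h set \<Rightarrow> 'h set" where
  "sat B = \<Union>{C \<in> components H. C \<inter> B \<noteq> {}}"

lemma closed_in_sat: "closed_in H (sat B)"
  using component_closed[OF H] unfolding sat_def closed_in_def by blast

text \<open>Within a component \<open>\<tau>\<close> is transitive on the external half edges, so an
  invariant set that touches a component already contains all of them.\<close>

lemma sat_Int_E:
  assumes "B \<subseteq> E" "\<tau> ` B \<subseteq> B" shows "sat B \<inter> E = B"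
proof (intro equalityI subsetI)
  fix x assume "x \<in> sat B \<inter> E"
  then obtain C y where C: "C \<in> components H" "y \<in> C" "y \<in> B" "x \<in> C" "x \<in> E"
    by (auto simp: sat_def)
  then have "x \<in> orbit \<tau> y" using tau_orbit[of C y] assms(1) by blast
  then show "x \<in> B" using orbit_subset_closed[OF assms(2) C(3)] by blast
next
  fix x assume "x \<in> B"
  moreover from this obtain C where "C \<in> components H" "x \<in> C"
    using assms(1) E_subset component_ex[OF H] by blast
  ultimately show "x \<in> sat B \<inter> E" using assms(1) unfolding sat_def by blast
qed

lemma tau_closed: 
  assumes "closed_in H A" shows "\<tau> ` (A \<inter> E) \<subseteq> A \<inter> E"
proof -
  have "(flip H \<circ> vrot H) ` A \<subseteq> A" using assms by (auto simp: closed_in_def)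
  then have "\<tau> x \<in> A \<inter> E" if "x \<in> A \<inter> E" for x
    using that orbit.base[of \<tau> x] orbit_delete_outside[OF pX fin, of x E]
      orbit_subset_closed[of "flip H \<circ> vrot H" A x] by blast
  then show ?thesis by blast
qed

lemma closed_meets_E:
  assumes "closed_in H A" "A \<noteq> {}" shows "A \<inter> E \<noteq> {}"
proof -
  obtain x where x: "x \<in> A" "x \<in> X" using assms by (auto simp: closed_in_def)
  then obtain C where C: "C \<in> components H" "x \<in> C" using component_ex[OF H] by blast
  then show ?thesis using component_least[OF H C(1) assms(1) x(1) C(2)] component_meets_E[OF C(1)] by blast
qed

lemma closed_superset_E:
  assumes "closed_in H A" "E \<subseteq> A" shows "A = X"
proof -
  have "C \<subseteq> A" if "C \<in> components H" for C
    using that component_meets_E[OF that] component_least[OF H that assms(1)] assms(2) by blast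
  then have "X \<subseteq> A" unfolding Union_components[OF H, symmetric] by (rule Union_least)
  then show ?thesis using assms(1) by (simp add: closed_in_def)
qed

end

section \<open>Contraction of a subgraph inside a fixed graph\<close>

locale contraction = generator_union +
  fixes G :: "'a ribbon"
  assumes G: "ribbon_graph G" and sub: "subribbon H G"
begin

abbreviation "K \<equiv> contract G H"

lemma half: "half_edges G = X" and vr: "vrot G = vrot H"
  and fl: "\<And>h. flip H h \<noteq> h \<Longrightarrow> flip G h = flip H h"
  using subribbonD[OF G sub] by auto

lemma flip_G_E: "flip G h \<in> E \<longleftrightarrow> h \<in> E"
proof -
  have "flip G h \<in> E" if h: "h \<in> E" for h
  proof (rule ccontr)
    assume n: "flip G h \<notin> E"
    have "flip G h \<in> X" using h flip_in[OF G] half by (auto simp: external_def)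
    then have "flip H (flip G h) \<noteq> flip G h" using n by (auto simp: external_def)
    then have "flip H (flip G h) = h" using fl ribbonD(4)[OF G] by metis
    then have "flip H h = flip G h" using ribbonD(4)[OF H] by metis
    then show False using h n by (auto simp: external_def)
  qed
  then show ?thesis using ribbonD(4)[OF G] by metis
qed

lemma K: "ribbon_graph K"
proof -
  have "perm_restrict (flip G) E permutes E"
    using perm_restrict_permutes[OF ribbonD(3,1)[OF G]] E_subset half flip_G_E by auto
  moreover have "perm_restrict (flip G) E (perm_restrict (flip G) E h) = h" for h
    using ribbonD(4)[OF G] flip_G_E by (auto simp: perm_restrict_def)
  ultimately show ?thesis
    using tau_permutes fin E_subset by (auto simp: ribbon_graph_def vr intro: finite_subset)
qed

text \<open>\<open>flip H\<close> is the identity on \<open>E\<close> and \<open>flip K\<close> is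
  the identity off \<open>E\<close>: the pairing of \<open>G\<close> is a product of two with
  disjoint supports.\<close>

lemma flip_G: "flip G = flip K \<circ> flip H"
proof
  fix h
  show "flip G h = (flip K \<circ> flip H) h"
  proof (cases "flip H h = h")
    case True
    then show ?thesis
      using permutes_not_in[OF ribbonD(3)[OF G], of h] half by (auto simp: perm_restrict_def external_def)
  next
    case False
    then have "flip H h \<notin> E" using ribbonD(4)[OF H] by (auto simp: external_def)
    then show ?thesis using False fl by (simp add: perm_restrict_def)
  qed
qed

lemma external_contract: "external K = external G"
  using fl E_subset half by (auto simp: external_def perm_restrict_def)

lemma face_perm: "flip G \<circ> vrot G = flip K \<circ> (flip H \<circ> vrot H)"
  by (simp add: flip_G vr o_assoc del: contract_simps)

lemma face_perm_contract: "flip K \<circ> vrot K = delete_outside (flip G \<circ> vrot G) E"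
proof -
  have "flip K permutes E" using ribbonD(3)[OF K] by simp
  then show ?thesis
    unfolding face_perm using delete_outside_comp[OF pX fin] by (simp add: vr)
qed

lemma faces_bij: "bij_betw (\<lambda>c. c \<inter> E) {c \<in> faces G. c \<inter> E \<noteq> {}} (faces K)"
  using bij_betw_cycles_delete_outside[OF face_permutes[OF G] ribbonD(1)[OF G], of E] E_subset
  unfolding faces_eq[OF G] faces_eq[OF K] face_perm_contract by (simp add: half)

text \<open>As long as a face walk stays off \<open>E\<close> the factor \<open>flip K\<close> is
  inactive, so the walks in \<open>G\<close> and in \<open>H\<close> coincide.\<close>

lemma faces_avoiding: "{c \<in> faces G. c \<inter> E = {}} = internal_faces H"
proof -
  let ?p = "flip H \<circ> vrot H" and ?b = "flip K"
  have b: "?b h = h" if "h \<notin> E" for h using that by (simp add: perm_restrict_def)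
  have b': "?b h \<in> E \<longleftrightarrow> h \<in> E" for h using flip_G_E by (simp add: perm_restrict_def)
  have 1: "orbit (?b \<circ> ?p) x = orbit ?p x" if "orbit ?p x \<inter> E = {}" for x
    using that self_in_orbit[OF pX fin] orbit.step[of _ ?p x]
    by (intro orbit_cong) (auto simp del: contract_simps intro!: b)
  have 2: "orbit (?b \<circ> ?p) x = orbit ?p x" if "orbit (?b \<circ> ?p) x \<inter> E = {}" for x
  proof (rule sym, rule orbit_cong)
    show "x \<in> orbit (?b \<circ> ?p) x"
      using self_in_orbit[OF face_permutes[OF G] ribbonD(1)[OF G]] face_perm by metis
    fix s assume "s \<in> orbit (?b \<circ> ?p) x"
    then have "(?b \<circ> ?p) s \<in> orbit (?b \<circ> ?p) x" by (rule orbit.step)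
    then have "?p s \<notin> E" using that b' by auto
    then show "?p s = (?b \<circ> ?p) s" using b by simp
  qed
  show ?thesis
    unfolding internal_faces_def faces_eq[OF G] faces_eq[OF H] face_perm half cycles_of_def
    using 1 2 by (auto simp del: contract_simps; blast)
qed

lemma card_faces_contract: "card (faces G) = card (faces K) + card (internal_faces H)"
proof -
  have "finite (faces G)" using ribbonD(1)[OF G] by (simp add: faces_def finite_cycles_of)
  moreover have "faces G = {c \<in> faces G. c \<inter> E \<noteq> {}} \<union> {c \<in> faces G. c \<inter> E = {}}" by blast
  ultimately have "card (faces G) = card {c \<in> faces G. c \<inter> E \<noteq> {}} + card {c \<in> faces G. c \<inter> E = {}}"
    by (subst card_Un_disjoint[symmetric]) auto
  then show ?thesis using bij_betw_same_card[OF faces_bij] faces_avoiding by simp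
qed

lemma card_boundaries_contract: "card (boundaries K) = card (boundaries G)"
proof -
  have "external G \<subseteq> E" using external_contract by (auto simp: external_def)
  then show ?thesis
    using card_cycles_meeting[OF face_permutes[OF G] ribbonD(1)[OF G], of E "external G"] E_subset
    unfolding boundaries_def faces_eq[OF G] faces_eq[OF K] face_perm_contract external_contract
    by (simp add: half)
qed

lemma card_internal_edges_contract:
  "card (internal_edges G) = card (internal_edges H) + card (internal_edges K)"
proof -
  have e: "{x \<in> half_edges G. flip G x \<noteq> x} =
      {x \<in> half_edges H. flip H x \<noteq> x} \<union> {x \<in> half_edges K. flip K x \<noteq> x}"
    using fl E_subset half by (auto simp: perm_restrict_def external_def)
  have "card {x \<in> half_edges G. flip G x \<noteq> x} =
      card {x \<in> half_edges H. flip H x \<noteq> x} + card {x \<in> half_edges K. flip K x \<noteq> x}"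
    unfolding e using fin E_subset
    by (intro card_Un_disjoint) (auto simp: external_def)
  then show ?thesis
    using card_internal_edges[OF G] card_internal_edges[OF H] card_internal_edges[OF K] by linarith
qed

text \<open>The vertices of the contraction are the components of \<open>H\<close>, the faces lost
  are the internal faces of \<open>H\<close>, and the edges lost are its internal edges; Euler's
  relation for \<open>H\<close> says that these changes cancel.\<close>

lemma genus_contract: "genus K = 0 \<longleftrightarrow> genus G = 0"
proof -
  have "card (vertices K) = card (components H)"
    using bij_betw_same_card[OF bij_betw_components_cycles] by (simp add: vertices_def vr)
  moreover have "card (vertices G) = card (vertices H)" by (simp add: vertices_def half vr)
  ultimately show ?thesis
    using card_internal_edges_contract card_faces_contract euler_generator_union
    unfolding genus_eq_0_iff by linarith
qed

lemma closed_G_H: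
  assumes "closed_in G A" shows "closed_in H A"
proof -
  have "flip H h \<in> A" if "h \<in> A" for h
    using fl[of h] assms that by (cases "flip H h = h") (auto simp: closed_in_def)
  then show ?thesis using assms by (auto simp: closed_in_def half vr)
qed

lemma closed_in_contract: "closed_in G A \<Longrightarrow> closed_in K (A \<inter> E)"
proof -
  assume A: "closed_in G A"
  have "flip G h \<in> A" if "h \<in> A" for h using A that by (auto simp: closed_in_def)
  then have "flip K ` (A \<inter> E) \<subseteq> A \<inter> E" using flip_G_E by (auto simp: perm_restrict_def)
  moreover have "vrot K ` (A \<inter> E) \<subseteq> A \<inter> E" using tau_closed[OF closed_G_H[OF A]] by (simp add: vr)
  ultimately show ?thesis unfolding closed_in_def by simp
qed

lemma closed_in_sat_G:
  assumes "closed_in K B" shows "closed_in G (sat B)" "sat B \<inter> E = B"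
proof -
  have B: "B \<subseteq> E" "\<tau> ` B \<subseteq> B" "flip K ` B \<subseteq> B" using assms by (auto simp: closed_in_def vr)
  show e: "sat B \<inter> E = B" using sat_Int_E[OF B(1,2)] .
  have "flip G h \<in> sat B" if h: "h \<in> sat B" for h
  proof (cases "h \<in> E")
    case True
    then have "h \<in> B" using h e by blast
    then have "flip G h \<in> B" using B True by (auto simp: perm_restrict_def)
    then show ?thesis using e by blast
  next
    case False
    moreover have "h \<in> X" using h closed_in_sat unfolding closed_in_def by blast
    ultimately have "flip G h = flip H h" using fl by (auto simp: external_def)
    then show ?thesis using h closed_in_sat unfolding closed_in_def by auto
  qed
  then show "closed_in G (sat B)"
    using closed_in_sat[of B] by (auto simp: closed_in_def half vr)
qed

text \<open>Intersection with \<open>E\<close> and \<open>sat\<close> carry closed sets back and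
  forth. Neither turns a nonempty set into an empty one or a proper one into the full one, because
  each component of \<open>H\<close> meets \<open>E\<close>.\<close>

lemma connected_contract: "connected_ribbon K \<longleftrightarrow> connected_ribbon G"
  unfolding connected_ribbon_iff[OF K] connected_ribbon_iff[OF G]
proof (intro iffI allI impI)
  fix A assume *: "\<forall>B. closed_in K B \<longrightarrow> B \<noteq> {} \<longrightarrow> B = half_edges K" and A: "closed_in G A" "A \<noteq> {}"
  have "A \<inter> E \<noteq> {}" using closed_meets_E[OF closed_G_H[OF A(1)] A(2)] .
  with * closed_in_contract[OF A(1)] have "A \<inter> E = E" by (metis contract_simps(1))
  then have "E \<subseteq> A" by blast
  then show "A = half_edges G" using closed_superset_E[OF closed_G_H[OF A(1)]] half by metis
next
  fix B assume *: "\<forall>A. closed_in G A \<longrightarrow> A \<noteq> {} \<longrightarrow> A = half_edges G" and B: "closed_in K B" "B \<noteq> {}"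
  have "sat B \<noteq> {}" using closed_in_sat_G(2)[OF B(1)] B(2) by blast
  then have "sat B = X" using * closed_in_sat_G(1)[OF B(1)] half by simp
  then show "B = half_edges K" using closed_in_sat_G(2)[OF B(1)] E_subset by auto
qed

text \<open>An internal edge of \<open>G\<close> has its ends in \<open>E\<close> and is an edge of
  the contraction, or it is an edge of \<open>H\<close>. For the first kind closed sets are
  transferred; the second kind is never a bridge, because generators are bridgeless.\<close>

lemma bridgeless_contract: "bridgeless K \<longleftrightarrow> bridgeless G"
  unfolding bridgeless_iff[OF K] bridgeless_iff[OF G]
proof (intro iffI ballI allI impI)
  fix x A
  assume *: "\<forall>x\<in>half_edges K. \<forall>B. flip K x \<noteq> x \<longrightarrow>
      closed_in (cut_edge K {x, flip K x}) B \<longrightarrow> x \<in> B \<longrightarrow> flip K x \<in> B"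
    and x: "x \<in> half_edges G" "flip G x \<noteq> x" "x \<in> A"
    and A: "closed_in (cut_edge G {x, flip G x}) A"
  have A': "A \<subseteq> X" "vrot H ` A \<subseteq> A" "\<And>h. h \<in> A \<Longrightarrow> h \<notin> {x, flip G x} \<Longrightarrow> flip G h \<in> A"
    using A unfolding closed_in_cut_edge[OF G] by (auto simp: half vr)
  show "flip G x \<in> A"
  proof (cases "x \<in> E")
    case True
    have "flip H h \<in> A" if "h \<in> A" for h
    proof (cases "flip H h = h")
      case False
      then have "h \<notin> E" by (auto simp: external_def)
      then have "h \<noteq> x" "h \<noteq> flip G x" using True flip_G_E by auto
      then show ?thesis using A'(3)[OF that] fl[OF False] by simp
    qed (use that in simp)
    then have "closed_in H A" using A' by (auto simp: closed_in_def)
    then have "closed_in (cut_edge K {x, flip K x}) (A \<inter> E)"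
      unfolding closed_in_cut_edge[OF K] using tau_closed A'(3) flip_G_E True
      by (auto simp: vr perm_restrict_def)
    then show ?thesis using * True x by (auto simp: perm_restrict_def)
  next
    case False
    then have n: "flip H x \<noteq> x" using x half by (auto simp: external_def)
    have "flip H h \<in> A" if "h \<in> A" "h \<notin> {x, flip G x}" for h
      using that A'(3) fl by metis
    then have "closed_in (cut_edge H {x, flip H x}) A"
      using A' fl[OF n] unfolding closed_in_cut_edge[OF H] by auto
    then show ?thesis using bridgeless_generator_union[OF n _ x(3)] fl[OF n] by simp
  qed
next
  fix x B
  assume *: "\<forall>x\<in>half_edges G. \<forall>A. flip G x \<noteq> x \<longrightarrow>
      closed_in (cut_edge G {x, flip G x}) A \<longrightarrow> x \<in> A \<longrightarrow> flip G x \<in> A"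
    and x: "x \<in> half_edges K" "flip K x \<noteq> x" "x \<in> B"
    and B: "closed_in (cut_edge K {x, flip K x}) B"
  have xE: "x \<in> E" "flip K x = flip G x" using x by (auto simp: perm_restrict_def)
  have B': "B \<subseteq> E" "\<tau> ` B \<subseteq> B" "\<And>h. h \<in> B \<Longrightarrow> h \<notin> {x, flip G x} \<Longrightarrow> flip G h \<in> B"
  proof -
    show B1: "B \<subseteq> E" and "\<tau> ` B \<subseteq> B" using B unfolding closed_in_cut_edge[OF K] by (simp_all add: vr)
    show "flip G h \<in> B" if "h \<in> B" "h \<notin> {x, flip G x}" for h
    proof -
      have "flip K h \<in> B" using B that xE unfolding closed_in_cut_edge[OF K] by simp
      moreover have "h \<in> E" using that B1 by blast
      ultimately show ?thesis by (simp add: perm_restrict_def)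
    qed
  qed
  have e: "sat B \<inter> E = B" using sat_Int_E[OF B'(1,2)] .
  have "flip G h \<in> sat B" if h: "h \<in> sat B" "h \<notin> {x, flip G x}" for h
  proof (cases "h \<in> E")
    case True
    then show ?thesis using h e B'(3) by blast
  next
    case False
    moreover have "h \<in> X" using h closed_in_sat unfolding closed_in_def by blast
    ultimately have "flip G h = flip H h" using fl by (auto simp: external_def)
    then show ?thesis using h closed_in_sat unfolding closed_in_def by auto
  qed
  then have "closed_in (cut_edge G {x, flip G x}) (sat B)"
    unfolding closed_in_cut_edge[OF G] using closed_in_sat[of B]
    by (auto simp: closed_in_def half vr)
  moreover have "x \<in> sat B" using e x by blast
  ultimately have "flip G x \<in> sat B" using * x xE E_subset half by auto
  then have "flip G x \<in> B" using e flip_G_E xE by blast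
  then show "flip K x \<in> B" using xE by simp
qed

lemma planar_contract: "planar_ribbon p K \<longleftrightarrow> planar_ribbon p G"
  unfolding planar_ribbon_def using G K connected_contract bridgeless_contract genus_contract
    card_boundaries_contract external_contract by simp

end

context generator_union
begin

text \<open>\<open>H\<close> prescribes the half edges, the rotation and some of the edges; what
  remains free is a pairing on \<open>E\<close>. The inverse map therefore multiplies
  \<open>flip K\<close> with \<open>flip H\<close>.\<close>

lemma bij_betw_contract:
  "bij_betw (\<lambda>G. contract G H) {G. planar_ribbon p G \<and> subribbon H G}
    {K. planar_ribbon p K \<and> half_edges K = E \<and> vrot K = \<tau>}"
proof (rule bij_betwI[where g = "\<lambda>K. \<lparr>half_edges = X, vrot = vrot H, flip = flip K \<circ> flip H\<rparr>"])
  show "(\<lambda>G. contract G H) \<in> {G. planar_ribbon p G \<and> subribbon H G} \<rightarrow>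
    {K. planar_ribbon p K \<and> half_edges K = E \<and> vrot K = \<tau>}"
  proof
    fix G assume "G \<in> {G. planar_ribbon p G \<and> subribbon H G}"
    then have "planar_ribbon p G" "contraction H G"
      using generator_union_axioms by (auto simp: contraction_def contraction_axioms_def planar_ribbon_def)
    then show "contract G H \<in> {K. planar_ribbon p K \<and> half_edges K = E \<and> vrot K = \<tau>}"
      using contraction.planar_contract contraction.vr by force
  qed
  have inv: "ribbon_graph \<lparr>half_edges = X, vrot = vrot H, flip = flip K \<circ> flip H\<rparr> \<and>
      subribbon H \<lparr>half_edges = X, vrot = vrot H, flip = flip K \<circ> flip H\<rparr> \<and>
      contract \<lparr>half_edges = X, vrot = vrot H, flip = flip K \<circ> flip H\<rparr> H = K"
    if K: "ribbon_graph K" "half_edges K = E" "vrot K = \<tau>" for K :: "'h ribbon"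
  proof -
    let ?G = "\<lparr>half_edges = X, vrot = vrot H, flip = flip K \<circ> flip H\<rparr>"
    have fK: "flip K h = h" if "h \<notin> E" for h using permutes_not_in[OF ribbonD(3)[OF K(1)]] K that by simp
    have fK': "flip K h \<in> E \<longleftrightarrow> h \<in> E" for h using flip_in[OF K(1)] K(2) by simp
    have fH: "flip H h = h" if "h \<in> E" for h using that by (simp add: external_def)
    have fH': "flip H h \<in> E \<longleftrightarrow> h \<in> E" for h using ribbonD(4)[OF H] flip_in[OF H] by (auto simp: external_def)
    have comm: "flip H (flip K h) = flip K (flip H h)" for h
      using fK fK' fH fH' by (cases "h \<in> E") auto
    have "flip K \<circ> flip H permutes X"
      using ribbonD(3)[OF H] permutes_subset[OF ribbonD(3)[OF K(1)]] K(2) E_subset permutes_compose by metis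
    then have G: "ribbon_graph ?G"
      using ribbonD[OF H] ribbonD(4)[OF K(1)] by (simp add: ribbon_graph_def comm)
    have "flip H x \<notin> E" if "flip H x \<noteq> x" for x using that fH fH' by auto
    then have "flip ?G x = flip H x" if "flip H x \<noteq> x" for x using that fK by simp
    then have "subribbon H ?G"
      unfolding subribbon_def internal_edges_eq[OF H] internal_edges_eq[OF G] using H by force
    moreover have "perm_restrict (flip K \<circ> flip H) E = flip K"
      using fK fH by (auto simp: perm_restrict_def)
    ultimately show ?thesis using G K by (simp add: contract_def)
  qed
  show "(\<lambda>K. \<lparr>half_edges = X, vrot = vrot H, flip = flip K \<circ> flip H\<rparr>) \<in>
    {K. planar_ribbon p K \<and> half_edges K = E \<and> vrot K = \<tau>} \<rightarrow> {G. planar_ribbon p G \<and> subribbon H G}"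
  proof
    fix K assume "K \<in> {K. planar_ribbon p K \<and> half_edges K = E \<and> vrot K = \<tau>}"
    then have K: "planar_ribbon p K" "ribbon_graph K" "half_edges K = E" "vrot K = \<tau>"
      by (auto simp: planar_ribbon_def)
    let ?G = "\<lparr>half_edges = X, vrot = vrot H, flip = flip K \<circ> flip H\<rparr>"
    note i = inv[OF K(2-4)]
    then have "contraction H ?G"
      using generator_union_axioms by (auto simp: contraction_def contraction_axioms_def)
    then show "?G \<in> {G. planar_ribbon p G \<and> subribbon H G}"
      using contraction.planar_contract[of H ?G p] i K(1) by simp
  qed
  show "\<lparr>half_edges = X, vrot = vrot H, flip = flip (contract G H) \<circ> flip H\<rparr> = G"
    if "G \<in> {G. planar_ribbon p G \<and> subribbon H G}" for G
  proof -
    have "contraction H G"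
      using that generator_union_axioms by (auto simp: contraction_def contraction_axioms_def planar_ribbon_def)
    then have "flip G = flip (contract G H) \<circ> flip H" "half_edges G = X" "vrot G = vrot H"
      by (rule contraction.flip_G contraction.half contraction.vr)+
    then show ?thesis
      by (intro ribbon.equality) (simp_all only: ribbon.simps, rule unit_eq[symmetric])
  qed
  show "contract \<lparr>half_edges = X, vrot = vrot H, flip = flip K \<circ> flip H\<rparr> H = K"
    if "K \<in> {K. planar_ribbon p K \<and> half_edges K = E \<and> vrot K = \<tau>}" for K
    using inv that by (auto simp: planar_ribbon_def)
qed

end

lemma finite_ribbon_graphs:
  assumes "finite X" shows "finite {G :: 'h ribbon. ribbon_graph G \<and> half_edges G = X}"
proof (rule finite_subset)
  show "{G :: 'h ribbon. ribbon_graph G \<and> half_edges G = X} \<subseteq>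
    (\<lambda>(s, a). \<lparr>half_edges = X, vrot = s, flip = a\<rparr>) ` ({s. s permutes X} \<times> {a. a permutes X})"
  proof
    fix G :: "'h ribbon" assume "G \<in> {G. ribbon_graph G \<and> half_edges G = X}"
    then show "G \<in> (\<lambda>(s, a). \<lparr>half_edges = X, vrot = s, flip = a\<rparr>) ` ({s. s permutes X} \<times> {a. a permutes X})"
      by (intro image_eqI[of _ _ "(vrot G, flip G)"]) (auto simp: ribbon_graph_def)
  qed
qed (use assms finite_permutations in auto)

section \<open>Deletion of a bivalent vertex\<close>

text \<open>Picture: the bivalent vertex \<open>{x, y}\<close> sits on the edge
  \<open>{u, u'}\<close> of \<open>K'\<close> and splits it into the edges \<open>{x, u}\<close> and
  \<open>{y, u'}\<close> of \<open>K\<close>.\<close>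

locale bivalent_removal =
  fixes K K' :: "'h ribbon" and x y u u' :: 'h
  assumes K: "ribbon_graph K" and K': "ribbon_graph K'"
    and half: "half_edges K = insert x (insert y (half_edges K'))"
    and xy: "x \<notin> half_edges K'" "y \<notin> half_edges K'" "x \<noteq> y"
    and uu: "u \<in> half_edges K'" "u' \<in> half_edges K'" "u \<noteq> u'"
    and vrot_xy: "vrot K x = y" "vrot K y = x"
    and vrot_E: "\<And>h. h \<in> half_edges K' \<Longrightarrow> vrot K h = vrot K' h"
    and flip_uu: "flip K' u = u'"
    and flip_xy: "flip K x = u" "flip K y = u'"
    and flip_E: "\<And>h. h \<in> half_edges K' \<Longrightarrow> h \<noteq> u \<Longrightarrow> h \<noteq> u' \<Longrightarrow> flip K h = flip K' h"
begin

abbreviation "E \<equiv> half_edges K'"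

lemma flips: "flip K' u' = u" "flip K u = x" "flip K u' = y"
  using ribbonD(4)[OF K'] ribbonD(4)[OF K] flip_uu flip_xy by metis+

text \<open>The picture is symmetric in the two sides of the vertex, so each argument about
  \<open>x\<close> and \<open>u\<close> also serves \<open>y\<close> and \<open>u'\<close>.\<close>

lemma swap: "bivalent_removal K K' y x u' u"
  by unfold_locales (use K K' half xy uu vrot_xy vrot_E flips flip_xy flip_E in auto)

lemma distinct: "x \<noteq> u" "x \<noteq> u'" "y \<noteq> u" "y \<noteq> u'"
  using xy uu by auto

lemma flip_K'_uu: "flip K' h \<in> {u, u'} \<longleftrightarrow> h \<in> {u, u'}"
  using ribbonD(4)[OF K'] flip_uu flips by (metis insertE insertI1 insertI2 singletonD)

lemma external_eq: "external K = external K'"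
proof (rule set_eqI)
  fix h
  show "h \<in> external K \<longleftrightarrow> h \<in> external K'"
    using flip_uu flips flip_xy distinct xy uu half flip_E[of h]
    by (cases "h \<in> {x, y, u, u'}") (auto simp: external_def)
qed

text \<open>A closed set that contains the edge \<open>{u, u'}\<close> must swallow the vertex
  placed on it. Testing \<open>u\<close> is enough, since \<open>u\<close> and \<open>u'\<close> lie
  in the set together when this edge is not cut.\<close>

definition ext :: "'h set \<Rightarrow> 'h set" where
  "ext B = B \<union> (if u \<in> B then {x, y} else {})"

lemma cut_restrict:
  assumes A: "closed_in (cut_edge K e) A" and e: "e \<inter> {x, y, u, u'} = {}"
  shows "closed_in (cut_edge K' e) (A \<inter> E)"
proof -
  have A': "vrot K ` A \<subseteq> A" "\<And>h. h \<in> A \<Longrightarrow> h \<notin> e \<Longrightarrow> flip K h \<in> A"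
    using A unfolding closed_in_cut_edge[OF K] by auto
  have "vrot K' h \<in> A \<inter> E" if "h \<in> A \<inter> E" for h
    using that A'(1) vrot_E[of h] vrot_in[OF K', of h] by auto
  moreover have "flip K' h \<in> A \<inter> E" if h: "h \<in> A \<inter> E" "h \<notin> e" for h
  proof -
    consider "h = u" | "h = u'" | "h \<noteq> u" "h \<noteq> u'" by blast
    then have "flip K' h \<in> A"
    proof cases
      case 1
      then have "x \<in> A" using A'(2)[of u] h flips by simp
      then have "y \<in> A" using A'(1) vrot_xy by auto
      then show ?thesis using A'(2)[of y] e flip_xy flip_uu 1 by auto
    next
      case 2
      then have "y \<in> A" using A'(2)[of u'] h flips by simp
      then have "x \<in> A" using A'(1) vrot_xy by auto
      then show ?thesis using A'(2)[of x] e flip_xy flips 2 by auto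
    next
      case 3
      then show ?thesis using A'(2)[of h] h flip_E[of h] by auto
    qed
    then show ?thesis using flip_in[OF K', of h] h by simp
  qed
  ultimately show ?thesis unfolding closed_in_cut_edge[OF K'] by auto
qed

lemma cut_extend:
  assumes B: "closed_in (cut_edge K' e) B" and e: "e \<inter> {u, u'} = {}"
  shows "closed_in (cut_edge K e) (ext B)"
proof -
  have B': "B \<subseteq> E" "vrot K' ` B \<subseteq> B" "\<And>h. h \<in> B \<Longrightarrow> h \<notin> e \<Longrightarrow> flip K' h \<in> B"
    using B unfolding closed_in_cut_edge[OF K'] by auto
  have uu': "u \<in> B \<longleftrightarrow> u' \<in> B" using B'(3)[of u] B'(3)[of u'] e flip_uu flips by auto
  have "vrot K h \<in> ext B" if "h \<in> ext B" for h
  proof (cases "h \<in> {x, y}")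
    case True
    then show ?thesis using that vrot_xy xy B'(1) by (auto simp: ext_def split: if_splits)
  next
    case False
    then have "h \<in> B" using that by (auto simp: ext_def split: if_splits)
    then show ?thesis using B' vrot_E[of h] by (auto simp: ext_def)
  qed
  moreover have "flip K h \<in> ext B" if h: "h \<in> ext B" "h \<notin> e" for h
  proof -
    consider "h = x" | "h = y" | "h = u" | "h = u'" | "h \<notin> {x, y, u, u'}" by blast
    then show ?thesis
    proof cases
      case 5
      then have "h \<in> B" using h by (auto simp: ext_def split: if_splits)
      then show ?thesis using B' h flip_E[of h] 5 by (auto simp: ext_def)
    qed (use h xy B'(1) flip_xy flips uu' distinct in \<open>auto simp: ext_def split: if_splits\<close>)
  qed
  moreover have "ext B \<subseteq> half_edges K" using B'(1) half by (auto simp: ext_def)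
  ultimately show ?thesis unfolding closed_in_cut_edge[OF K] by auto
qed

lemma closed_in_cut_empty: "closed_in (cut_edge G {}) A \<longleftrightarrow> closed_in G A"
  by (simp add: cut_edge_def closed_in_def)

lemma connected_iff: "connected_ribbon K \<longleftrightarrow> connected_ribbon K'"
  unfolding connected_ribbon_iff[OF K] connected_ribbon_iff[OF K']
proof (intro iffI allI impI)
  fix B assume *: "\<forall>A. closed_in K A \<longrightarrow> A \<noteq> {} \<longrightarrow> A = half_edges K" and B: "closed_in K' B" "B \<noteq> {}"
  have "closed_in K (ext B)" using cut_extend[of "{}" B] B by (simp add: closed_in_cut_empty)
  moreover have "ext B \<noteq> {}" using B by (auto simp: ext_def)
  ultimately have "ext B = half_edges K" using * by blast
  then have "E \<subseteq> ext B" using half by blast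
  then have "E \<subseteq> B" using xy by (auto simp: ext_def split: if_splits)
  then show "B = E" using B(1) by (auto simp: closed_in_def)
next
  fix A assume *: "\<forall>B. closed_in K' B \<longrightarrow> B \<noteq> {} \<longrightarrow> B = E" and A: "closed_in K A" "A \<noteq> {}"
  have c: "closed_in K' (A \<inter> E)" using cut_restrict[of "{}" A] A by (simp add: closed_in_cut_empty)
  have m: "flip K h \<in> A" if "h \<in> A" for h using A that by (auto simp: closed_in_def)
  have "A \<inter> E \<noteq> {}"
  proof -
    obtain h where h: "h \<in> A" "h \<in> half_edges K" using A by (auto simp: closed_in_def)
    then consider "h = x" | "h = y" | "h \<in> E" using half by blast
    then show ?thesis using m[OF h(1)] h flip_xy uu by cases auto
  qed
  then have E: "E \<subseteq> A" using * c by blast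
  then have "x \<in> A" "y \<in> A" using m[of u] m[of u'] flips uu by auto
  then show "A = half_edges K" using E half A by (auto simp: closed_in_def)
qed

text \<open>After cutting \<open>{x, u}\<close> the points \<open>x\<close>, \<open>y\<close> and
  \<open>u'\<close> still hang together, so a set separating \<open>x\<close> from \<open>u\<close>
  also separates \<open>u'\<close> from \<open>u\<close> and makes \<open>{u, u'}\<close> a bridge
  of \<open>K'\<close>.\<close>

lemma bridge_xu:
  assumes b: "bridgeless K'" and A: "closed_in (cut_edge K {x, u}) A"
  shows "x \<in> A \<longleftrightarrow> u \<in> A"
proof -
  have A': "vrot K ` A \<subseteq> A" "\<And>h. h \<in> A \<Longrightarrow> h \<notin> {x, u} \<Longrightarrow> flip K h \<in> A"
    using A unfolding closed_in_cut_edge[OF K] by auto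
  have "vrot K' h \<in> A \<inter> E" if "h \<in> A \<inter> E" for h
    using that A'(1) vrot_E[of h] vrot_in[OF K', of h] by auto
  moreover have "flip K' h \<in> A \<inter> E" if h: "h \<in> A \<inter> E" "h \<notin> {u, u'}" for h
    using that A'(2)[of h] flip_E[of h] flip_in[OF K', of h] xy by auto
  ultimately have c: "closed_in (cut_edge K' {u, u'}) (A \<inter> E)" unfolding closed_in_cut_edge[OF K'] by auto
  have "u \<in> A \<inter> E \<Longrightarrow> u' \<in> A \<inter> E"
    using b c uu flip_uu unfolding bridgeless_iff[OF K'] by metis
  moreover have "u' \<in> A \<inter> E \<Longrightarrow> u \<in> A \<inter> E"
    using b c uu flips unfolding bridgeless_iff[OF K'] by (metis insert_commute)
  moreover have "x \<in> A \<longleftrightarrow> y \<in> A" using A'(1) vrot_xy by auto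
  moreover have "y \<in> A \<longleftrightarrow> u' \<in> A" using A'(2)[of y] A'(2)[of u'] xy uu distinct flip_xy flips by auto
  ultimately show ?thesis using uu by blast
qed

text \<open>If \<open>u'\<close> were missing from \<open>B\<close>, then \<open>B\<close> without
  the new vertex would be closed in \<open>K\<close> once \<open>{u, x}\<close> is cut, and would
  separate \<open>u\<close> from \<open>x\<close>.\<close>

lemma bridge_uu:
  assumes b: "bridgeless K" and B: "closed_in (cut_edge K' {u, u'}) B" and u: "u \<in> B"
  shows "u' \<in> B"
proof -
  have B': "B \<subseteq> E" "vrot K' ` B \<subseteq> B" "\<And>h. h \<in> B \<Longrightarrow> h \<notin> {u, u'} \<Longrightarrow> flip K' h \<in> B"
    using B unfolding closed_in_cut_edge[OF K'] by auto
  define A where "A = B \<union> (if u' \<in> B then {x, y} else {})"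
  have "vrot K h \<in> A" if "h \<in> A" for h
  proof (cases "h \<in> {x, y}")
    case True
    then show ?thesis using that vrot_xy xy B'(1) by (auto simp: A_def split: if_splits)
  next
    case False
    then have "h \<in> B" using that by (auto simp: A_def split: if_splits)
    then show ?thesis using B' vrot_E[of h] by (auto simp: A_def)
  qed
  moreover have "flip K h \<in> A" if h: "h \<in> A" "h \<notin> {u, x}" for h
  proof -
    consider "h = y" | "h = u'" | "h \<notin> {x, y, u, u'}" using h by blast
    then show ?thesis
    proof cases
      case 3
      then have "h \<in> B" using h by (auto simp: A_def split: if_splits)
      then show ?thesis using B' h flip_E[of h] 3 by (auto simp: A_def)
    qed (use h xy B'(1) flip_xy flips distinct uu in \<open>auto simp: A_def split: if_splits\<close>)
  qed
  moreover have "A \<subseteq> half_edges K" using B'(1) half by (auto simp: A_def)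
  ultimately have "closed_in (cut_edge K {u, x}) A" unfolding closed_in_cut_edge[OF K] by auto
  moreover have "u \<in> A" using u by (simp add: A_def)
  ultimately have "x \<in> A"
    using b flips distinct uu half unfolding bridgeless_iff[OF K] by (metis insertI2)
  then show "u' \<in> B" using B'(1) xy by (auto simp: A_def split: if_splits)
qed

lemma bridgeless_iff': "bridgeless K \<longleftrightarrow> bridgeless K'"
proof
  assume b: "bridgeless K"
  show "bridgeless K'"
    unfolding bridgeless_iff[OF K']
  proof (intro ballI allI impI)
    fix z B assume z: "z \<in> E" "flip K' z \<noteq> z" and B: "closed_in (cut_edge K' {z, flip K' z}) B" "z \<in> B"
    consider "z = u" | "z = u'" | "z \<notin> {u, u'}" by blast
    then show "flip K' z \<in> B"
    proof cases
      case 1 then show ?thesis using bridge_uu[OF b] B flip_uu by simp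
    next
      case 2 then show ?thesis using bivalent_removal.bridge_uu[OF swap b] B flips by simp
    next
      case 3
      then have f: "flip K' z \<notin> {u, u'}" using flip_K'_uu by blast
      have fz: "flip K z = flip K' z" using 3 z flip_E by simp
      have "closed_in (cut_edge K {z, flip K' z}) (ext B)" using cut_extend[OF B(1)] 3 f by blast
      moreover have "z \<in> ext B" "z \<in> half_edges K" using B z half by (auto simp: ext_def)
      ultimately have "flip K z \<in> ext B" using b z fz unfolding bridgeless_iff[OF K] by metis
      moreover have "flip K' z \<in> E" using flip_in[OF K'] z by simp
      ultimately show ?thesis using fz xy by (auto simp: ext_def split: if_splits)
    qed
  qed
next
  assume b: "bridgeless K'"
  show "bridgeless K"
    unfolding bridgeless_iff[OF K]
  proof (intro ballI allI impI)
    fix z A assume z: "z \<in> half_edges K" "flip K z \<noteq> z"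
      and A: "closed_in (cut_edge K {z, flip K z}) A" "z \<in> A"
    consider "z = x" | "z = u" | "z = y" | "z = u'" | "z \<notin> {x, y, u, u'}" by blast
    then show "flip K z \<in> A"
    proof cases
      case 1 then show ?thesis using bridge_xu[OF b] A flip_xy by simp
    next
      case 2 then show ?thesis using bridge_xu[OF b, of A] A flips by (simp add: insert_commute)
    next
      case 3 then show ?thesis using bivalent_removal.bridge_xu[OF swap b] A flip_xy by simp
    next
      case 4 then show ?thesis
        using bivalent_removal.bridge_xu[OF swap b, of A] A flips by (simp add: insert_commute)
    next
      case 5
      then have zE: "z \<in> E" using z half by simp
      have f: "flip K' z \<notin> {u, u'}" using flip_K'_uu 5 by blast
      have fz: "flip K z = flip K' z" using 5 zE flip_E by simp
      have fE: "flip K' z \<in> E" using flip_in[OF K'] zE by simp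
      then have "flip K' z \<noteq> x" "flip K' z \<noteq> y" using xy by auto
      then have "closed_in (cut_edge K' {z, flip K' z}) (A \<inter> E)"
        using cut_restrict[OF A(1)] 5 f fz by auto
      then have "flip K' z \<in> A \<inter> E"
        using b zE z fz A unfolding bridgeless_iff[OF K'] by (metis IntI)
      then show ?thesis using fz by simp
    qed
  qed
qed

lemma vertices_eq: "vertices K = insert {x, y} (vertices K')" "{x, y} \<notin> vertices K'"
proof -
  have o: "orbit (vrot K) h = orbit (vrot K') h" if "h \<in> E" for h
    by (rule orbit_cong0[of _ E]) (use that vrot_E vrot_in[OF K'] in auto)
  note orbit_swapped_pair[OF ribbonD(2,1)[OF K] vrot_xy]
  moreover have "orbit (vrot K) ` E = orbit (vrot K') ` E" using o by (rule image_cong[OF refl])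
  ultimately show "vertices K = insert {x, y} (vertices K')"
    by (simp add: vertices_def cycles_of_def half)
  have "\<Union>(vertices K') = E"
    unfolding vertices_def using Union_cycles_of[OF ribbonD(2,1)[OF K']] .
  then show "{x, y} \<notin> vertices K'" using xy by blast
qed

text \<open>A face that used to pass from \<open>u\<close> to \<open>u'\<close> now visits
  \<open>x\<close> in between. This is one extra point outside \<open>E\<close>, which the first
  return skips; likewise \<open>y\<close> in the other direction.\<close>

lemma face_perm: "flip K' \<circ> vrot K' = delete_outside (flip K \<circ> vrot K) E"
proof
  fix z
  let ?p = "flip K \<circ> vrot K"
  show "(flip K' \<circ> vrot K') z = delete_outside ?p E z"
  proof (cases "z \<in> E")
    case False
    then show ?thesis
      using permutes_not_in[OF face_permutes[OF K']] by (simp add: delete_outside_def)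
  next
    case True
    let ?w = "vrot K' z"
    have w: "vrot K z = ?w" "?w \<in> E" using True vrot_E vrot_in[OF K'] by auto
    consider "?w = u" | "?w = u'" | "?w \<noteq> u" "?w \<noteq> u'" by blast
    then show ?thesis
    proof cases
      case 3
      then show ?thesis
        using delete_outside_step1[of z E ?p] True w flip_E[OF w(2) 3] flip_in[OF K'] by simp
    qed (use delete_outside_step2[of z E ?p] True w flips vrot_xy flip_xy flip_uu uu xy in simp_all)
  qed
qed

lemma E_subset: "E \<subseteq> half_edges K" using half by blast

text \<open>On their faces \<open>x\<close> and \<open>y\<close> are followed by \<open>u'\<close>
  and \<open>u\<close>, so no face consists of new half edges only and none is lost in taking traces
  on \<open>E\<close>.\<close>

lemma card_faces_eq: "card (faces K') = card (faces K)" "card (boundaries K') = card (boundaries K)"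
proof -
  let ?p = "flip K \<circ> vrot K"
  note c = card_cycles_meeting[OF face_permutes[OF K] ribbonD(1)[OF K] E_subset]
  have meet: "c \<inter> E \<noteq> {}" if c: "c \<in> faces K" for c
  proof -
    obtain h where h: "h \<in> half_edges K" "c = orbit ?p h"
      using c by (auto simp: faces_eq[OF K] cycles_of_def)
    have "?p x = u'" "?p y = u" using vrot_xy flip_xy by auto
    then have "u' \<in> orbit ?p x" "u \<in> orbit ?p y" using orbit.base[of ?p] by metis+
    moreover have "h \<in> orbit ?p h" using self_in_orbit[OF face_permutes[OF K] ribbonD(1)[OF K]] .
    ultimately show ?thesis using h half uu by auto
  qed
  have meet': "c \<noteq> {}" "c \<subseteq> E" if c: "c \<in> faces K'" for c
  proof -
    obtain h where "h \<in> E" "c = orbit (flip K' \<circ> vrot K') h"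
      using c by (auto simp: faces_eq[OF K'] cycles_of_def)
    then show "c \<noteq> {}" "c \<subseteq> E"
      using permutes_orbit_subset[OF face_permutes[OF K']] by (simp_all add: orbit_nonempty)
  qed
  have "{c \<in> faces K. c \<inter> E \<noteq> {}} = faces K" "{c \<in> faces K'. c \<inter> E \<noteq> {}} = faces K'"
    using meet meet' by blast+
  then show "card (faces K') = card (faces K)"
    using c[OF order.refl] unfolding face_perm[symmetric] faces_eq[OF K] faces_eq[OF K'] by simp
  have "external K' \<subseteq> E" by (auto simp: external_def)
  then show "card (boundaries K') = card (boundaries K)"
    using c unfolding face_perm[symmetric] boundaries_def faces_eq[OF K] faces_eq[OF K'] external_eq by simp
qed

text \<open>\<open>K\<close> has one vertex and one edge more than \<open>K'\<close>, and as many
  faces.\<close>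

lemma genus_iff: "genus K = 0 \<longleftrightarrow> genus K' = 0"
proof -
  have "{h \<in> half_edges K. flip K h \<noteq> h} = {x, y} \<union> {h \<in> E. flip K' h \<noteq> h}"
  proof (rule set_eqI)
    fix h
    show "h \<in> {h \<in> half_edges K. flip K h \<noteq> h} \<longleftrightarrow> h \<in> {x, y} \<union> {h \<in> E. flip K' h \<noteq> h}"
      using flip_uu flips flip_xy distinct xy uu half flip_E[of h]
      by (cases "h \<in> {x, y, u, u'}") auto
  qed
  moreover have "card ({x, y} \<union> {h \<in> E. flip K' h \<noteq> h}) = 2 + card {h \<in> E. flip K' h \<noteq> h}"
    using xy ribbonD(1)[OF K'] by (subst card_Un_disjoint) auto
  ultimately have "card (internal_edges K) = card (internal_edges K') + 1"
    using card_internal_edges[OF K] card_internal_edges[OF K'] by simp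
  moreover have "card (vertices K) = card (vertices K') + 1"
    using vertices_eq ribbonD(1)[OF K'] by (simp add: vertices_def finite_cycles_of)
  ultimately show ?thesis unfolding genus_eq_0_iff using card_faces_eq by linarith
qed

lemma planar_iff: "planar_ribbon p K \<longleftrightarrow> planar_ribbon p K'"
  unfolding planar_ribbon_def
  using K K' connected_iff bridgeless_iff' genus_iff card_faces_eq external_eq by simp

lemma bivalent_eq: "bivalent K = {x, y} \<union> bivalent K'" "bivalent K' \<subseteq> E"
proof -
  have "card {x, y} = 2" using xy by simp
  then show "bivalent K = {x, y} \<union> bivalent K'" unfolding bivalent_def vertices_eq by blast
  have "\<Union>(vertices K') = E"
    unfolding vertices_def using Union_cycles_of[OF ribbonD(2,1)[OF K']] .
  then show "bivalent K' \<subseteq> E" unfolding bivalent_def by blast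
qed

text \<open>The walk that searches for the new partner in \<open>K'\<close> is the first-return map
  of the walk in \<open>K\<close>, the detour through \<open>{x, y}\<close> being skipped. First
  returns to the surviving half edges then agree by transitivity.\<close>

lemma delete_bivalent_eq: "delete_bivalent K = delete_bivalent K'"
proof -
  let ?f = "\<lambda>h. flip K (if h \<in> bivalent K then vrot K h else h)"
  let ?f' = "\<lambda>h. flip K' (if h \<in> bivalent K' then vrot K' h else h)"
  let ?S = "E - bivalent K'"
  have S: "half_edges K - bivalent K = ?S" using half bivalent_eq xy by auto
  have biv: "h \<in> bivalent K \<longleftrightarrow> h \<in> bivalent K'" if "h \<in> E" for h
    using that bivalent_eq xy by auto
  have vb: "vrot K ` bivalent K \<subseteq> bivalent K"
    unfolding bivalent_def vertices_def cycles_of_def using orbit.step by fastforce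
  have bs: "bivalent K \<subseteq> half_edges K" using bivalent_eq half by auto
  have "flip K \<circ> perm_restrict (vrot K) (bivalent K) permutes half_edges K"
    using permutes_subset[OF perm_restrict_permutes[OF ribbonD(2,1)[OF K] bs vb] bs] ribbonD(3)[OF K]
    by (rule permutes_compose)
  moreover have "flip K \<circ> perm_restrict (vrot K) (bivalent K) = ?f"
    by (auto simp: perm_restrict_def)
  ultimately have perm: "?f permutes half_edges K" by simp
  have "?f' z = delete_outside ?f E z" for z
  proof (cases "z \<in> E")
    case False
    then show ?thesis
      using permutes_not_in[OF ribbonD(3)[OF K']] bivalent_eq by (auto simp: delete_outside_def)
  next
    case True
    define w where "w = (if z \<in> bivalent K' then vrot K' z else z)"
    have w: "(if z \<in> bivalent K then vrot K z else z) = w" "w \<in> E"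
      using True vrot_E vrot_in[OF K'] biv by (auto simp: w_def)
    have fx: "?f x = u'" "?f y = u" using bivalent_eq vrot_xy flip_xy by auto
    have fz: "?f z = flip K w" "?f' z = flip K' w" using w by (auto simp: w_def)
    consider "w = u" | "w = u'" | "w \<noteq> u" "w \<noteq> u'" by blast
    then show ?thesis
    proof cases
      case 1
      then have z: "?f z = x" using fz flips by simp
      have "delete_outside ?f E z = ?f (?f z)"
        by (rule delete_outside_step2) (simp_all only: z fx True uu xy not_False_eq_True)
      then show ?thesis unfolding z fx fz 1 flip_uu by simp
    next
      case 2
      then have z: "?f z = y" using fz flips by simp
      have "delete_outside ?f E z = ?f (?f z)"
        by (rule delete_outside_step2) (simp_all only: z fx True uu xy not_False_eq_True)
      then show ?thesis unfolding z fx fz 2 flips by simp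
    next
      case 3
      have "?f z = flip K' w" using flip_E[OF w(2) 3] fz by simp
      then show ?thesis
        using delete_outside_step1[of z E ?f] True fz w flip_in[OF K'] by simp
    qed
  qed
  then have "?f' = delete_outside ?f E" by blast
  then have "delete_outside ?f' ?S = delete_outside ?f ?S"
    using delete_outside_delete_outside[OF perm ribbonD(1)[OF K] E_subset] by simp
  moreover have "perm_restrict (vrot K) ?S = perm_restrict (vrot K') ?S"
    using vrot_E by (auto simp: perm_restrict_def)
  ultimately show ?thesis unfolding delete_bivalent_def S by simp
qed

end

section \<open>Positions of a bivalent vertex in a planar graph\<close>

definition planars :: "nat \<Rightarrow> 'h set \<Rightarrow> ('h \<Rightarrow> 'h) \<Rightarrow> 'h ribbon set" where
  "planars p E \<tau> = {K. planar_ribbon p K \<and> half_edges K = E \<and> vrot K = \<tau>}"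

lemma finite_planars: "finite E \<Longrightarrow> finite (planars p E \<tau>)"
  by (rule finite_subset[OF _ finite_ribbon_graphs[of E]]) (auto simp: planars_def planar_ribbon_def)

text \<open>If \<open>x\<close> were external or joined inside \<open>{x, y}\<close>, this set would
  be closed once the edge at \<open>y\<close> is cut. Then bridgelessness forbids an edge from
  \<open>y\<close> to the rest, and connectedness forbids that there is a rest.\<close>

lemma planar_bivalent_neighbours:
  assumes K: "planar_ribbon p K" and h: "half_edges K = insert x (insert y E)"
    and xy: "x \<notin> E" "y \<notin> E" "x \<noteq> y" and v: "vrot K x = y" "vrot K y = x" and E: "E \<noteq> {}"
  shows "flip K x \<in> E"
proof (rule ccontr)
  assume n: "flip K x \<notin> E"
  have R: "ribbon_graph K" "connected_ribbon K" "bridgeless K" using K by (auto simp: planar_ribbon_def)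
  have not: "\<not> closed_in K {x, y}"
  proof
    assume "closed_in K {x, y}"
    then have "{x, y} = half_edges K" using R(2) unfolding connected_ribbon_iff[OF R(1)] by blast
    then show False using h xy E by auto
  qed
  have fx: "flip K x \<in> {x, y}" using n flip_in[OF R(1), of x] h by auto
  then have cl: "closed_in (cut_edge K {y, flip K y}) {x, y}"
    unfolding closed_in_cut_edge[OF R(1)] using h v by auto
  have "flip K y \<in> {x, y}"
  proof (cases "flip K y = y")
    case False
    moreover have "y \<in> half_edges K" using h by simp
    ultimately show ?thesis using cl R(3) unfolding bridgeless_iff[OF R(1)] by (metis insertI1 insertI2)
  qed simp
  then have "closed_in K {x, y}" using fx v h by (auto simp: closed_in_def)
  then show False using not by simp
qed

text \<open>\<open>card E - p\<close> is the number of half edges of internal edges in a graph on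
  \<open>E\<close>. Choosing one of them, as partner of \<open>x\<close>, chooses an internal edge
  and one of the two ways to put the vertex on it.\<close>

lemma sum_planars_bivalent:
  fixes f :: "'h ribbon \<Rightarrow> 'a::comm_semiring_1"
  assumes fin: "finite E" and t: "\<tau> permutes insert x (insert y E)"
    and xy: "x \<notin> E" "y \<notin> E" "x \<noteq> y" and v: "\<tau> x = y" "\<tau> y = x" and E: "E \<noteq> {}"
  shows "(\<Sum>K\<in>planars p (insert x (insert y E)) \<tau>. f (delete_bivalent K)) =
    of_nat (card E - p) * (\<Sum>K\<in>planars p E (perm_restrict \<tau> E). f (delete_bivalent K))"
proof -
  let ?\<tau>' = "perm_restrict \<tau> E"
  let ?N = "\<lambda>K'. {u \<in> E. flip K' u \<noteq> u}"
  \<comment> \<open>Removing the vertex joins the former partners of \<open>x\<close> and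
    \<open>y\<close>; keeping \<open>flip K x\<close> records on which edge, and which way round,
    the vertex sat.\<close>
  define shrink where "shrink K = (\<lparr>half_edges = E, vrot = ?\<tau>',
     flip = (\<lambda>h. if h \<in> E then (if h = flip K x then flip K y else if h = flip K y then flip K x else flip K h) else h)\<rparr>,
     flip K x)" for K :: "'h ribbon"
  define grow where "grow = (\<lambda>(K' :: 'h ribbon, u). \<lparr>half_edges = insert x (insert y E), vrot = \<tau>,
     flip = (flip K')(x := u, u := x, y := flip K' u, flip K' u := y)\<rparr>)"
  have t_E: "\<tau> h \<in> E \<longleftrightarrow> h \<in> E" for h
    using permutes_in_image[OF t, of h] v xy permutes_inj[OF t] by (metis insert_iff injD)
  have t': "?\<tau>' permutes E"
    by (rule perm_restrict_permutes[OF t]) (use fin t_E in auto)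
  have down: "bivalent_removal K (fst (shrink K)) x y (flip K x) (flip K y)"
    if K: "K \<in> planars p (insert x (insert y E)) \<tau>" for K
  proof -
    have P: "planar_ribbon p K" and h: "half_edges K = insert x (insert y E)" and vr: "vrot K = \<tau>"
      using K by (auto simp: planars_def)
    have R: "ribbon_graph K" using P by (simp add: planar_ribbon_def)
    note i = ribbonD(4)[OF R]
    have x: "flip K x \<in> E" using planar_bivalent_neighbours[OF P h xy] v vr E by simp
    have y: "flip K y \<in> E"
      using planar_bivalent_neighbours[OF P, of y x E] v vr E h xy by (auto simp: insert_commute)
    have ne: "flip K x \<noteq> flip K y" using i xy by metis
    have out: "flip K h \<in> E" if "h \<in> E" "h \<noteq> flip K x" "h \<noteq> flip K y" for h
      using that flip_in[OF R, of h] i h by (metis insert_iff)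
    let ?K' = "fst (shrink K)"
    have fin': "flip ?K' (flip ?K' h) = h" for h
    proof -
      have a: "flip K h \<noteq> flip K x" "flip K h \<noteq> flip K y" if "h \<in> E"
        using that i xy by metis+
      consider "h \<notin> E" | "h = flip K x" | "h = flip K y" | "h \<in> E" "h \<noteq> flip K x" "h \<noteq> flip K y" by blast
      then show ?thesis
        by cases (use x y ne out a i in \<open>simp_all add: shrink_def\<close>)
    qed
    have "flip ?K' permutes E"
      by (rule involution_permutes[OF fin']) (simp add: shrink_def)
    then have R': "ribbon_graph ?K'" unfolding ribbon_graph_def using fin' fin t' by (auto simp: shrink_def)
    show ?thesis
      by (unfold_locales; (rule R R')?) (use R R' x y ne h xy vr v in \<open>auto simp: shrink_def perm_restrict_def\<close>)
  qed
  have up: "bivalent_removal (grow (K', u)) K' x y u (flip K' u)"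
    if K: "K' \<in> planars p E ?\<tau>'" and u: "u \<in> ?N K'" for K' u
  proof -
    have h: "half_edges K' = E" and vr: "vrot K' = ?\<tau>'" and R: "ribbon_graph K'"
      using K by (auto simp: planars_def planar_ribbon_def)
    note i = ribbonD(4)[OF R]
    have uE: "u \<in> E" "flip K' u \<noteq> u" using u by auto
    have u': "flip K' u \<in> E" using flip_in[OF R] uE h by simp
    have o: "flip K' h = h" if "h \<notin> E" for h using permutes_not_in[OF ribbonD(3)[OF R]] that h by simp
    let ?K = "grow (K', u)"
    have ii: "flip K' h = u \<longleftrightarrow> h = flip K' u" "flip K' h = flip K' u \<longleftrightarrow> h = u" for h
      using i by metis+
    have xi: "flip K' h = x \<longleftrightarrow> h = x" "flip K' h = y \<longleftrightarrow> h = y" for h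
      using i o xy by metis+
    have fin': "flip ?K (flip ?K h) = h" for h
    proof -
      consider "h = x" | "h = y" | "h = u" | "h = flip K' u" | "h \<notin> {x, y, u, flip K' u}" by blast
      then show ?thesis
        by cases (use uE u' xy ii xi i in \<open>auto simp: grow_def\<close>)
    qed
    have "flip ?K permutes insert x (insert y E)"
      by (rule involution_permutes[OF fin']) (use uE u' o in \<open>auto simp: grow_def\<close>)
    then have R': "ribbon_graph ?K" unfolding ribbon_graph_def using fin' fin t by (auto simp: grow_def)
    show ?thesis
      by (unfold_locales; (rule R R')?) (use R R' uE u' xy h vr v in \<open>auto simp: grow_def perm_restrict_def\<close>)
  qed
  have "(\<Sum>K\<in>planars p (insert x (insert y E)) \<tau>. f (delete_bivalent K)) =
      (\<Sum>(K', u)\<in>Sigma (planars p E ?\<tau>') ?N. f (delete_bivalent K'))"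
  proof (rule sum.reindex_bij_witness[of _ grow shrink])
    fix K assume K: "K \<in> planars p (insert x (insert y E)) \<tau>"
    interpret d: bivalent_removal K "fst (shrink K)" x y "flip K x" "flip K y" by (rule down[OF K])
    have s: "shrink K = (fst (shrink K), flip K x)" by (simp add: shrink_def)
    show "shrink K \<in> Sigma (planars p E ?\<tau>') ?N"
    proof -
      have "flip (fst (shrink K)) (flip K x) \<noteq> flip K x" "flip K x \<in> E"
        using d.uu d.flip_uu by (simp_all add: shrink_def)
      moreover have "planar_ribbon p (fst (shrink K))" using d.planar_iff K by (simp add: planars_def)
      moreover have "half_edges (fst (shrink K)) = E" "vrot (fst (shrink K)) = ?\<tau>'"
        by (simp_all add: shrink_def)
      ultimately show ?thesis by (subst s) (simp add: planars_def)
    qed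
    show "(case shrink K of (K', u) \<Rightarrow> f (delete_bivalent K')) = f (delete_bivalent K)"
      by (subst s) (simp add: d.delete_bivalent_eq)
    have KE: "half_edges K = insert x (insert y E)" "vrot K = \<tau>" using K by (auto simp: planars_def)
    have gs: "grow (shrink K) = grow (fst (shrink K), flip K x)" using s by (rule arg_cong)
    have "flip (grow (shrink K)) h = flip K h" for h
    proof -
      have o: "flip K h = h" if "h \<notin> insert x (insert y E)"
        using permutes_not_in[OF ribbonD(3)[OF d.K]] that KE by simp
      have fs: "flip (fst (shrink K)) (flip K x) = flip K y" by (rule d.flip_uu)
      consider "h = x" | "h = y" | "h = flip K x" | "h = flip K y" | "h \<notin> {x, y, flip K x, flip K y}" by blast
      then show ?thesis
      proof cases
        case 5
        then have "flip (grow (shrink K)) h = flip (fst (shrink K)) h"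
          unfolding gs using fs by (simp add: grow_def)
        then show ?thesis using o 5 by (auto simp: shrink_def)
      qed (unfold gs, use fs d.distinct d.flips d.uu d.xy in \<open>auto simp: grow_def\<close>)
    qed
    then have "flip (grow (shrink K)) = flip K" by (rule ext)
    then show "grow (shrink K) = K"
      using KE by (intro ribbon.equality) (assumption | simp add: grow_def shrink_def)+
  next
    fix b assume b: "b \<in> Sigma (planars p E ?\<tau>') ?N"
    obtain K' u where b': "b = (K', u)" by force
    have K': "K' \<in> planars p E ?\<tau>'" "u \<in> ?N K'" using b b' by auto
    interpret d: bivalent_removal "grow (K', u)" K' x y u "flip K' u" by (rule up[OF K'])
    show "grow b \<in> planars p (insert x (insert y E)) \<tau>"
      using d.planar_iff K' unfolding b' by (auto simp: planars_def) (auto simp: grow_def)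
    have KE: "half_edges K' = E" "vrot K' = ?\<tau>'" using K' by (auto simp: planars_def)
    have "flip (fst (shrink (grow (K', u)))) h = flip K' h" for h
    proof (cases "h \<in> E")
      case False
      then show ?thesis using permutes_not_in[OF ribbonD(3)[OF d.K']] KE by (simp add: shrink_def)
    next
      case True
      then show ?thesis
        using d.flip_xy d.flip_uu d.flips d.flip_E[of h] KE by (auto simp: shrink_def)
    qed
    then have "fst (shrink (grow (K', u))) = K'"
      using KE by (intro ribbon.equality) (auto simp: shrink_def)
    moreover have "snd (shrink (grow (K', u))) = u" using d.flip_xy by (simp add: shrink_def)
    ultimately show "shrink (grow b) = b" unfolding b' by (simp add: prod_eq_iff)
  qed
  also have "\<dots> = (\<Sum>K'\<in>planars p E ?\<tau>'. \<Sum>u\<in>?N K'. f (delete_bivalent K'))"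
    using fin finite_planars by (subst sum.Sigma) auto
  also have "\<dots> = (\<Sum>K'\<in>planars p E ?\<tau>'. of_nat (card E - p) * f (delete_bivalent K'))"
  proof (rule sum.cong[OF refl])
    fix K' assume "K' \<in> planars p E ?\<tau>'"
    then have e: "card (external K') = p" "half_edges K' = E" by (auto simp: planars_def planar_ribbon_def)
    have "?N K' = E - external K'" using e by (auto simp: external_def)
    then have "card (?N K') = card E - p"
      using e fin by (simp add: card_Diff_subset external_def)
    then show "(\<Sum>u\<in>?N K'. f (delete_bivalent K')) = of_nat (card E - p) * f (delete_bivalent K')" by simp
  qed
  finally show ?thesis by (simp add: sum_distrib_left)
qed

section \<open>Isomorphisms as relabellings\<close>

definition conjugate :: "('h \<Rightarrow> 'h) \<Rightarrow> ('h \<Rightarrow> 'h) \<Rightarrow> 'h \<Rightarrow> 'h" where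
  "conjugate F p = F \<circ> p \<circ> inv F"

text \<open>Isomorphisms are realised by bijections of the whole type, so that an isomorphic copy is
  a term and every notion can be transported by rewriting. For finite graphs nothing is lost, by
  \<open>ribbon_iso_imp_relabel\<close>.\<close>

definition relabel :: "('h \<Rightarrow> 'h) \<Rightarrow> 'h ribbon \<Rightarrow> 'h ribbon" where
  "relabel F G = \<lparr>half_edges = F ` half_edges G, vrot = conjugate F (vrot G), flip = conjugate F (flip G)\<rparr>"

lemma relabel_simps [simp]:
  "half_edges (relabel F G) = F ` half_edges G" "vrot (relabel F G) = conjugate F (vrot G)"
  "flip (relabel F G) = conjugate F (flip G)"
  by (simp_all add: relabel_def)

lemma relabel_id [simp]: "relabel id G = G"
  by (simp add: relabel_def conjugate_def)

lemma Collect_image: "{y \<in> f ` A. P y} = f ` {x \<in> A. P (f x)}"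
  by blast

context
  fixes F :: "'h \<Rightarrow> 'h"
  assumes F: "bij F"
begin

lemma bij_eq_iff: "F x = F y \<longleftrightarrow> x = y"
  using F by (simp add: bij_is_inj inj_eq)

lemma bij_image_mem_iff: "F x \<in> F ` A \<longleftrightarrow> x \<in> A"
  using F by (simp add: bij_is_inj inj_image_mem_iff)

lemma bij_preimageE: obtains x where "y = F x"
  using F by (meson bij_pointE)

lemma bij_all_iff: "(\<forall>y. P y) \<longleftrightarrow> (\<forall>x. P (F x))"
  by (metis bij_preimageE)

lemma bij_preimage_setE: obtains B where "A = F ` B"
  using F bij_is_surj by (metis surj_image_vimage_eq)

lemma inj_on_image_bij: "inj_on ((`) F) \<A>"
  using F by (meson bij_is_inj inj_image_eq_iff inj_onI)

lemma bij_inv_apply: "inv F (F x) = x" "F (inv F y) = y"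
  using F by (simp_all add: bij_is_inj bij_is_surj surj_f_inv_f)

lemma conjugate_apply [simp]: "conjugate F p (F x) = F (p x)"
  by (simp add: conjugate_def bij_inv_apply)

lemma conjugate_eqI: "(\<And>x. q (F x) = F (p x)) \<Longrightarrow> conjugate F p = q"
  by (rule ext, rule bij_preimageE) (metis conjugate_apply bij_preimageE)

lemma conjugate_funpow: "(conjugate F p ^^ n) (F x) = F ((p ^^ n) x)"
  by (induction n) simp_all

lemma conjugate_comp: "conjugate F p \<circ> conjugate F q = conjugate F (p \<circ> q)"
  by (rule sym, rule conjugate_eqI) simp

lemma conjugate_permutes:
  assumes "p permutes S" shows "conjugate F p permutes F ` S"
proof -
  have "bij (conjugate F p)"
    unfolding conjugate_def using F assms by (simp add: bij_comp bij_imp_bij_inv permutes_bij)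
  moreover have "conjugate F p y = y" if "y \<notin> F ` S" for y
    using that assms permutes_not_in by (metis bij_preimageE conjugate_apply imageI)
  ultimately show ?thesis unfolding permutes_def by (metis bij_pointE)
qed

lemma orbit_conjugate: "orbit (conjugate F p) (F x) = F ` orbit p x"
  unfolding orbit_altdef by (auto simp: conjugate_funpow)

lemma cycles_of_conjugate: "cycles_of (conjugate F p) (F ` S) = (`) F ` cycles_of p S"
  by (simp add: cycles_of_def image_image orbit_conjugate)

lemma perm_restrict_conjugate: "perm_restrict (conjugate F p) (F ` A) = conjugate F (perm_restrict p A)"
  by (rule sym, rule conjugate_eqI) (simp add: perm_restrict_def bij_image_mem_iff)

lemma delete_outside_conjugate:
  "delete_outside (conjugate F p) (F ` S) = conjugate F (delete_outside p S)"
  by (rule sym, rule conjugate_eqI)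
    (simp add: delete_outside_def bij_image_mem_iff conjugate_funpow)

lemma external_relabel: "external (relabel F G) = F ` external G"
  by (auto simp: external_def bij_eq_iff)

lemma vertices_relabel: "vertices (relabel F G) = (`) F ` vertices G"
  by (simp add: vertices_def cycles_of_conjugate)

lemma card_image_bij: "card (F ` A) = card A"
  using F by (meson bij_is_inj card_image inj_on_subset subset_UNIV)

lemma card_image_image_bij: "card ((`) F ` \<A>) = card \<A>"
  by (rule card_image[OF inj_on_image_bij])

lemma internal_edges_relabel: "internal_edges (relabel F G) = (`) F ` internal_edges G"
  by (auto simp: internal_edges_def cycles_of_conjugate card_image_bij)

lemma bij_image_disjoint_iff: "F ` A \<inter> F ` B = {} \<longleftrightarrow> A \<inter> B = {}"
  by (simp add: image_Int[symmetric] bij_is_inj[OF F])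

lemma relabel_cut_edge: "cut_edge (relabel F G) (F ` e) = relabel F (cut_edge G e)"
  unfolding cut_edge_def relabel_def
  by simp (rule sym, rule conjugate_eqI, simp add: bij_image_mem_iff)

lemma component_graph_relabel: "component_graph (relabel F G) (F ` C) = relabel F (component_graph G C)"
  by (simp add: component_graph_def relabel_def perm_restrict_conjugate)

lemma contract_relabel: "contract (relabel F G) (relabel F H) = relabel F (contract G H)"
  by (simp add: contract_def relabel_def external_relabel[unfolded relabel_def]
      conjugate_comp delete_outside_conjugate perm_restrict_conjugate)

lemma bivalent_relabel: "bivalent (relabel F G) = F ` bivalent G"
  unfolding bivalent_def vertices_relabel Collect_image by (simp add: card_image_bij image_Union)

lemma delete_bivalent_relabel: "delete_bivalent (relabel F G) = relabel F (delete_bivalent G)"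
proof -
  have "(\<lambda>h. conjugate F (flip G) (if h \<in> F ` bivalent G then conjugate F (vrot G) h else h)) =
      conjugate F (\<lambda>h. flip G (if h \<in> bivalent G then vrot G h else h))"
    by (rule sym, rule conjugate_eqI) (simp add: bij_image_mem_iff)
  moreover have "F ` half_edges G - F ` bivalent G = F ` (half_edges G - bivalent G)"
    by (simp add: image_set_diff bij_is_inj[OF F])
  ultimately show ?thesis
    unfolding delete_bivalent_def bivalent_relabel relabel_simps
    by (simp add: delete_outside_conjugate perm_restrict_conjugate relabel_def)
qed

lemma closed_in_relabel: "closed_in (relabel F G) (F ` A) \<longleftrightarrow> closed_in G A"
  by (simp add: closed_in_def image_image inj_image_subset_iff[OF bij_is_inj[OF F]])
    (simp add: image_subset_iff bij_image_mem_iff)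

lemma ribbon_graph_relabel:
  assumes "ribbon_graph G" shows "ribbon_graph (relabel F G)"
  using ribbonD[OF assms] conjugate_permutes
  unfolding ribbon_graph_def bij_all_iff[where P = "\<lambda>h. flip _ (flip _ h) = h"] by simp

lemma faces_relabel: "ribbon_graph G \<Longrightarrow> faces (relabel F G) = (`) F ` faces G"
  by (simp add: faces_eq ribbon_graph_relabel conjugate_comp cycles_of_conjugate)

lemma boundaries_relabel: "ribbon_graph G \<Longrightarrow> boundaries (relabel F G) = (`) F ` boundaries G"
  unfolding boundaries_def faces_relabel external_relabel Collect_image by (simp add: bij_image_disjoint_iff)

lemma internal_faces_relabel: "ribbon_graph G \<Longrightarrow> internal_faces (relabel F G) = (`) F ` internal_faces G"
  unfolding internal_faces_def faces_relabel external_relabel Collect_image by (simp add: bij_image_disjoint_iff)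

lemma loop_number_relabel: "ribbon_graph G \<Longrightarrow> loop_number (relabel F G) = loop_number G"
  by (simp add: loop_number_def internal_faces_relabel card_image_image_bij)

lemma linked_relabel:
  assumes G: "ribbon_graph G" and x: "x \<in> half_edges G"
  shows "linked (relabel F G) `` {F x} = F ` (linked G `` {x})"
proof (rule set_eqI)
  fix z
  obtain y where z: "z = F y" by (rule bij_preimageE)
  have x': "F x \<in> half_edges (relabel F G)" using x by simp
  have "(\<forall>A. closed_in (relabel F G) A \<longrightarrow> F x \<in> A \<longrightarrow> F y \<in> A) \<longleftrightarrow>
      (\<forall>B. closed_in G B \<longrightarrow> x \<in> B \<longrightarrow> y \<in> B)"
  proof (intro iffI allI impI)
    fix B assume "\<forall>A. closed_in (relabel F G) A \<longrightarrow> F x \<in> A \<longrightarrow> F y \<in> A" "closed_in G B" "x \<in> B"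
    then have "F y \<in> F ` B" by (simp add: closed_in_relabel)
    then show "y \<in> B" by (simp add: bij_image_mem_iff)
  next
    fix A assume *: "\<forall>B. closed_in G B \<longrightarrow> x \<in> B \<longrightarrow> y \<in> B" "closed_in (relabel F G) A" "F x \<in> A"
    obtain B where B: "A = F ` B" by (rule bij_preimage_setE)
    show "F y \<in> A" using * unfolding B closed_in_relabel bij_image_mem_iff by blast
  qed
  then show "z \<in> linked (relabel F G) `` {F x} \<longleftrightarrow> z \<in> F ` (linked G `` {x})"
    unfolding z bij_image_mem_iff Image_singleton_iff linked_iff[OF G x] linked_iff[OF ribbon_graph_relabel[OF G] x'] .
qed

lemma components_relabel:
  assumes "ribbon_graph G" shows "components (relabel F G) = (`) F ` components G"
proof -
  have "components (relabel F G) = (\<lambda>x. linked (relabel F G) `` {F x}) ` half_edges G"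
    by (simp add: components_def image_image)
  also have "\<dots> = (\<lambda>x. F ` (linked G `` {x})) ` half_edges G"
    by (rule image_cong[OF refl linked_relabel[OF assms]])
  finally show ?thesis by (simp add: components_def image_image)
qed

lemma connected_relabel:
  assumes G: "ribbon_graph G" shows "connected_ribbon (relabel F G) \<longleftrightarrow> connected_ribbon G"
proof -
  have "(\<forall>A. closed_in (relabel F G) A \<longrightarrow> A \<noteq> {} \<longrightarrow> A = F ` half_edges G) \<longleftrightarrow>
    (\<forall>B. closed_in (relabel F G) (F ` B) \<longrightarrow> F ` B \<noteq> {} \<longrightarrow> F ` B = F ` half_edges G)"
    by (metis bij_preimage_setE)
  also have "\<dots> \<longleftrightarrow> (\<forall>B. closed_in G B \<longrightarrow> B \<noteq> {} \<longrightarrow> B = half_edges G)"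
    by (simp add: closed_in_relabel inj_image_eq_iff[OF bij_is_inj[OF F]])
  finally show ?thesis
    by (simp add: connected_ribbon_iff[OF G] connected_ribbon_iff[OF ribbon_graph_relabel[OF G]])
qed

lemma bridgeless_relabel:
  assumes G: "ribbon_graph G" shows "bridgeless (relabel F G) \<longleftrightarrow> bridgeless G"
proof -
  have "components (cut_edge (relabel F G) (F ` e)) = components (relabel F G) \<longleftrightarrow>
      components (cut_edge G e) = components G" if e: "e \<in> internal_edges G" for e
  proof -
    have "ribbon_graph (cut_edge G e)"
      using e ribbon_graph_cut_edge[OF G] by (auto simp: internal_edges_eq[OF G])
    then show ?thesis
      by (simp add: relabel_cut_edge components_relabel G inj_on_image_eq_iff[OF inj_on_image_bij[of UNIV]])
  qed
  then show ?thesis unfolding bridgeless_def internal_edges_relabel by simp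
qed

lemma planar_relabel:
  assumes G: "ribbon_graph G" shows "planar_ribbon p (relabel F G) \<longleftrightarrow> planar_ribbon p G"
  using G by (simp add: planar_ribbon_def ribbon_graph_relabel connected_relabel bridgeless_relabel
      genus_def vertices_relabel internal_edges_relabel faces_relabel boundaries_relabel
      external_relabel card_image_image_bij card_image_bij)

lemma generating_relabel:
  assumes G: "ribbon_graph G" shows "generating_graph p (relabel F G) \<longleftrightarrow> generating_graph p G"
  using G by (simp add: generating_graph_iff planar_relabel vertices_relabel card_image_bij)

lemma is_generator_relabel:
  "ribbon_graph G \<Longrightarrow> is_generator (relabel F G) \<longleftrightarrow> is_generator G"
  by (simp add: is_generator_def generating_relabel)

lemma all_generators_relabel:
  assumes "all_generators G" shows "all_generators (relabel F G)"
proof -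
  have G: "ribbon_graph G" using assms by (simp add: all_generators_def)
  have "is_generator (component_graph (relabel F G) (F ` C))" if "C \<in> components G" for C
    using that assms ribbon_graph_component_graph[OF G component_closed[OF G that]]
    by (simp add: component_graph_relabel is_generator_relabel all_generators_def)
  then show ?thesis
    unfolding all_generators_def components_relabel[OF G] using ribbon_graph_relabel[OF G] by blast
qed

lemma subribbon_relabel:
  assumes "subribbon H G" shows "subribbon (relabel F H) (relabel F G)"
  using assms by (auto simp: subribbon_def ribbon_graph_relabel internal_edges_relabel)

lemma relabel_relabel: "bij F' \<Longrightarrow> relabel F (relabel F' G) = relabel (F \<circ> F') G"
  using F by (simp add: relabel_def conjugate_def o_inv_distrib image_comp o_assoc)

lemma relabel_inv: "relabel (inv F) (relabel F G) = G"
proof -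
  have "relabel (inv F) (relabel F G) = relabel id G"
    using F by (simp add: relabel_def conjugate_def image_comp o_assoc inv_inv_eq)
      (simp add: bij_is_inj o_assoc[symmetric])
  then show ?thesis by simp
qed

lemma ribbon_iso_relabel: "ribbon_iso F G (relabel F G)"
  using inj_on_subset[OF bij_is_inj[OF F]] unfolding ribbon_iso_def by (auto simp: bij_betw_def)

end

section \<open>From isomorphisms to relabellings\<close>

lemma relabel_cong:
  assumes G: "ribbon_graph G" and F: "bij F" "bij F'" and eq: "\<And>x. x \<in> half_edges G \<Longrightarrow> F x = F' x"
  shows "relabel F G = relabel F' G"
proof -
  have c: "conjugate F p = conjugate F' p" if p: "p permutes half_edges G" for p
  proof
    fix y
    obtain x where x: "y = F x" by (rule bij_preimageE[OF F(1)])
    show "conjugate F p y = conjugate F' p y"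
    proof (cases "x \<in> half_edges G")
      case True
      then have "y = F' x" "F (p x) = F' (p x)" using eq x p by (auto simp: permutes_in_image)
      then show ?thesis using x conjugate_apply F by metis
    next
      case False
      obtain x' where x': "y = F' x'" by (rule bij_preimageE[OF F(2)])
      have "x' \<notin> half_edges G" using False eq x x' bij_eq_iff[OF F(1)] by metis
      then show ?thesis using False x x' conjugate_apply[OF F(1), of p x]
          conjugate_apply[OF F(2), of p x'] permutes_not_in[OF p] by simp
    qed
  qed
  have "F ` half_edges G = F' ` half_edges G" by (rule image_cong[OF refl eq])
  then show ?thesis using c ribbonD[OF G] by (simp add: relabel_def)
qed

text \<open>\<open>A\<close> and \<open>B\<close> have equally many elements, so their complements
  within \<open>A \<union> B\<close> can be matched as well, and outside \<open>A \<union> B\<close>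
  the identity serves.\<close>

lemma bij_extend:
  fixes f :: "'a \<Rightarrow> 'a"
  assumes "finite A" "finite B" "bij_betw f A B"
  obtains F where "bij F" "\<And>x. x \<in> A \<Longrightarrow> F x = f x"
proof -
  have "card A = card B" using assms by (simp add: bij_betw_same_card)
  then have "card (A \<union> B - A) = card (A \<union> B - B)"
    using assms by (simp add: card_Diff_subset)
  then obtain g where g: "bij_betw g (A \<union> B - A) (A \<union> B - B)"
    using assms finite_same_card_bij[of "A \<union> B - A" "A \<union> B - B"] by auto
  define F where "F x = (if x \<in> A then f x else if x \<in> B then g x else x)" for x
  have "bij_betw F A B"
    by (subst bij_betw_cong[of A F f]) (simp_all add: F_def assms)
  moreover have "bij_betw F (A \<union> B - A) (A \<union> B - B)"
    by (subst bij_betw_cong[of _ F g]) (auto simp: F_def g)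
  ultimately have "bij_betw F (A \<union> (A \<union> B - A)) (B \<union> (A \<union> B - B))"
    by (rule bij_betw_combine) auto
  moreover have "bij_betw F (- (A \<union> B)) (- (A \<union> B))"
    by (subst bij_betw_cong[of _ F id]) (auto simp: F_def)
  ultimately have "bij_betw F ((A \<union> (A \<union> B - A)) \<union> - (A \<union> B)) ((B \<union> (A \<union> B - B)) \<union> - (A \<union> B))"
    by (rule bij_betw_combine) auto
  moreover have "(A \<union> (A \<union> B - A)) \<union> - (A \<union> B) = UNIV" "(B \<union> (A \<union> B - B)) \<union> - (A \<union> B) = UNIV" by auto
  ultimately have "bij F" by simp
  then show ?thesis by (rule that) (simp add: F_def)
qed

lemma ribbon_iso_imp_relabel:
  assumes G: "ribbon_graph G" and G': "ribbon_graph G'" and f: "ribbon_iso f G G'"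
  obtains F where "bij F" "relabel F G = G'" "\<And>x. x \<in> half_edges G \<Longrightarrow> F x = f x"
proof -
  have b: "bij_betw f (half_edges G) (half_edges G')" using f by (simp add: ribbon_iso_def)
  obtain F where F: "bij F" "\<And>x. x \<in> half_edges G \<Longrightarrow> F x = f x"
    using bij_extend[OF ribbonD(1)[OF G] ribbonD(1)[OF G'] b] by blast
  have im: "F ` half_edges G = half_edges G'"
    using b F(2) by (simp add: bij_betw_def cong: image_cong)
  have c: "conjugate F p = q"
    if p: "p permutes half_edges G" and q: "q permutes half_edges G'"
      and pq: "\<And>h. h \<in> half_edges G \<Longrightarrow> f (p h) = q (f h)" for p q
  proof (rule conjugate_eqI[OF F(1)])
    fix x
    show "q (F x) = F (p x)"
    proof (cases "x \<in> half_edges G")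
      case True then show ?thesis using F(2) pq p by (simp add: permutes_in_image)
    next
      case False
      then have "F x \<notin> half_edges G'" using im bij_image_mem_iff[OF F(1)] by metis
      then show ?thesis using False p q by (simp add: permutes_not_in)
    qed
  qed
  have "conjugate F (vrot G) = vrot G'" "conjugate F (flip G) = flip G'"
    using f ribbonD[OF G] ribbonD[OF G'] by (auto intro!: c simp: ribbon_iso_def)
  then have "relabel F G = G'" using im by (simp add: relabel_def)
  then show ?thesis using that F by blast
qed

lemma iso_class_eq:
  assumes "ribbon_graph G" shows "iso_class G = {relabel F G | F. bij F}"
proof (intro equalityI subsetI)
  fix K assume "K \<in> iso_class G"
  then obtain f where "ribbon_graph K" "ribbon_iso f G K" by (auto simp: iso_class_def)
  from ribbon_iso_imp_relabel[OF assms this] show "K \<in> {relabel F G | F. bij F}" by blast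
next
  fix K assume "K \<in> {relabel F G | F. bij F}"
  then show "K \<in> iso_class G"
    using ribbon_iso_relabel ribbon_graph_relabel assms by (auto simp: iso_class_def)
qed

lemma iso_class_relabel:
  assumes G: "ribbon_graph G" and F: "bij F" shows "iso_class (relabel F G) = iso_class G"
  unfolding iso_class_eq[OF G] iso_class_eq[OF ribbon_graph_relabel[OF F G]]
proof (intro equalityI subsetI)
  fix K assume "K \<in> {relabel F' (relabel F G) | F'. bij F'}"
  then obtain F' where "K = relabel F' (relabel F G)" "bij F'" by blast
  then have "K = relabel (F' \<circ> F) G" "bij (F' \<circ> F)" using F by (simp_all add: relabel_relabel bij_comp)
  then show "K \<in> {relabel F G | F. bij F}" by blast
next
  fix K assume "K \<in> {relabel F G | F. bij F}"
  then obtain F' where F': "K = relabel F' G" "bij F'" by blast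
  have "relabel (F' \<circ> inv F) (relabel F G) = relabel F' (relabel (inv F) (relabel F G))"
    by (rule relabel_relabel[OF F'(2) bij_imp_bij_inv[OF F], symmetric])
  then have "K = relabel (F' \<circ> inv F) (relabel F G)" using F F' by (simp add: relabel_inv)
  moreover have "bij (F' \<circ> inv F)" using F F' by (simp add: bij_comp bij_imp_bij_inv)
  ultimately show "K \<in> {relabel F' (relabel F G) | F'. bij F'}" by blast
qed

lemma generator_of_relabel:
  "ribbon_graph G \<Longrightarrow> bij F \<Longrightarrow> generator_of (relabel F G) = generator_of G"
  by (simp add: generator_of_def iso_class_relabel)

lemma monomial_of_relabel:
  assumes G: "ribbon_graph G" and F: "bij F" shows "monomial_of (relabel F G) = monomial_of G"
proof -
  have "mset_set ((`) F ` components G) = image_mset ((`) F) (mset_set (components G))"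
    by (rule image_mset_mset_set[symmetric]) (rule inj_on_image_bij[OF F])
  then have "monomial_of (relabel F G) =
      image_mset (\<lambda>C. generator_of (component_graph (relabel F G) (F ` C))) (mset_set (components G))"
    by (simp add: monomial_of_def components_relabel[OF F G] image_mset.compositionality comp_def)
  also have "\<dots> = monomial_of G"
    unfolding monomial_of_def
  proof (rule image_mset_cong)
    fix C assume "C \<in># mset_set (components G)"
    then have "C \<in> components G" using finite_components[OF G] by simp
    then show "generator_of (component_graph (relabel F G) (F ` C)) = generator_of (component_graph G C)"
      using ribbon_graph_component_graph[OF G component_closed[OF G]] F
      by (simp add: component_graph_relabel generator_of_relabel)
  qed
  finally show ?thesis .
qed

lemma graph_elem_relabel: "ribbon_graph G \<Longrightarrow> bij F \<Longrightarrow> graph_elem (relabel F G) = graph_elem G"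
  by (simp add: graph_elem_def monomial_of_relabel)

lemma orbit_card_2:
  assumes "p permutes X" "finite X" "card (orbit p h) = 2" shows "p (p h) = h" "orbit p h = {h, p h}"
proof -
  have ne: "p h \<noteq> h" using assms(3) orbit_eq_singleton_iff[of p h] by auto
  have sub: "{h, p h} \<subseteq> orbit p h" using self_in_orbit[OF assms(1,2)] orbit.base[of p h] by blast
  show o: "orbit p h = {h, p h}"
    by (rule card_subset_eq[OF _ sub, symmetric]) (use assms(3) ne card_ge_0_finite[of "orbit p h"] in auto)
  have "p (p h) \<noteq> p h" using ne permutes_inj[OF assms(1)] by (auto dest: injD)
  moreover have "p (p h) \<in> orbit p h" by (intro orbit.intros)
  ultimately show "p (p h) = h" using o by simp
qed

text \<open>The new involution is again an involution because the walk defining it is reversed by crossing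
  the bivalent vertices backwards.\<close>

lemma ribbon_graph_delete_bivalent:
  assumes G: "ribbon_graph G" shows "ribbon_graph (delete_bivalent G)"
proof -
  let ?B = "bivalent G" and ?S = "half_edges G - bivalent G"
  define g where "g h = (if h \<in> ?B then vrot G h else h)" for h
  define f where "f h = flip G (g h)" for h
  have sB: "?B \<subseteq> half_edges G"
    using Union_cycles_of[OF ribbonD(2,1)[OF G]] by (auto simp: bivalent_def vertices_def)
  have orb: "orbit (vrot G) h \<subseteq> ?B \<and> vrot G (vrot G h) = h" if h: "h \<in> ?B" for h
  proof -
    obtain w where w: "w \<in> vertices G" "card w = 2" "h \<in> w" using h by (auto simp: bivalent_def)
    then have "orbit (vrot G) h = w"
      using orbit_sym(2)[OF ribbonD(2,1)[OF G]] by (auto simp: vertices_def cycles_of_def)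
    then show ?thesis using w orbit_card_2[OF ribbonD(2,1)[OF G]] by (auto simp: bivalent_def)
  qed
  have vB: "vrot G h \<in> ?B" if "h \<in> ?B" for h
    using orb[OF that] orbit.base[of "vrot G" h] by blast
  have gB: "g h \<in> ?B \<longleftrightarrow> h \<in> ?B" for h using vB by (simp add: g_def)
  have gg: "g (g h) = h" for h using orb[of h] vB[of h] by (simp add: g_def)
  have gS: "g h = h" if "h \<in> ?S" for h using that by (simp add: g_def)
  have gH: "g h \<in> half_edges G \<longleftrightarrow> h \<in> half_edges G" for h using vrot_in[OF G] by (simp add: g_def)
  have g_perm: "g permutes half_edges G"
    by (rule involution_permutes[OF gg]) (use sB in \<open>auto simp: g_def\<close>)
  have f_perm: "f permutes half_edges G"
    using permutes_compose[OF g_perm ribbonD(3)[OF G]] by (simp add: f_def[abs_def] comp_def)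
  \<comment> \<open>\<open>f\<close> is the product of the involutions \<open>flip G\<close> and
    \<open>g\<close>, so conjugation by \<open>g\<close> inverts it; this is stated without
    mentioning inverses.\<close>
  have key: "g ((f ^^ i) (g ((f ^^ i) z))) = z" for i z
  proof (induction i arbitrary: z)
    case (Suc i)
    have "(f ^^ Suc i) z = (f ^^ i) (f z)" by (simp add: funpow_swap1)
    then have "g ((f ^^ Suc i) (g ((f ^^ Suc i) z))) = g (f ((f ^^ i) (g ((f ^^ i) (f z)))))" by simp
    also have "(f ^^ i) (g ((f ^^ i) (f z))) = g (f z)" using Suc[of "f z"] gg by metis
    also have "g (f (g (f z))) = z" by (simp add: f_def gg ribbonD(4)[OF G])
    finally show ?case .
  qed (simp add: gg)
  have reversed: "(f ^^ j) (g ((f ^^ i) z)) = g ((f ^^ (i - j)) z)" if "j \<le> i" for i j z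
  proof -
    have "(f ^^ i) z = (f ^^ j) ((f ^^ (i - j)) z)"
      using that by (metis funpow_add le_add_diff_inverse o_apply)
    then show ?thesis using key[of j "(f ^^ (i - j)) z"] gg by metis
  qed
  define q where "q = delete_outside f ?S"
  have q_perm: "q permutes ?S"
    unfolding q_def by (rule delete_outside_permutes[OF f_perm ribbonD(1)[OF G]]) blast
  have "q (q x) = x" for x
  proof (cases "x \<in> ?S")
    case True
    obtain m where m: "0 < m" "(f ^^ m) x \<in> ?S" "\<And>i. 0 < i \<Longrightarrow> i < m \<Longrightarrow> (f ^^ i) x \<notin> ?S"
      "q x = (f ^^ m) x"
      using delete_outsideE[OF f_perm ribbonD(1)[OF G] True] unfolding q_def by blast
    let ?y = "(f ^^ m) x"
    have y: "(f ^^ j) ?y = g ((f ^^ (m - j)) x)" if "j \<le> m" for j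
      using reversed[OF that, of x] gS[OF m(2)] by simp
    have "delete_outside f ?S ?y = (f ^^ m) ?y"
    proof (rule delete_outside_eqI[OF m(2,1)])
      show "(f ^^ m) ?y \<in> ?S" using y[of m] gS[OF True] True by simp
      show "(f ^^ j) ?y \<notin> ?S" if "0 < j" "j < m" for j
      proof -
        have "(f ^^ (m - j)) x \<notin> ?S" using m(3)[of "m - j"] that by simp
        then have "g ((f ^^ (m - j)) x) \<notin> ?S" using gB gH by blast
        then show ?thesis using y[of j] that by simp
      qed
    qed
    then show ?thesis using y[of m] gS[OF True] m(4) by (simp add: q_def)
  next
    case False
    then have "q x = x" unfolding q_def delete_outside_def by (rule if_not_P)
    then show ?thesis by simp
  qed
  moreover have "perm_restrict (vrot G) ?S permutes ?S"
  proof (rule perm_restrict_permutes[OF ribbonD(2,1)[OF G]])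
    have "vrot G h \<notin> ?B" if "h \<in> ?S" for h
    proof
      assume v: "vrot G h \<in> ?B"
      have "h \<in> orbit (vrot G) (vrot G h)"
        using orbit_sym(1)[OF ribbonD(2,1)[OF G] orbit.base] .
      then show False using orb[OF v] that by blast
    qed
    then show "vrot G ` ?S \<subseteq> ?S" using vrot_in[OF G] by auto
  qed blast
  ultimately show ?thesis
    using q_perm ribbonD(1)[OF G]
    unfolding ribbon_graph_def delete_bivalent_def q_def f_def[abs_def] g_def by simp
qed

text \<open>Relabelling permutes the admissible subgraphs and commutes with contraction and
  deletion. The right tensor factor must be a ribbon graph for its class to be invariant, which is
  what \<open>ribbon_graph_delete_bivalent\<close> provides.\<close>

lemma coproduct_graph_relabel:
  assumes G: "ribbon_graph G" and F: "bij F"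
  shows "coproduct_graph (relabel F G) = coproduct_graph G"
proof -
  have F': "bij (inv F)" using F by (rule bij_imp_bij_inv)
  have i: "relabel F (relabel (inv F) K) = K" for K
    using relabel_inv[OF F'] by (simp add: inv_inv_eq[OF F])
  show ?thesis
    unfolding coproduct_graph_def
  proof (rule sum.reindex_bij_witness[of _ "relabel F" "relabel (inv F)"])
    fix H assume H: "H \<in> {H. subribbon H (relabel F G) \<and> all_generators H}"
    show "relabel F (relabel (inv F) H) = H" by (rule i)
    show "relabel (inv F) H \<in> {H. subribbon H G \<and> all_generators H}"
      using H subribbon_relabel[OF F', of H "relabel F G"] all_generators_relabel[OF F', of H]
      by (simp add: relabel_inv[OF F])
    define H' where "H' = relabel (inv F) H"
    have H': "H = relabel F H'" by (simp add: H'_def i)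
    have s: "subribbon H' G" "all_generators H'"
      using H subribbon_relabel[OF F', of H "relabel F G"] all_generators_relabel[OF F', of H]
      by (simp_all add: relabel_inv[OF F] H'_def)
    then have "ribbon_graph (contract G H')"
      using G by (intro contraction.K) (simp add: contraction_def generator_union_def contraction_axioms_def)
    then have "graph_elem (delete_bivalent (contract (relabel F G) H)) =
        graph_elem (delete_bivalent (contract G H'))"
      unfolding H' using F
      by (simp add: contract_relabel delete_bivalent_relabel graph_elem_relabel ribbon_graph_delete_bivalent)
    moreover have "graph_elem H = graph_elem H'"
      unfolding H' using F s by (simp add: graph_elem_relabel all_generators_def)
    ultimately show "graph_elem (relabel (inv F) H) \<otimes>
        graph_elem (delete_bivalent (contract G (relabel (inv F) H))) =
      graph_elem H \<otimes> graph_elem (delete_bivalent (contract (relabel F G) H))"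
      by (simp add: H'_def)
  next
    fix H assume H: "H \<in> {H. subribbon H G \<and> all_generators H}"
    show "relabel (inv F) (relabel F H) = H" by (rule relabel_inv[OF F])
    show "relabel F H \<in> {H. subribbon H (relabel F G) \<and> all_generators H}"
      using H subribbon_relabel[OF F] all_generators_relabel[OF F] by simp
  qed
qed

section \<open>Counting labelled graphs on a fixed set\<close>

text \<open>Counting half edges by vertices gives \<open>4 V\<close>, by edges
  \<open>p + 2 I\<close>, and Euler's relation with one boundary reads \<open>V + n = I + 1\<close>,
  with \<open>n\<close> the loop number. So \<open>V = n + 1\<close> for \<open>p = 4\<close> and
  \<open>V = n\<close> for \<open>p = 2\<close>.\<close>

lemma card_half_edges_generating:
  assumes "generating_graph p G" shows "card (half_edges G) + 4 = 4 * loop_number G + 2 * p"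
proof -
  have P: "planar_ribbon p G" and w: "\<And>w. w \<in> vertices G \<Longrightarrow> card w = 4"
    using assms by (auto simp: generating_graph_iff)
  have G: "ribbon_graph G" using P by (simp add: planar_ribbon_def)
  have "card (half_edges G) = sum card (vertices G)"
    unfolding vertices_def by (rule sum_card_cycles_of[OF ribbonD(2,1)[OF G], symmetric])
  then have V: "card (half_edges G) = 4 * card (vertices G)" using w by simp
  have "half_edges G = external G \<union> {x \<in> half_edges G. flip G x \<noteq> x}" by (auto simp: external_def)
  then have "card (half_edges G) = card (external G) + card {x \<in> half_edges G. flip G x \<noteq> x}"
    using ribbonD(1)[OF G] by (subst card_Un_disjoint[symmetric]) (auto simp: external_def)
  then have I: "card (half_edges G) = p + 2 * card (internal_edges G)"
    using P by (simp add: card_internal_edges[OF G] planar_ribbon_def)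
  have "card (vertices G) + (card (internal_faces G) + 1) = card (internal_edges G) + 2"
    using P card_faces[OF G] by (simp add: planar_ribbon_def genus_eq_0_iff)
  then show ?thesis using V I by (simp add: loop_number_def)
qed

lemma labelled_class_eq:
  assumes G: "ribbon_graph G" and h: "h \<in> half_edges G"
  shows "labelled_class G h = {(relabel F G, F h) | F. bij F}"
proof (intro equalityI subsetI)
  fix x assume "x \<in> labelled_class G h"
  then obtain G' f where x: "x = (G', f h)" "ribbon_graph G'" "ribbon_iso f G G'"
    by (auto simp: labelled_class_def)
  obtain F where F: "bij F" "relabel F G = G'" "\<And>x. x \<in> half_edges G \<Longrightarrow> F x = f x"
    using ribbon_iso_imp_relabel[OF G x(2,3)] by metis
  have "x = (relabel F G, F h)" using x F(2) F(3)[OF h] by simp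
  then show "x \<in> {(relabel F G, F h) | F. bij F}" using F(1) by blast
next
  fix x assume "x \<in> {(relabel F G, F h) | F. bij F}"
  then show "x \<in> labelled_class G h"
    using ribbon_graph_relabel[OF _ G] ribbon_iso_relabel by (auto simp: labelled_class_def)
qed

lemma labelled_class_relabel:
  assumes G: "ribbon_graph G" and h: "h \<in> half_edges G" and F: "bij F"
  shows "labelled_class (relabel F G) (F h) = labelled_class G h"
proof -
  have h': "F h \<in> half_edges (relabel F G)" using h by simp
  show ?thesis
    unfolding labelled_class_eq[OF G h] labelled_class_eq[OF ribbon_graph_relabel[OF F G] h']
  proof (intro equalityI subsetI)
    fix x assume "x \<in> {(relabel F' (relabel F G), F' (F h)) | F'. bij F'}"
    then obtain F' where F': "x = (relabel F' (relabel F G), F' (F h))" "bij F'" by blast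
    then have "x = (relabel (F' \<circ> F) G, (F' \<circ> F) h)" "bij (F' \<circ> F)"
      using F by (simp_all add: relabel_relabel bij_comp)
    then show "x \<in> {(relabel F G, F h) | F. bij F}" by blast
  next
    fix x assume "x \<in> {(relabel F G, F h) | F. bij F}"
    then obtain F' where F': "x = (relabel F' G, F' h)" "bij F'" by blast
    have "relabel F' (relabel (inv F) (relabel F G)) = relabel (F' \<circ> inv F) (relabel F G)"
      by (rule relabel_relabel[OF F'(2) bij_imp_bij_inv[OF F]])
    then have "x = (relabel (F' \<circ> inv F) (relabel F G), (F' \<circ> inv F) (F h))"
      using F' by (simp add: relabel_inv[OF F] bij_inv_apply[OF F])
    moreover have "bij (F' \<circ> inv F)" using F F' by (simp add: bij_comp bij_imp_bij_inv)
    ultimately show "x \<in> {(relabel F' (relabel F G), F' (F h)) | F'. bij F'}" by blast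
  qed
qed

text \<open>The half edges on which the two relabellings agree form a closed set, because both
  intertwine rotation and involution.\<close>

lemma connected_rigid:
  assumes G: "ribbon_graph G" "connected_ribbon G" and F: "bij F" "bij F'"
    and eq: "relabel F G = relabel F' G" and h: "h \<in> half_edges G" "F h = F' h" and x: "x \<in> half_edges G"
  shows "F x = F' x"
proof -
  let ?A = "{x \<in> half_edges G. F x = F' x}"
  have c: "conjugate F (vrot G) = conjugate F' (vrot G)" "conjugate F (flip G) = conjugate F' (flip G)"
    using eq by (simp_all add: relabel_def)
  have "F (vrot G x) = F' (vrot G x)" "F (flip G x) = F' (flip G x)" if "F x = F' x" for x
    using c that conjugate_apply[OF F(1), of _ x] conjugate_apply[OF F(2), of _ x] by metis+
  then have "closed_in G ?A" by (auto simp: closed_in_def vrot_in[OF G(1)] flip_in[OF G(1)])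
  moreover have "?A \<noteq> {}" using h by blast
  ultimately have "?A = half_edges G" using G(2) unfolding connected_ribbon_iff[OF G(1)] by blast
  then show ?thesis using x by blast
qed

text \<open>The permutations of \<open>X\<close> act transitively on the copies that live on
  \<open>X\<close>, and freely by \<open>connected_rigid\<close>.\<close>

lemma card_labelled_class_on:
  assumes G: "ribbon_graph G" "connected_ribbon G" and h: "h \<in> half_edges G"
    and X: "finite X" "card X = card (half_edges G)"
  shows "card {(G', h') \<in> labelled_class G h. half_edges G' = X} = fact (card X)"
proof -
  obtain f where "bij_betw f (half_edges G) X"
    using finite_same_card_bij[OF ribbonD(1)[OF G(1)] X(1)] X(2) by auto
  then obtain F0 where F0: "bij F0" "F0 ` half_edges G = X"
    using bij_extend[OF ribbonD(1)[OF G(1)] X(1)] by (metis bij_betw_def image_cong)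
  define G1 h1 where "G1 = relabel F0 G" and "h1 = F0 h"
  have G1: "ribbon_graph G1" "connected_ribbon G1" "h1 \<in> half_edges G1" "half_edges G1 = X"
    using G h F0 by (auto simp: G1_def h1_def ribbon_graph_relabel connected_relabel)
  have cl: "labelled_class G h = {(relabel F G1, F h1) | F. bij F}"
    using labelled_class_relabel[OF G(1) h F0(1)] labelled_class_eq[OF G1(1,3)]
    by (simp add: G1_def h1_def)
  have "bij_betw (\<lambda>p. (relabel p G1, p h1)) {p. p permutes X} {(G', h') \<in> labelled_class G h. half_edges G' = X}"
    unfolding bij_betw_def
  proof
    show "inj_on (\<lambda>p. (relabel p G1, p h1)) {p. p permutes X}"
    proof (rule inj_onI)
      fix p q assume pq: "p \<in> {p. p permutes X}" "q \<in> {p. p permutes X}"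
        "(relabel p G1, p h1) = (relabel q G1, q h1)"
      then have "p x = q x" if "x \<in> X" for x
        using connected_rigid[OF G1(1,2) _ _ _ G1(3), of p q x] that G1(4) by (auto simp: permutes_bij)
      then show "p = q" using pq permutes_not_in by (metis ext mem_Collect_eq)
    qed
    show "(\<lambda>p. (relabel p G1, p h1)) ` {p. p permutes X} = {(G', h') \<in> labelled_class G h. half_edges G' = X}"
    proof (intro equalityI subsetI)
      fix x assume "x \<in> (\<lambda>p. (relabel p G1, p h1)) ` {p. p permutes X}"
      then obtain p where "p permutes X" "x = (relabel p G1, p h1)" by blast
      then show "x \<in> {(G', h') \<in> labelled_class G h. half_edges G' = X}"
        unfolding cl using permutes_bij[of p X] permutes_image[of p X] by (auto simp: G1(4) simp del: image_eqI)
    next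
      fix x assume "x \<in> {(G', h') \<in> labelled_class G h. half_edges G' = X}"
      then obtain F where F: "x = (relabel F G1, F h1)" "bij F" "F ` X = X"
        unfolding cl using G1(4) by auto
      \<comment> \<open>A bijection of the whole type that preserves \<open>X\<close> acts on these
        copies like its restriction to \<open>X\<close>.\<close>
      let ?p = "perm_restrict F X"
      have "bij_betw ?p X X"
        using F(2,3) by (simp add: bij_betw_def perm_restrict_def bij_is_inj inj_on_subset cong: inj_on_cong image_cong)
          (meson bij_is_inj inj_on_subset subset_UNIV)
      then have p: "?p permutes X" by (rule bij_imp_permutes) (simp add: perm_restrict_def)
      have "relabel ?p G1 = relabel F G1"
        by (rule relabel_cong[OF G1(1) permutes_bij[OF p] F(2)]) (simp add: perm_restrict_def G1(4))
      moreover have "?p h1 = F h1" using G1 by (simp add: perm_restrict_def)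
      ultimately show "x \<in> (\<lambda>p. (relabel p G1, p h1)) ` {p. p permutes X}" 
        using p F by (intro image_eqI[of _ _ ?p]) simp_all
    qed
  qed
  from bij_betw_same_card[OF this] show ?thesis using card_permutations[OF refl X(1)] by simp
qed

text \<open>Marking one of the \<open>p\<close> external half edges turns the left side into a sum
  over rooted graphs on \<open>X\<close>, in which each labelled class has \<open>(card X)!\<close>
  members. The condition on \<open>card X\<close> says that the graphs on \<open>X\<close> are those
  with \<open>n\<close> internal faces.\<close>

lemma rooted_count:
  fixes f :: "nat ribbon \<Rightarrow> 'a::{comm_semiring_1, semiring_char_0}"
  assumes X: "finite X" "card X + 4 = 4 * n + 2 * p"
    and inv: "\<And>F G. bij F \<Longrightarrow> ribbon_graph G \<Longrightarrow> f (relabel F G) = f G"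
  shows "of_nat p * (\<Sum>G | generating_graph p G \<and> half_edges G = X. f G) =
    fact (card X) * (\<Sum>L\<in>labelled_graphs p n. f (fst (SOME x. x \<in> L)))"
proof -
  define S where "S = Sigma {G. generating_graph p G \<and> half_edges G = X} external"
  define g where "g = (\<lambda>(G, h). labelled_class G h)"
  have gen: "ribbon_graph G" "connected_ribbon G" "card (external G) = p" "external G \<subseteq> half_edges G"
    if "generating_graph p G" for G :: "nat ribbon"
    using that by (auto simp: generating_graph_iff planar_ribbon_def external_def)
  have fin: "finite {G. generating_graph p G \<and> half_edges G = X}"
    by (rule finite_subset[OF _ finite_ribbon_graphs[OF X(1)]]) (use gen in auto)
  have finS: "finite S" unfolding S_def
    by (rule finite_SigmaI[OF fin]) (use gen(4) X(1) finite_subset in blast)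
  have image: "g ` S = labelled_graphs p n"
  proof (intro equalityI subsetI)
    fix L assume "L \<in> g ` S"
    then obtain G h where G: "generating_graph p G" "half_edges G = X" "h \<in> external G" "L = labelled_class G h"
      by (auto simp: S_def g_def)
    then have "loop_number G = n" using card_half_edges_generating[OF G(1)] X(2) by simp
    then show "L \<in> labelled_graphs p n" using G unfolding labelled_graphs_def by blast
  next
    fix L assume "L \<in> labelled_graphs p n"
    then obtain G h where G: "generating_graph p G" "loop_number G = n" "h \<in> external G" "L = labelled_class G h"
      by (auto simp: labelled_graphs_def)
    note R = gen[OF G(1)]
    have "card (half_edges G) = card X" using card_half_edges_generating[OF G(1)] X(2) G(2) by simp
    then obtain b where "bij_betw b (half_edges G) X"
      using finite_same_card_bij[OF ribbonD(1)[OF R(1)] X(1)] by auto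
    then obtain F where F: "bij F" "F ` half_edges G = X"
      using bij_extend[OF ribbonD(1)[OF R(1)] X(1)] by (metis bij_betw_def image_cong)
    have "(relabel F G, F h) \<in> S"
      using G F R by (simp add: S_def generating_relabel external_relabel)
    moreover have "g (relabel F G, F h) = L"
      using labelled_class_relabel[OF R(1) _ F(1)] G R(4) by (auto simp: g_def)
    ultimately show "L \<in> g ` S" by blast
  qed
  have per_class: "(\<Sum>x | x \<in> S \<and> g x = L. f (fst x)) = fact (card X) * f (fst (SOME x. x \<in> L))"
    if L: "L \<in> labelled_graphs p n" for L
  proof -
    obtain G h where G: "generating_graph p G" "half_edges G = X" "h \<in> external G" "L = labelled_class G h"
      using L unfolding image[symmetric] by (auto simp: S_def g_def)
    note R = gen[OF G(1)]
    have hG: "h \<in> half_edges G" using G R by blast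
    have cl: "L = {(relabel F G, F h) | F. bij F}" unfolding G(4) by (rule labelled_class_eq[OF R(1) hG])
    have fL: "f (fst x) = f G" if "x \<in> L" for x using that inv R(1) unfolding cl by auto
    have "(id G, id h) \<in> L" unfolding cl using bij_id relabel_id by (metis (mono_tags, lifting) eq_id_iff mem_Collect_eq)
    then have some: "f (fst (SOME x. x \<in> L)) = f G" by (intro fL) (rule someI)
    have "{x \<in> S. g x = L} = {(G', h') \<in> L. half_edges G' = X}"
    proof (rule set_eqI, clarify)
      fix G' h'
      show "(G', h') \<in> {x \<in> S. g x = L} \<longleftrightarrow> (G', h') \<in> {(G', h'). (G', h') \<in> L \<and> half_edges G' = X}"
      proof
        assume a: "(G', h') \<in> {x \<in> S. g x = L}"
        then have "generating_graph p G'" "half_edges G' = X" "h' \<in> external G'" "labelled_class G' h' = L"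
          by (auto simp: S_def g_def)
        moreover from this have "(id G', id h') \<in> labelled_class G' h'"
          using gen[of G'] labelled_class_eq[of G' h'] bij_id relabel_id
          by (metis (mono_tags, lifting) eq_id_iff mem_Collect_eq subsetD)
        ultimately show "(G', h') \<in> {(G', h'). (G', h') \<in> L \<and> half_edges G' = X}" by simp
      next
        assume a: "(G', h') \<in> {(G', h'). (G', h') \<in> L \<and> half_edges G' = X}"
        then obtain F where F: "G' = relabel F G" "h' = F h" "bij F" unfolding cl by auto
        then show "(G', h') \<in> {x \<in> S. g x = L}"
          using a G R labelled_class_relabel[OF R(1) hG F(3)]
          by (simp add: S_def g_def generating_relabel external_relabel)
      qed
    qed
    then have "card {x \<in> S. g x = L} = fact (card X)"
      using card_labelled_class_on[OF R(1,2) hG X(1)] G by simp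
    moreover have "(\<Sum>x | x \<in> S \<and> g x = L. f (fst x)) = (\<Sum>x | x \<in> S \<and> g x = L. f G)"
    proof (rule sum.cong[OF refl])
      fix x assume "x \<in> {x \<in> S. g x = L}"
      then have "x \<in> L" using \<open>{x \<in> S. g x = L} = _\<close> by auto
      then show "f (fst x) = f G" by (rule fL)
    qed
    ultimately show ?thesis by (simp add: some)
  qed
  have "of_nat p * (\<Sum>G | generating_graph p G \<and> half_edges G = X. f G) =
      (\<Sum>G | generating_graph p G \<and> half_edges G = X. \<Sum>h\<in>external G. f G)"
    unfolding sum_distrib_left by (rule sum.cong[OF refl]) (use gen in simp)
  also have "\<dots> = (\<Sum>x\<in>S. f (fst x))"
    unfolding S_def using fin gen(4) X(1) finite_subset
    by (subst sum.Sigma) (auto simp: case_prod_beta intro: finite_subset)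
  also have "\<dots> = (\<Sum>L\<in>labelled_graphs p n. \<Sum>x | x \<in> S \<and> g x = L. f (fst x))"
    using finS by (intro sum.group[symmetric]) (simp_all only: image[symmetric] finite_imageI order.refl)
  also have "\<dots> = (\<Sum>L\<in>labelled_graphs p n. fact (card X) * f (fst (SOME x. x \<in> L)))"
    by (rule sum.cong[OF refl per_class])
  finally show ?thesis by (simp add: sum_distrib_left)
qed

section \<open>Generators in the algebra and coefficients of the coproduct\<close>

lemma generator_of_eqD:
  assumes G: "is_generator G" and G': "is_generator G'" and eq: "generator_of G = generator_of G'"
  obtains F where "bij F" "G' = relabel F G"
proof -
  note R = is_generatorD(1)[OF G] is_generatorD(1)[OF G']
  have "iso_class G = iso_class G'"
    using eq Abs_generator_inject[of "iso_class G" "iso_class G'"] G G' unfolding generator_of_def by blast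
  moreover have "relabel id G' \<in> iso_class G'" unfolding iso_class_eq[OF R(2)] using bij_id by blast
  ultimately have "G' \<in> {relabel F G | F. bij F}" unfolding iso_class_eq[OF R(1)] by simp
  then show ?thesis using that by blast
qed

lemma loop_number_generator_of:
  assumes G: "is_generator G"
  shows "loop_number (SOME G'. G' \<in> Rep_generator (generator_of G)) = loop_number G"
proof -
  note R = is_generatorD(1)[OF G]
  have r: "Rep_generator (generator_of G) = {relabel F G | F. bij F}"
    using G by (simp add: generator_of_def iso_class_eq[OF R, symmetric]) (rule Abs_generator_inverse, blast)
  have "relabel id G \<in> {relabel F G | F. bij F}" using bij_id by blast
  then have "(SOME G'. G' \<in> Rep_generator (generator_of G)) \<in> {relabel F G | F. bij F}"
    unfolding r by (rule someI)
  then show ?thesis using R by (auto simp: loop_number_relabel)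
qed

lemma generator_nonempty: "is_generator G \<Longrightarrow> half_edges G \<noteq> {}"
  using planar_ribbon_nonempty by (auto simp: is_generator_def generating_graph_iff)

lemma component_graph_half_edges: "ribbon_graph G \<Longrightarrow> component_graph G (half_edges G) = G"
  by (simp add: component_graph_def ribbonD(2,3))

lemma components_generator:
  assumes "is_generator G" shows "components G = {half_edges G}"
  using connected_components is_generatorD[OF assms] generator_nonempty[OF assms] by blast

lemma monomial_of_generator: "is_generator G \<Longrightarrow> monomial_of G = {#generator_of G#}"
  by (simp add: monomial_of_def components_generator component_graph_half_edges is_generatorD)

lemma graph_elem_generator:
  "is_generator G \<Longrightarrow> graph_elem G = Poly_Mapping.single {#generator_of G#} 1"
  by (simp add: graph_elem_def monomial_of_generator)

lemma all_generators_generator: "is_generator G \<Longrightarrow> all_generators G"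
  by (simp add: all_generators_def components_generator component_graph_half_edges is_generatorD)

text \<open>The representative taken by \<open>monomial_graph\<close> is arbitrary, but a monomial
  of degree one forces a single component, which is then isomorphic to \<open>G\<close>.\<close>

lemma coproduct_graph_monomial_graph:
  assumes G: "is_generator G"
  shows "coproduct_graph (monomial_graph {#generator_of G#}) = coproduct_graph G"
proof -
  define G' where "G' = monomial_graph {#generator_of G#}"
  have "all_generators G' \<and> monomial_of G' = {#generator_of G#}"
    unfolding G'_def monomial_graph_def
    by (rule someI[of _ G]) (simp add: G monomial_of_generator all_generators_generator)
  then have G': "all_generators G'" "monomial_of G' = {#generator_of G#}" "ribbon_graph G'"
    by (auto simp: all_generators_def)
  have "size (monomial_of G') = card (components G')" by (simp add: monomial_of_def)
  then have "card (components G') = 1" using G'(2) by simp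
  then obtain C where C: "components G' = {C}" by (auto simp: card_1_singleton_iff)
  then have "C = half_edges G'" using Union_components[OF G'(3)] by simp
  then have "is_generator G'"
    using G'(1) C component_graph_half_edges[OF G'(3)] by (simp add: all_generators_def)
  moreover from this have "generator_of G' = generator_of G" using G'(2) by (simp add: monomial_of_generator)
  ultimately obtain F where "bij F" "G' = relabel F G" using generator_of_eqD[OF G] by metis
  then show ?thesis using is_generatorD(1)[OF G] by (simp add: G'_def[symmetric] coproduct_graph_relabel)
qed

lemma lookup_tensor:
  "Poly_Mapping.lookup (a \<otimes> b) (s, t) = Poly_Mapping.lookup a s * Poly_Mapping.lookup b t"
proof -
  have "Poly_Mapping.lookup (a \<otimes> b) (s, t) = (\<Sum>s'\<in>Poly_Mapping.keys a. \<Sum>t'\<in>Poly_Mapping.keys b.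
      if s' = s then (if t' = t then Poly_Mapping.lookup a s' * Poly_Mapping.lookup b t' else 0) else 0)"
    unfolding tensor_def lookup_sum by (intro sum.cong refl) (auto simp: lookup_single when_def)
  also have "\<dots> = (\<Sum>s'\<in>Poly_Mapping.keys a. if s' = s then
      (\<Sum>t'\<in>Poly_Mapping.keys b. if t' = t then Poly_Mapping.lookup a s' * Poly_Mapping.lookup b t' else 0) else 0)"
    by (intro sum.cong refl) simp
  finally show ?thesis by (simp add: in_keys_iff)
qed

lemma lookup_scale: "Poly_Mapping.lookup (Poly_Mapping.map ((*) c) f) k = c * Poly_Mapping.lookup f k"
  for c :: "'a::mult_zero"
  by (simp add: map.rep_eq when_def)

text \<open>Several indices may give the same monomial, which then carries their number as its
  coefficient. Exchanging the sums over keys and indices resolves these collisions.\<close>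

lemma lookup_coproduct_sum:
  assumes "finite I"
  shows "Poly_Mapping.lookup (\<Delta> (\<Sum>i\<in>I. Poly_Mapping.single (m i) 1)) k =
    (\<Sum>i\<in>I. Poly_Mapping.lookup (coproduct_graph (monomial_graph (m i))) k)"
proof -
  define x :: hck where "x = (\<Sum>i\<in>I. Poly_Mapping.single (m i) 1)"
  define c where "c j = Poly_Mapping.lookup (coproduct_graph (monomial_graph j)) k" for j
  have lx: "Poly_Mapping.lookup x j = (\<Sum>i\<in>I. if m i = j then 1 else 0)" for j
    unfolding x_def lookup_sum by (intro sum.cong refl) (simp add: lookup_single when_def)
  have keys: "Poly_Mapping.keys x \<subseteq> m ` I"
  proof
    fix j assume "j \<in> Poly_Mapping.keys x"
    then have "(\<Sum>i\<in>I. if m i = j then 1 else 0 :: rat) \<noteq> 0" by (simp add: in_keys_iff lx)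
    then obtain i where "i \<in> I" "(if m i = j then 1 else 0 :: rat) \<noteq> 0"
      by (rule sum.not_neutral_contains_not_neutral)
    then show "j \<in> m ` I" by (auto split: if_splits)
  qed
  have "Poly_Mapping.lookup (\<Delta> x) k = (\<Sum>j\<in>Poly_Mapping.keys x. Poly_Mapping.lookup x j * c j)"
    by (simp add: coproduct_def lookup_sum lookup_scale c_def)
  also have "\<dots> = (\<Sum>j\<in>m ` I. Poly_Mapping.lookup x j * c j)"
    by (rule sum.mono_neutral_left) (use assms keys in \<open>auto simp: in_keys_iff\<close>)
  also have "\<dots> = (\<Sum>j\<in>m ` I. \<Sum>i\<in>I. if m i = j then c j else 0)"
    by (simp add: lx sum_distrib_right if_distrib[of "\<lambda>x. x * _"] cong: if_cong)
  also have "\<dots> = (\<Sum>i\<in>I. \<Sum>j\<in>m ` I. if m i = j then c j else 0)" by (rule sum.swap)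
  also have "\<dots> = (\<Sum>i\<in>I. c (m i))"
    by (rule sum.cong[OF refl]) (use assms in simp)
  finally show ?thesis by (simp add: x_def c_def)
qed

section \<open>Conjugacy of permutations with equal cycle lengths\<close>

lemma cycle_iso:
  assumes p: "p permutes X" "finite X" and q: "q permutes Y" "finite Y"
    and c: "card (orbit p x) = card (orbit q y)"
  obtains F where "bij_betw F (orbit p x) (orbit q y)" "F x = y"
    "\<And>z. z \<in> orbit p x \<Longrightarrow> F (p z) = q (F z)"
proof -
  have enum: "\<exists>n>0. bij_betw (\<lambda>i. (p ^^ i) x) {0..<n} (orbit p x) \<and> (p ^^ n) x = x \<and> card (orbit p x) = n"
    if p: "p permutes X" "finite X" for p :: "'c \<Rightarrow> 'c" and X x
  proof -
    have x: "x \<in> orbit p x" by (rule self_in_orbit[OF p])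
    let ?n = "funpow_dist1 p x x"
    have b: "bij_betw (\<lambda>i. (p ^^ i) x) {0..<?n} (orbit p x)"
      unfolding bij_betw_def using inj_on_funpow_dist1[OF x] orbit_conv_funpow_dist1[OF x] by simp
    show ?thesis
      using b bij_betw_same_card[OF b] funpow_dist1_prop[OF x] by (intro exI[of _ ?n]) simp
  qed
  obtain n where n: "n > 0" "bij_betw (\<lambda>i. (p ^^ i) x) {0..<n} (orbit p x)" "(p ^^ n) x = x"
    "card (orbit p x) = n" using enum[OF p] by blast
  obtain m where m: "m > 0" "bij_betw (\<lambda>i. (q ^^ i) y) {0..<m} (orbit q y)" "(q ^^ m) y = y"
    "card (orbit q y) = m" using enum[OF q] by blast
  have mn: "m = n" using n m c by simp
  define F where "F z = (q ^^ (inv_into {0..<n} (\<lambda>i. (p ^^ i) x) z)) y" for z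
  have F: "F ((p ^^ i) x) = (q ^^ i) y" if "i < n" for i
    using that inv_into_f_f[OF bij_betw_imp_inj_on[OF n(2)], of i] by (simp add: F_def)
  \<comment> \<open>The case \<open>i = n\<close> is what the intertwining needs at the last point,
    where both cycles close up.\<close>
  have Fn: "F ((p ^^ i) x) = (q ^^ i) y" if "i \<le> n" for i
  proof (cases "i = n")
    case True
    then show ?thesis using F[of 0] n m mn by simp
  next
    case False
    then show ?thesis using F that by simp
  qed
  have "bij_betw F (orbit p x) (orbit q y)"
    unfolding F_def[abs_def]
    using bij_betw_trans[OF bij_betw_inv_into[OF n(2)] m(2)[unfolded mn]] by (simp add: comp_def)
  moreover have "F x = y" using F[of 0] n by simp
  moreover have "F (p z) = q (F z)" if "z \<in> orbit p x" for z
  proof -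
    have "z \<in> (\<lambda>i. (p ^^ i) x) ` {0..<n}" using that bij_betw_imp_surj_on[OF n(2)] by simp
    then obtain i where i: "i < n" "z = (p ^^ i) x" by auto
    then show ?thesis using Fn[of "Suc i"] F[of i] by simp
  qed
  ultimately show ?thesis by (rule that)
qed

lemma
  assumes p: "p permutes X" "finite X" and c: "c \<in> cycles_of p X"
  shows perm_restrict_Diff_cycle: "perm_restrict p (X - c) permutes (X - c)"
    and cycles_of_Diff_cycle: "cycles_of (perm_restrict p (X - c)) (X - c) = cycles_of p X - {c}"
proof -
  have cl: "p h \<in> c \<longleftrightarrow> h \<in> c" for h
  proof -
    obtain z where z: "c = orbit p z" using c by (auto simp: cycles_of_def)
    then have "p ` c \<subseteq> c" by (auto intro: orbit.step)
    then show ?thesis by (rule permutes_closed_iff[OF p])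
  qed
  have im: "p ` (X - c) \<subseteq> X - c" using cl permutes_in_image[OF p(1)] by auto
  show "perm_restrict p (X - c) permutes (X - c)"
    by (rule perm_restrict_permutes[OF p _ im]) blast
  have "cycles_of (perm_restrict p (X - c)) (X - c) = cycles_of p (X - c)"
    by (rule cycles_of_perm_restrict[OF im])
  also have "\<dots> = cycles_of p X - {c}"
  proof (intro equalityI subsetI)
    fix d assume "d \<in> cycles_of p (X - c)"
    then obtain z where z: "z \<in> X" "z \<notin> c" "d = orbit p z" by (auto simp: cycles_of_def)
    then show "d \<in> cycles_of p X - {c}" using self_in_orbit[OF p, of z] by (auto simp: cycles_of_def)
  next
    fix d assume d: "d \<in> cycles_of p X - {c}"
    then obtain z where z: "z \<in> X" "d = orbit p z" by (auto simp: cycles_of_def)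
    then have "z \<notin> c" using cycles_of_disjoint[OF p _ c, of d] d self_in_orbit[OF p, of z] by auto
    then show "d \<in> cycles_of p (X - c)" using z by (auto simp: cycles_of_def)
  qed
  finally show "cycles_of (perm_restrict p (X - c)) (X - c) = cycles_of p X - {c}" .
qed

text \<open>One cycle is matched on either side and removed, and the induction continues with the
  restricted permutations. With \<open>k = 4\<close> this makes all quartic rotations of a set
  equivalent.\<close>

lemma cycles_conjugate:
  assumes "p permutes X" "finite X" "q permutes Y" "finite Y" "card X = card Y" "0 < k"
    and "\<And>c. c \<in> cycles_of p X \<Longrightarrow> card c = k" "\<And>c. c \<in> cycles_of q Y \<Longrightarrow> card c = k"
  shows "\<exists>F. bij_betw F X Y \<and> (\<forall>z\<in>X. F (p z) = q (F z))"
  using assms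
proof (induction "card X" arbitrary: X Y p q rule: less_induct)
  case less
  note p = less.prems(1,2) and q = less.prems(3,4)
  show ?case
  proof (cases "X = {}")
    case True
    then have "Y = {}" using less.prems by auto
    then show ?thesis using True by (intro exI[of _ "\<lambda>_. undefined"]) (simp add: bij_betw_def)
  next
    case False
    then obtain x y where x: "x \<in> X" and y: "y \<in> Y" using less.prems(2,4,5) by fastforce
    let ?c = "orbit p x" and ?d = "orbit q y"
    have c: "?c \<in> cycles_of p X" "?d \<in> cycles_of q Y" using x y by (auto simp: cycles_of_def)
    have sub: "?c \<subseteq> X" "?d \<subseteq> Y" using permutes_orbit_subset x y p q by metis+
    have cards: "card ?c = k" "card ?d = k" using c less.prems by auto
    obtain F where F: "bij_betw F ?c ?d" "\<And>z. z \<in> ?c \<Longrightarrow> F (p z) = q (F z)"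
      using cycle_iso[OF p q, of x y] cards by metis
    let ?X = "X - ?c" and ?Y = "Y - ?d"
    let ?p = "perm_restrict p ?X" and ?q = "perm_restrict q ?Y"
    have fin: "finite ?X" "finite ?Y" using p q by auto
    have cd: "card ?X = card X - k" "card ?Y = card Y - k"
      using sub cards p q by (simp_all add: card_Diff_subset finite_subset)
    have "card ?X < card X" using cd x p less.prems(6) cards card_mono[OF p(2) sub(1)] by simp
    moreover have "card ?X = card ?Y" using cd less.prems(5) by simp
    ultimately obtain F' where F': "bij_betw F' ?X ?Y" "\<forall>z\<in>?X. F' (?p z) = ?q (F' z)"
      using less.hyps[of ?X ?p ?q ?Y] perm_restrict_Diff_cycle[OF p c(1)] perm_restrict_Diff_cycle[OF q c(2)]
        cycles_of_Diff_cycle[OF p c(1)] cycles_of_Diff_cycle[OF q c(2)] fin less.prems(6,7,8) by auto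
    define H where "H z = (if z \<in> ?c then F z else F' z)" for z
    have b1: "bij_betw H ?c ?d" by (subst bij_betw_cong[of _ _ F]) (auto simp: H_def F)
    have b2: "bij_betw H ?X ?Y" by (subst bij_betw_cong[of _ _ F']) (auto simp: H_def F')
    have "bij_betw H (?c \<union> ?X) (?d \<union> ?Y)" by (rule bij_betw_combine[OF b1 b2]) blast
    moreover have "?c \<union> ?X = X" "?d \<union> ?Y = Y" using sub by auto
    ultimately have "bij_betw H X Y" by simp
    moreover have "H (p z) = q (H z)" if z: "z \<in> X" for z
    proof (cases "z \<in> ?c")
      case True
      then show ?thesis using F(2) orbit.step[of z p x] by (simp add: H_def)
    next
      case False
      have "p z \<in> ?X" using permutes_in_image[OF perm_restrict_Diff_cycle[OF p c(1)], of z] False z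
        by (simp add: perm_restrict_def)
      moreover have "F' z \<in> ?Y" using F'(1) False z by (auto dest: bij_betwE)
      ultimately show ?thesis using F'(2) False z by (simp add: H_def perm_restrict_def)
    qed
    ultimately show ?thesis by blast
  qed
qed

section \<open>Disjoint unions and exponential generating functions\<close>

text \<open>For disjoint half edges this is the disjoint union on the nose, without renaming, so
  that splitting off a component and joining are exact inverses.\<close>

definition join :: "'h ribbon \<Rightarrow> 'h ribbon \<Rightarrow> 'h ribbon" where
  "join G H = \<lparr>half_edges = half_edges G \<union> half_edges H,
     vrot = (\<lambda>h. if h \<in> half_edges G then vrot G h else vrot H h),
     flip = (\<lambda>h. if h \<in> half_edges G then flip G h else flip H h)\<rparr>"

context
  fixes G H :: "'h ribbon"
  assumes G: "ribbon_graph G" and H: "ribbon_graph H" and disj: "half_edges G \<inter> half_edges H = {}"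
begin

lemma permutes_join:
  assumes p: "p permutes half_edges G" and q: "q permutes half_edges H"
  shows "(\<lambda>h. if h \<in> half_edges G then p h else q h) permutes half_edges G \<union> half_edges H"
proof -
  have "(\<lambda>h. if h \<in> half_edges G then p h else q h) = p \<circ> q"
  proof
    fix h
    show "(if h \<in> half_edges G then p h else q h) = (p \<circ> q) h"
    proof (cases "h \<in> half_edges G")
      case True
      then have "q h = h" using disj permutes_not_in[OF q] by blast
      then show ?thesis using True by simp
    next
      case False
      then have "q h \<notin> half_edges G"
        using disj permutes_in_image[OF q, of h] permutes_not_in[OF q, of h] by (cases "h \<in> half_edges H") auto
      then show ?thesis using False permutes_not_in[OF p] by simp
    qed
  qed
  moreover have "p permutes half_edges G \<union> half_edges H" "q permutes half_edges G \<union> half_edges H"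
    using permutes_subset[OF p] permutes_subset[OF q] by blast+
  ultimately show ?thesis using permutes_compose by simp
qed

lemma ribbon_graph_join: "ribbon_graph (join G H)"
proof -
  have "flip H h \<notin> half_edges G" if "h \<notin> half_edges G" for h
    using disj flip_in[OF H, of h] permutes_not_in[OF ribbonD(3)[OF H], of h] that
    by (cases "h \<in> half_edges H") auto
  then have "flip (join G H) (flip (join G H) h) = h" for h
    using ribbonD(4)[OF G] ribbonD(4)[OF H] flip_in[OF G] by (auto simp: join_def)
  then show ?thesis
    unfolding ribbon_graph_def using ribbonD[OF G] ribbonD[OF H] permutes_join by (simp add: join_def)
qed

lemma closed_in_join: "closed_in (join G H) (half_edges G)"
  using vrot_in[OF G] flip_in[OF G] by (auto simp: closed_in_def join_def)

lemma half_edges_join: "half_edges (join G H) = half_edges G \<union> half_edges H"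
  by (simp add: join_def)

lemma component_graph_join:
  "component_graph (join G H) (half_edges G) = G"
  "component_graph (join G H) (half_edges (join G H) - half_edges G) = H"
proof -
  have 1: "perm_restrict (\<lambda>h. if h \<in> half_edges G then p h else q h) (half_edges G) = p"
    if "p permutes half_edges G" for p q :: "'h \<Rightarrow> 'h"
    using permutes_not_in[OF that] by (auto simp: perm_restrict_def)
  have 2: "perm_restrict (\<lambda>h. if h \<in> half_edges G then p h else q h) (half_edges H) = q"
    if "q permutes half_edges H" for p q :: "'h \<Rightarrow> 'h"
  proof
    fix h
    show "perm_restrict (\<lambda>h. if h \<in> half_edges G then p h else q h) (half_edges H) h = q h"
    proof (cases "h \<in> half_edges H")
      case True
      then have "h \<notin> half_edges G" using disj by blast
      then show ?thesis using True by (simp add: perm_restrict_def)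
    next
      case False
      then show ?thesis using permutes_not_in[OF that False] by (simp add: perm_restrict_def)
    qed
  qed
  have "half_edges (join G H) - half_edges G = half_edges H" using disj half_edges_join by auto
  then show "component_graph (join G H) (half_edges G) = G"
    "component_graph (join G H) (half_edges (join G H) - half_edges G) = H"
    using 1 2 ribbonD[OF G] ribbonD[OF H] by (simp_all add: component_graph_def join_def)
qed

end

text \<open>A component is contained in every closed set that it meets, so it cannot lie across
  \<open>Y\<close> and its complement.\<close>

lemma components_split:
  assumes U: "ribbon_graph U" and Y: "closed_in U Y"
  shows "components U = components (component_graph U Y) \<union> components (component_graph U (half_edges U - Y))"
proof -
  have Y': "closed_in U (half_edges U - Y)" by (rule closed_in_Diff[OF U closed_in_half_edges[OF U] Y])
  have "C \<subseteq> Y \<or> C \<subseteq> half_edges U - Y" if "C \<in> components U" for C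
    using component_least[OF U that Y] component_subset[OF U that] by blast
  then show ?thesis
    unfolding components_component_graph[OF U Y] components_component_graph[OF U Y'] by blast
qed

lemma join_component_graph:
  assumes U: "ribbon_graph U" and Y: "Y \<subseteq> half_edges U"
  shows "join (component_graph U Y) (component_graph U (half_edges U - Y)) = U"
proof -
  have "(if h \<in> Y then perm_restrict p Y h else perm_restrict p (half_edges U - Y) h) = p h"
    if "p permutes half_edges U" for p h
    using permutes_not_in[OF that, of h] by (auto simp: perm_restrict_def)
  then have "(\<lambda>h. if h \<in> Y then perm_restrict (vrot U) Y h else perm_restrict (vrot U) (half_edges U - Y) h) = vrot U"
    "(\<lambda>h. if h \<in> Y then perm_restrict (flip U) Y h else perm_restrict (flip U) (half_edges U - Y) h) = flip U"
    using ribbonD(2,3)[OF U] by blast+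
  moreover have "Y \<union> (half_edges U - Y) = half_edges U" using Y by blast
  ultimately show ?thesis unfolding join_def component_graph_simps by simp
qed

definition generator_components :: "nat \<Rightarrow> 'h ribbon \<Rightarrow> 'h set set" where
  "generator_components p H = {C \<in> components H. generating_graph p (component_graph H C)}"

context
  fixes H :: "nat ribbon" and C
  assumes H: "all_generators H" and C: "C \<in> components H"
begin

text \<open>Removing one component leaves the graphs of the others untouched, so the monomial loses
  exactly one factor. With \<open>join_generator\<close> this is the inverse pair behind
  \<open>union_sum_rec\<close>.\<close>

lemma component_split:
  defines "H' \<equiv> component_graph H (half_edges H - C)"
  shows "all_generators H'" "half_edges H' = half_edges H - C" "components H' = components H - {C}"
    "generator_components p H' = generator_components p H - {C}"
    "graph_elem H = graph_elem (component_graph H C) * graph_elem H'"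
    "is_generator (component_graph H C)"
proof -
  have R: "ribbon_graph H" using H by (simp add: all_generators_def)
  have Ccl: "closed_in H C" and Ccl': "closed_in H (half_edges H - C)"
    using component_closed[OF R C] closed_in_Diff[OF R closed_in_half_edges[OF R]] by auto
  have R': "ribbon_graph H'" unfolding H'_def by (rule ribbon_graph_component_graph[OF R Ccl'])
  show gen: "is_generator (component_graph H C)" using H C by (simp add: all_generators_def)
  show "half_edges H' = half_edges H - C" by (simp add: H'_def)
  have "D \<subseteq> half_edges H - C" if "D \<in> components H" "D \<noteq> C" for D
    using components_disjoint[OF R that(1) C that(2)] component_subset[OF R that(1)] by blast
  moreover have "\<not> C \<subseteq> half_edges H - C" using component_nonempty[OF R C] by blast
  ultimately show comps: "components H' = components H - {C}"
    unfolding H'_def components_component_graph[OF R Ccl'] by blast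
  have cg: "component_graph H' D = component_graph H D" if "D \<in> components H - {C}" for D
  proof -
    have "D \<subseteq> half_edges H - C"
      using that component_subset[OF R'] comps by (auto simp: H'_def)
    then show ?thesis unfolding H'_def by (simp add: component_graph_component_graph Int_absorb1)
  qed
  show "all_generators H'"
    unfolding all_generators_def comps using R' H cg by (auto simp: all_generators_def)
  show "generator_components p H' = generator_components p H - {C}"
  proof (rule set_eqI)
    fix D
    show "D \<in> generator_components p H' \<longleftrightarrow> D \<in> generator_components p H - {C}"
      using cg[of D] by (cases "D \<in> components H - {C}") (auto simp: generator_components_def comps)
  qed
  have "mset_set (components H) = mset_set (insert C (components H - {C}))"
    using C by (simp add: insert_absorb)
  also have "\<dots> = add_mset C (mset_set (components H - {C}))"
    using finite_components[OF R] by (subst mset_set.insert) auto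
  finally have "monomial_of H = add_mset (generator_of (component_graph H C))
      (image_mset (\<lambda>D. generator_of (component_graph H D)) (mset_set (components H - {C})))"
    by (simp add: monomial_of_def)
  also have "image_mset (\<lambda>D. generator_of (component_graph H D)) (mset_set (components H - {C})) = monomial_of H'"
    unfolding monomial_of_def comps using cg finite_components[OF R]
    by (intro image_mset_cong) simp
  finally have "monomial_of H = monomial_of (component_graph H C) + monomial_of H'"
    using gen by (simp add: monomial_of_generator)
  then show "graph_elem H = graph_elem (component_graph H C) * graph_elem H'"
    by (simp add: graph_elem_def mult_single)
qed

end

lemma join_generator:
  assumes G: "is_generator G" and H: "all_generators H" and disj: "half_edges G \<inter> half_edges H = {}"
  shows "all_generators (join G H)" "half_edges G \<in> components (join G H)"
proof -
  note R = is_generatorD(1)[OF G]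
  have RH: "ribbon_graph H" using H by (simp add: all_generators_def)
  note j = ribbon_graph_join[OF R RH disj] closed_in_join[OF R RH disj] component_graph_join[OF R RH disj]
  have comps: "components (join G H) = {half_edges G} \<union> components H"
    using components_split[OF j(1,2)] j(3,4) components_generator[OF G] by simp
  then show "half_edges G \<in> components (join G H)" by simp
  have "component_graph (join G H) D = component_graph H D" if "D \<in> components H" for D
  proof -
    have D: "D \<subseteq> half_edges H" using component_subset[OF RH that] .
    have "D \<subseteq> half_edges (join G H) - half_edges G"
      using D disj half_edges_join[OF R RH disj] by blast
    then have "component_graph (component_graph (join G H) (half_edges (join G H) - half_edges G)) D =
        component_graph (join G H) D"
      by (simp add: component_graph_component_graph Int_absorb1)
    then show ?thesis using j(4) by simp
  qed
  then show "all_generators (join G H)"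
    unfolding all_generators_def comps using j(1,3) G H by (auto simp: all_generators_def)
qed

text \<open>The two numbers are all that the sum over contracted graphs will depend on, hence the
  grouping by them.\<close>

definition unions :: "nat set \<Rightarrow> nat \<Rightarrow> nat \<Rightarrow> nat ribbon set" where
  "unions X a b = {H. all_generators H \<and> half_edges H = X \<and>
     card (generator_components 4 H) = a \<and> card (generator_components 2 H) = b}"

definition union_sum :: "nat set \<Rightarrow> nat \<Rightarrow> nat \<Rightarrow> hck" where
  "union_sum X a b = (\<Sum>H\<in>unions X a b. graph_elem H)"

definition generating_graphs :: "nat \<Rightarrow> 'h set \<Rightarrow> 'h ribbon set" where
  "generating_graphs p Y = {G. generating_graph p G \<and> half_edges G = Y}"

lemma finite_generating_graphs: "finite Y \<Longrightarrow> finite (generating_graphs p Y)"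
  by (rule finite_subset[OF _ finite_ribbon_graphs[of Y]])
    (auto simp: generating_graphs_def generating_graph_iff planar_ribbon_def)

lemma finite_unions: "finite X \<Longrightarrow> finite (unions X a b)"
  by (rule finite_subset[OF _ finite_ribbon_graphs[of X]]) (auto simp: unions_def all_generators_def)

lemma generating_graph_unique: "generating_graph p G \<Longrightarrow> generating_graph q G \<Longrightarrow> p = q"
  by (auto simp: generating_graph_iff planar_ribbon_def)

text \<open>Both sides count the unions with one marked component.\<close>

lemma union_sum_rec:
  assumes X: "finite X" and p: "(p = 4 \<and> a' = Suc a \<and> b' = b \<and> m = a') \<or> (p = 2 \<and> a' = a \<and> b' = Suc b \<and> m = b')"
  shows "of_nat m * union_sum X a' b' =
    (\<Sum>Y\<in>Pow X. (\<Sum>G\<in>generating_graphs p Y. graph_elem G) * union_sum (X - Y) a b)"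
proof -
  let ?M = "Sigma (unions X a' b') (generator_components p)"
  let ?N = "SIGMA Y:Pow X. generating_graphs p Y \<times> unions (X - Y) a b"
  let ?split = "\<lambda>(H :: nat ribbon, C). (C, component_graph H C, component_graph H (half_edges H - C))"
  let ?join = "\<lambda>(Y :: nat set, G, H). (join G H, Y)"
  have fin: "finite (generator_components q H)" if "all_generators H" for q and H :: "nat ribbon"
    using that finite_components[of H] by (simp add: generator_components_def all_generators_def)
  have cardM: "card (generator_components p H) = m" if "H \<in> unions X a' b'" for H
    using that p by (auto simp: unions_def)
  have "of_nat m * union_sum X a' b' = (\<Sum>H\<in>unions X a' b'. \<Sum>C\<in>generator_components p H. graph_elem H)"
    unfolding union_sum_def sum_distrib_left by (rule sum.cong[OF refl]) (simp add: cardM)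
  also have "\<dots> = (\<Sum>(H, C)\<in>?M. graph_elem H)"
    using finite_unions[OF X] fin by (subst sum.Sigma) (auto simp: unions_def)
  also have "\<dots> = (\<Sum>(Y, G, H)\<in>?N. graph_elem G * graph_elem H)"
  proof (rule sum.reindex_bij_witness[of _ ?join ?split])
    fix x assume "x \<in> ?M"
    then obtain H C where x: "x = (H, C)" and H: "all_generators H" "half_edges H = X"
        "card (generator_components 4 H) = a'" "card (generator_components 2 H) = b'"
      and C: "C \<in> components H" "generating_graph p (component_graph H C)" "C \<in> generator_components p H"
      by (auto simp: unions_def generator_components_def)
    note s = component_split[OF H(1) C(1)]
    have R: "ribbon_graph H" using H by (simp add: all_generators_def)
    have CX: "C \<subseteq> X" using component_subset[OF R C(1)] H(2) by simp
    show "?join (?split x) = x" using join_component_graph[OF R, of C] CX H(2) by (simp add: x)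
    \<comment> \<open>Splitting off a \<open>p\<close>-point component lowers only the count for
      \<open>p\<close>, since the number of external half edges determines the type.\<close>
    have "card (generator_components q H - {C}) = card (generator_components q H) - (if q = p then 1 else 0)" for q
    proof (cases "q = p")
      case True
      then show ?thesis using C(3) by (simp add: card_Diff_singleton)
    next
      case False
      then have "C \<notin> generator_components q H"
        using C(2) generating_graph_unique[of p "component_graph H C" q] by (auto simp: generator_components_def)
      then show ?thesis using False by simp
    qed
    then have "component_graph H (X - C) \<in> unions (X - C) a b"
      unfolding unions_def using s H p by auto
    then show "?split x \<in> ?N" using C CX H(2) by (simp add: x generating_graphs_def)
    show "(case ?split x of (Y, G, H) \<Rightarrow> graph_elem G * graph_elem H) = (case x of (H, C) \<Rightarrow> graph_elem H)"
      using s(5) by (simp add: x)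
  next
    fix y assume "y \<in> ?N"
    then obtain Y G H where y: "y = (Y, G, H)" "Y \<subseteq> X" and G: "generating_graph p G" "half_edges G = Y"
      and H: "all_generators H" "half_edges H = X - Y"
        "card (generator_components 4 H) = a" "card (generator_components 2 H) = b"
      by (auto simp: unions_def generating_graphs_def)
    have gen: "is_generator G" using G p by (auto simp: is_generator_def)
    have disj: "half_edges G \<inter> half_edges H = {}" using G H by auto
    note R = is_generatorD(1)[OF gen]
    have RH: "ribbon_graph H" using H by (simp add: all_generators_def)
    note j = join_generator[OF gen H(1) disj]
    note cg = component_graph_join[OF R RH disj]
    have half: "half_edges (join G H) = X" using half_edges_join[OF R RH disj] G H y by auto
    note s = component_split[OF j]
    show "?split (?join y) = y" using cg G(2) by (simp add: y)
    have YC: "Y \<in> components (join G H)" using j(2) G(2) by simp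
    have "generator_components q H = generator_components q (join G H) - {Y}" for q
      using s(4)[of q] cg G(2) by simp
    moreover have "Y \<in> generator_components q (join G H) \<longleftrightarrow> q = p" for q
      using YC cg(1) G generating_graph_unique[of p G q] by (auto simp: generator_components_def)
    ultimately have "card (generator_components q (join G H)) =
        card (generator_components q H) + (if q = p then 1 else 0)" for q
      using card_Suc_Diff1[OF fin[OF j(1)], of Y q] by (cases "q = p") simp_all
    then have "join G H \<in> unions X a' b'"
      unfolding unions_def using j(1) half H p by auto
    moreover have "Y \<in> generator_components p (join G H)"
      using YC cg(1) G by (auto simp: generator_components_def)
    ultimately show "?join y \<in> ?M" by (simp add: y)
  qed
  also have "\<dots> = (\<Sum>Y\<in>Pow X. \<Sum>(G, H)\<in>generating_graphs p Y \<times> unions (X - Y) a b. graph_elem G * graph_elem H)"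
  proof (subst sum.Sigma)
    show "\<forall>Y\<in>Pow X. finite (generating_graphs p Y \<times> unions (X - Y) a b)"
    proof
      fix Y assume "Y \<in> Pow X"
      then have "finite Y" "finite (X - Y)" using X finite_subset by auto
      then show "finite (generating_graphs p Y \<times> unions (X - Y) a b)"
        by (intro finite_cartesian_product finite_generating_graphs finite_unions)
    qed
  qed (use X in \<open>simp_all add: case_prod_beta\<close>)
  also have "\<dots> = (\<Sum>Y\<in>Pow X. (\<Sum>G\<in>generating_graphs p Y. graph_elem G) * union_sum (X - Y) a b)"
    by (simp add: union_sum_def sum_product sum.cartesian_product)
  finally show ?thesis .
qed

text \<open>All vertices being 4-valent, a set of \<open>4V\<close> half edges contributes to the coefficient of order \<open>V\<close>.\<close>

definition egf :: "(nat set \<Rightarrow> 'a::{comm_ring_1, ring_char_0}) \<Rightarrow> 'a fps \<Rightarrow> bool" where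
  "egf s P \<longleftrightarrow> (\<forall>X. finite X \<longrightarrow>
     s X = (if 4 dvd card X then fact (card X) * fps_nth P (card X div 4) else 0))"

text \<open>The product rule for exponential generating functions: there are
  \<open>4V choose 4i\<close> parts \<open>Y\<close> of size \<open>4i\<close>, and this number
  times \<open>(4i)! (4V - 4i)!\<close> is \<open>(4V)!\<close>.\<close>

lemma egf_mult:
  assumes w: "egf w P" and s: "egf s Q"
  shows "egf (\<lambda>X. \<Sum>Y\<in>Pow X. w Y * s (X - Y)) (P * Q)"
  unfolding egf_def
proof (intro allI impI)
  fix X :: "nat set" assume X: "finite X"
  let ?N = "card X"
  define h where "h k = (if 4 dvd k then fact k * fps_nth P (k div 4) else 0) *
    (if 4 dvd ?N - k then fact (?N - k) * fps_nth Q ((?N - k) div 4) else 0)" for k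
  have "(\<Sum>Y\<in>Pow X. w Y * s (X - Y)) = (\<Sum>Y\<in>Pow X. h (card Y))"
  proof (rule sum.cong[OF refl])
    fix Y assume "Y \<in> Pow X"
    then have "finite Y" "finite (X - Y)" "card (X - Y) = ?N - card Y"
      using X by (auto simp: card_Diff_subset finite_subset)
    then show "w Y * s (X - Y) = h (card Y)" using w s by (simp add: egf_def h_def)
  qed
  also have "\<dots> = (\<Sum>k\<in>{..?N}. \<Sum>Y | Y \<in> Pow X \<and> card Y = k. h (card Y))"
    by (rule sum.group[symmetric]) (use X in \<open>auto intro: card_mono\<close>)
  also have "\<dots> = (\<Sum>k\<in>{..?N}. of_nat (?N choose k) * h k)"
  proof (rule sum.cong[OF refl])
    fix k
    have "(\<Sum>Y | Y \<in> Pow X \<and> card Y = k. h (card Y)) = (\<Sum>Y | Y \<in> Pow X \<and> card Y = k. h k)"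
      by (rule sum.cong) auto
    then show "(\<Sum>Y | Y \<in> Pow X \<and> card Y = k. h (card Y)) = of_nat (?N choose k) * h k"
      using n_subsets[OF X, of k] by simp
  qed
  finally have sum: "(\<Sum>Y\<in>Pow X. w Y * s (X - Y)) = (\<Sum>k\<in>{..?N}. of_nat (?N choose k) * h k)" .
  show "(\<Sum>Y\<in>Pow X. w Y * s (X - Y)) =
    (if 4 dvd ?N then fact ?N * fps_nth (P * Q) (?N div 4) else 0)"
  proof (cases "4 dvd ?N")
    case False
    \<comment> \<open>If 4 does not divide the total, it fails to divide one of the two
      parts.\<close>
    have "h k = 0" if "k \<le> ?N" for k
      using False that dvd_add[of 4 k "?N - k"] by (auto simp: h_def)
    then show ?thesis using False by (simp add: sum)
  next
    case True
    then obtain V where V: "?N = 4 * V" by blast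
    have "(\<Sum>k\<in>{..?N}. of_nat (?N choose k) * h k) = (\<Sum>k\<in>(*) 4 ` {..V}. of_nat (?N choose k) * h k)"
    proof (rule sum.mono_neutral_right)
      show "\<forall>k\<in>{..?N} - (*) 4 ` {..V}. of_nat (?N choose k) * h k = 0"
      proof
        fix k assume "k \<in> {..?N} - (*) 4 ` {..V}"
        then have "\<not> 4 dvd k" using V by auto
        then show "of_nat (?N choose k) * h k = 0" by (simp add: h_def)
      qed
    qed (use V in auto)
    also have "\<dots> = (\<Sum>i\<in>{..V}. of_nat (?N choose (4 * i)) * h (4 * i))"
      by (subst sum.reindex) (auto simp: inj_on_def)
    also have "\<dots> = (\<Sum>i\<in>{..V}. fact ?N * (fps_nth P i * fps_nth Q (V - i)))"
    proof (rule sum.cong[OF refl])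
      fix i assume "i \<in> {..V}"
      then have i: "4 * i \<le> ?N" "?N - 4 * i = 4 * (V - i)" using V by auto
      have "(fact ?N :: 'a) = of_nat (fact (4 * i) * fact (?N - 4 * i) * (?N choose (4 * i)))"
        using binomial_fact_lemma[OF i(1)] by (simp only: of_nat_fact)
      then show "of_nat (?N choose (4 * i)) * h (4 * i) = fact ?N * (fps_nth P i * fps_nth Q (V - i))"
        by (simp add: h_def i(2))
    qed
    finally show ?thesis
      using V by (simp add: sum fps_mult_nth sum_distrib_left atMost_atLeast0)
  qed
qed

lemma egf_cong: "(\<And>X. finite X \<Longrightarrow> s X = s' X) \<Longrightarrow> egf s P \<longleftrightarrow> egf s' P"
  by (simp add: egf_def)

lemma flip_eq_id:
  assumes R: "ribbon_graph G" and c: "card (external G) = card (half_edges G)" shows "flip G = id"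
proof -
  have "external G \<subseteq> half_edges G" by (auto simp: external_def)
  then have ext: "external G = half_edges G" using c ribbonD(1)[OF R] by (intro card_subset_eq) auto
  show ?thesis
  proof
    fix h
    show "flip G h = id h"
      using ext permutes_not_in[OF ribbonD(3)[OF R], of h] by (cases "h \<in> half_edges G") (auto simp: external_def)
  qed
qed

text \<open>The four external half edges use up all half edges, so there is no internal edge and the
  rotation is one 4-cycle.\<close>

lemma one_vertex:
  assumes G: "generating_graph 4 G" and c: "card (half_edges G) = 4"
  shows "flip G = id" "\<And>h. h \<in> half_edges G \<Longrightarrow> orbit (vrot G) h = half_edges G"
    "external G = half_edges G"
proof -
  have R: "ribbon_graph G" and e: "card (external G) = 4" and v: "\<And>w. w \<in> vertices G \<Longrightarrow> card w = 4"
    using G by (auto simp: generating_graph_iff planar_ribbon_def)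
  have "external G \<subseteq> half_edges G" by (auto simp: external_def)
  then show ext: "external G = half_edges G" using e c ribbonD(1)[OF R] by (intro card_subset_eq) auto
  show "flip G = id" using flip_eq_id[OF R] e c by simp
  show "orbit (vrot G) h = half_edges G" if h: "h \<in> half_edges G" for h
  proof (rule card_subset_eq[OF ribbonD(1)[OF R]])
    show "orbit (vrot G) h \<subseteq> half_edges G" by (rule permutes_orbit_subset[OF ribbonD(2)[OF R] h])
    show "card (orbit (vrot G) h) = card (half_edges G)"
      using v h c by (simp add: vertices_def cycles_of_def)
  qed
qed

lemma one_vertex_iso:
  assumes G: "ribbon_graph G" "flip G = id" "orbit (vrot G) h = half_edges G"
    and G': "ribbon_graph G'" "flip G' = id" "orbit (vrot G') h' = half_edges G'"
    and c: "card (half_edges G) = card (half_edges G')"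
  obtains F where "bij F" "G' = relabel F G" "F h = h'"
proof -
  obtain f where f: "bij_betw f (half_edges G) (half_edges G')" "f h = h'"
    "\<And>z. z \<in> half_edges G \<Longrightarrow> f (vrot G z) = vrot G' (f z)"
    using cycle_iso[OF ribbonD(2,1)[OF G(1)] ribbonD(2,1)[OF G'(1)], of h h'] G G' c by metis
  have "ribbon_iso f G G'" using f G G' by (simp add: ribbon_iso_def)
  from ribbon_iso_imp_relabel[OF G(1) G'(1) this]
  obtain F where F: "bij F" "relabel F G = G'" "\<And>x. x \<in> half_edges G \<Longrightarrow> F x = f x" by metis
  have "h \<in> half_edges G" using G(3) self_in_orbit[OF ribbonD(2,1)[OF G(1)], of h] by simp
  then show ?thesis using that F f by metis
qed

lemma half_edges_vertex4: "half_edges vertex4 = {0, 1, 2, 3}" "card (half_edges vertex4) = 4"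
  by (simp_all add: vertex4_def)

lemma is_generator_vertex4: "is_generator vertex4"
  using generating_graph_vertex4 by (simp add: is_generator_def)

lemma loop_number_vertex4: "loop_number vertex4 = 0"
  using card_half_edges_generating[OF generating_graph_vertex4] half_edges_vertex4(2) by simp

text \<open>Rotating the vertex moves any external half edge to any other, so it has only one
  labelling. Hence \<open>c_v 0\<close> follows the general pattern, in contrast to
  \<open>c_e 0\<close>.\<close>

lemma labelled_sum_4_0: "labelled_sum 4 0 = graph_elem vertex4"
proof -
  note v = generating_graph_vertex4
  have Rv: "ribbon_graph vertex4" using v by (simp add: generating_graph_def)
  note ov = one_vertex[OF v half_edges_vertex4(2)]
  have 0: "0 \<in> half_edges vertex4" by (simp add: half_edges_vertex4)
  have "labelled_graphs 4 0 = {labelled_class vertex4 0}"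
  proof (intro equalityI subsetI)
    fix L assume "L \<in> labelled_graphs 4 0"
    then obtain G h where G: "generating_graph 4 G" "loop_number G = 0" "h \<in> external G" "L = labelled_class G h"
      by (auto simp: labelled_graphs_def)
    have R: "ribbon_graph G" using G by (simp add: generating_graph_def)
    have c: "card (half_edges G) = 4" using card_half_edges_generating[OF G(1)] G(2) by simp
    note o = one_vertex[OF G(1) c]
    have h: "h \<in> half_edges G" using G o by simp
    obtain F where F: "bij F" "G = relabel F vertex4" "F 0 = h"
      using one_vertex_iso[OF Rv ov(1) ov(2)[OF 0] R o(1) o(2)[OF h]] c half_edges_vertex4 by metis
    then show "L \<in> {labelled_class vertex4 0}"
      using labelled_class_relabel[OF Rv 0 F(1)] G(4) by simp
  next
    fix L assume "L \<in> {labelled_class vertex4 0}"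
    then show "L \<in> labelled_graphs 4 0"
      unfolding labelled_graphs_def using v loop_number_vertex4 0 ov(3) by blast
  qed
  then have "labelled_sum 4 0 = graph_elem (fst (SOME x. x \<in> labelled_class vertex4 0))"
    by (simp add: labelled_sum_def)
  moreover have cl: "labelled_class vertex4 0 = {(relabel F vertex4, F 0) | F. bij F}"
    by (rule labelled_class_eq[OF Rv 0])
  have "(relabel id vertex4, id 0) \<in> labelled_class vertex4 0" unfolding cl using bij_id by blast
  then have "(SOME x. x \<in> labelled_class vertex4 0) \<in> labelled_class vertex4 0" by (rule someI)
  then have "graph_elem (fst (SOME x. x \<in> labelled_class vertex4 0)) = graph_elem vertex4"
    unfolding cl using graph_elem_relabel[OF Rv] by auto
  ultimately show ?thesis by simp
qed

lemma c_v_eq: "c_v n = labelled_sum 4 n"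
  by (simp add: c_v_def labelled_sum_4_0)

section \<open>Generating series of vertex and edge corrections\<close>

definition vertex_fps :: "hck fps" where
  "vertex_fps = Abs_fps c_v"

text \<open>The constant term is dropped because the open edge is not a component of a subgraph; as
  a consequence the \<open>b\<close>-th power starts in order \<open>b\<close>.\<close>

definition edge_fps :: "hck fps" where
  "edge_fps = Abs_fps (\<lambda>n. if n = 0 then 0 else c_e n)"

text \<open>Here the order counts vertices instead of loops: a 4-point graph with \<open>n\<close>
  internal faces has \<open>n + 1\<close> of them, whence the factor \<open>fps_X\<close>, and a
  2-point graph has \<open>n\<close>.\<close>

definition point_fps :: "nat \<Rightarrow> hck fps" where
  "point_fps p = (if p = 4 then fps_X * vertex_fps else edge_fps)"

lemma point_fps_4: "point_fps 4 = fps_X * vertex_fps" and point_fps_2: "point_fps 2 = edge_fps"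
  by (simp_all add: point_fps_def)

lemma point_fps_nth: "p = 2 \<or> p = 4 \<Longrightarrow> card X + 4 = 4 * n + 2 * p \<Longrightarrow> 0 < card X \<Longrightarrow>
   4 dvd card X \<and> fps_nth (point_fps p) (card X div 4) = labelled_sum p n"
proof (elim disjE)
  assume "card X + 4 = 4 * n + 2 * p" "p = 4"
  then have "card X = 4 * (n + 1)" by simp
  then show ?thesis using \<open>p = 4\<close> by (simp add: point_fps_def vertex_fps_def c_v_eq)
next
  assume "card X + 4 = 4 * n + 2 * p" "p = 2" "0 < card X"
  then have "card X = 4 * n" "n > 0" by auto
  then show ?thesis using \<open>p = 2\<close> by (simp add: point_fps_def edge_fps_def c_e_def)
qed

lemma vertex_fps_power_nth_0: "fps_nth (vertex_fps ^ a) 0 = c_v 0 ^ a"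
  by (induction a) (simp_all add: vertex_fps_def)

text \<open>This is \<open>rooted_count\<close> with the class itself as summand. Sets of other
  sizes carry no generating graph, by the count of half edges, and neither does the empty
  set.\<close>

lemma egf_generating:
  assumes p: "p = 2 \<or> p = 4"
  shows "egf (\<lambda>Y. of_nat p * (\<Sum>G\<in>generating_graphs p Y. graph_elem G)) (point_fps p)"
  unfolding egf_def
proof (intro allI impI)
  fix Y :: "nat set" assume Y: "finite Y"
  have 0: "fps_nth (point_fps p) 0 = 0" using p by (auto simp: point_fps_def edge_fps_def)
  show "of_nat p * (\<Sum>G\<in>generating_graphs p Y. graph_elem G) =
    (if 4 dvd card Y then fact (card Y) * fps_nth (point_fps p) (card Y div 4) else 0)"
  proof (cases "4 dvd card Y \<and> Y \<noteq> {}")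
    case True
    then obtain k where k: "card Y = 4 * k" by blast
    then have "k > 0" using True Y by (cases k) auto
    \<comment> \<open>The number of faces is \<open>k\<close> for \<open>p = 2\<close> and
      \<open>k - 1\<close> for \<open>p = 4\<close>.\<close>
    then obtain n where n: "card Y + 4 = 4 * n + 2 * p" using p k by (elim disjE) (auto intro: that[of k] that[of "k - 1"])
    have "of_nat p * (\<Sum>G | generating_graph p G \<and> half_edges G = Y. graph_elem G) =
        fact (card Y) * labelled_sum p n"
      unfolding labelled_sum_def by (rule rooted_count[OF Y n]) (rule graph_elem_relabel)
    then show ?thesis
      using point_fps_nth[OF p n] True Y by (simp add: generating_graphs_def card_gt_0_iff)
  next
    case False
    have "generating_graphs p Y = {}"
    proof (rule equals0I)
      fix G assume "G \<in> generating_graphs p Y"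
      then have G: "generating_graph p G" "half_edges G = Y" by (auto simp: generating_graphs_def)
      have "card Y + 4 = 4 * loop_number G + 2 * p" using card_half_edges_generating[OF G(1)] G(2) by simp
      then have "4 dvd card Y" using p by presburger
      moreover have "Y \<noteq> {}" using G planar_ribbon_nonempty by (auto simp: generating_graph_iff)
      ultimately show False using False by simp
    qed
    then show ?thesis using False 0 by auto
  qed
qed

lemma union_sum_empty: "union_sum X 0 0 = (if X = {} then 1 else 0)"
proof -
  have half: "half_edges H = {}"
    if H: "all_generators H" "card (generator_components 4 H) = 0" "card (generator_components 2 H) = 0"
    for H :: "nat ribbon"
  proof -
    have R: "ribbon_graph H" using H by (simp add: all_generators_def)
    have "generator_components 4 H = {}" "generator_components 2 H = {}"
      using H finite_components[OF R] by (auto simp: generator_components_def)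
    then have "components H = {}"
      using H(1) unfolding generator_components_def all_generators_def is_generator_def by blast
    then show ?thesis using Union_components[OF R] by simp
  qed
  let ?O = "\<lparr>half_edges = {} :: nat set, vrot = id, flip = id\<rparr>"
  have O: "all_generators ?O" "components ?O = {}"
    by (auto simp: all_generators_def ribbon_graph_def components_def permutes_id)
  have "unions {} 0 0 = {?O}"
  proof (intro equalityI subsetI)
    fix H assume "H \<in> unions {} 0 0"
    then have "ribbon_graph H" "half_edges H = {}" by (auto simp: unions_def all_generators_def)
    then have "vrot H = id" "flip H = id" by (auto simp: ribbon_graph_def)
    then show "H \<in> {?O}" using \<open>half_edges H = {}\<close> by simp
  qed (use O in \<open>auto simp: unions_def generator_components_def\<close>)
  moreover have "graph_elem ?O = 1" using O by (simp add: graph_elem_def monomial_of_def)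
  moreover have "unions X 0 0 = {}" if "X \<noteq> {}" using that half by (auto simp: unions_def)
  ultimately show ?thesis by (simp add: union_sum_def)
qed

text \<open>Each component split off brings the number of ways to mark it, building up the
  factorials, and a factor \<open>p\<close> for the choice of its root, building up
  \<open>4^a\<close> and \<open>2^b\<close>.\<close>

lemma union_sum_egf:
  "egf (\<lambda>X. of_nat (fact a * fact b * 4 ^ a * 2 ^ b) * union_sum X a b)
     (point_fps 4 ^ a * point_fps 2 ^ b)"
proof -
  have step: "egf (\<lambda>X. of_nat (p * m * k) * union_sum X a' b') (point_fps p * P)"
    if egf: "egf (\<lambda>X. of_nat k * union_sum X a b) P"
      and p: "(p = 4 \<and> a' = Suc a \<and> b' = b \<and> m = a') \<or> (p = 2 \<and> a' = a \<and> b' = Suc b \<and> m = b')"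
    for p m k a b a' b' P
  proof (rule iffD2[OF egf_cong egf_mult[OF egf_generating egf]])
    fix X :: "nat set" assume X: "finite X"
    have "of_nat (p * m * k) * union_sum X a' b' = of_nat p * of_nat k * (of_nat m * union_sum X a' b')"
      by (simp add: mult_ac)
    also have "of_nat m * union_sum X a' b' =
        (\<Sum>Y\<in>Pow X. (\<Sum>G\<in>generating_graphs p Y. graph_elem G) * union_sum (X - Y) a b)"
      by (rule union_sum_rec[OF X p])
    finally show "of_nat (p * m * k) * union_sum X a' b' = (\<Sum>Y\<in>Pow X.
        of_nat p * (\<Sum>G\<in>generating_graphs p Y. graph_elem G) * (of_nat k * union_sum (X - Y) a b))"
      by (subst (asm) sum_distrib_left) (simp only: mult_ac)
  qed (use p in blast)
  have base: "egf (\<lambda>X. of_nat (fact 0 * fact b * 4 ^ 0 * 2 ^ b) * union_sum X 0 b) (point_fps 2 ^ b)" for b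
  proof (induction b)
    case 0
    show ?case unfolding egf_def by (auto simp: union_sum_empty fps_one_nth dvd_div_eq_0_iff)
  next
    case (Suc b)
    have "fact 0 * fact (Suc b) * 4 ^ 0 * 2 ^ Suc b = 2 * Suc b * (fact 0 * fact b * 4 ^ 0 * 2 ^ b :: nat)"
      unfolding fact_Suc power_Suc of_nat_id by (simp only: mult_ac)
    then show ?case using step[OF Suc, of 2 0 "Suc b" "Suc b"] by (simp only: power_Suc) simp
  qed
  show ?thesis
  proof (induction a)
    case 0 show ?case using base by simp
  next
    case (Suc a)
    have "fact (Suc a) * fact b * 4 ^ Suc a * 2 ^ b = 4 * Suc a * (fact a * fact b * 4 ^ a * 2 ^ b :: nat)"
      unfolding fact_Suc power_Suc of_nat_id by (simp only: mult_ac)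
    then show ?case using step[OF Suc, of 4 "Suc a" b "Suc a"] by (simp only: power_Suc mult.assoc) simp
  qed
qed

lemma lookup_of_nat_mult: "Poly_Mapping.lookup (of_nat k * x) m = of_nat k * Poly_Mapping.lookup x m"
  for x :: hck
  by (subst single_of_nat[symmetric], subst mult_map_scale_conv_mult[symmetric]) (rule lookup_scale)

text \<open>Coefficients are rational, so the algebra has no torsion and identities between counts
  can be divided by positive integers.\<close>

lemma of_nat_mult_cancel: "of_nat k * x = of_nat k * y \<Longrightarrow> k > 0 \<Longrightarrow> x = y" for x y :: hck
  by (rule poly_mapping_eqI) (metis lookup_of_nat_mult mult_left_cancel of_nat_0_eq_iff not_gr0)

lemma c_v_0: "c_v 0 = Poly_Mapping.single {#generator_of vertex4#} 1"
  by (simp add: c_v_def graph_elem_generator[OF is_generator_vertex4])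

lemma c_v_0_power: "c_v 0 ^ a = Poly_Mapping.single (replicate_mset a (generator_of vertex4)) 1"
  by (induction a) (simp_all add: c_v_0 mult_single)

section \<open>Rotations with all cycles of length four\<close>

abbreviation quartic :: "'h set \<Rightarrow> ('h \<Rightarrow> 'h) \<Rightarrow> bool" where
  "quartic E \<tau> \<equiv> \<tau> permutes E \<and> (\<forall>c\<in>cycles_of \<tau> E. card c = 4)"

text \<open>With all half edges external, each cycle of the rotation is a component of its own, a
  copy of the single vertex. This serves the count of quartic rotations as well as the value of
  \<open>skl\<close>.\<close>

lemma skeleton:
  fixes E :: "nat set"
  assumes E: "finite E" and t: "quartic E \<tau>"
  defines "H \<equiv> \<lparr>half_edges = E, vrot = \<tau>, flip = id\<rparr>"
  shows "all_generators H" "generator_components 4 H = cycles_of \<tau> E" "generator_components 2 H = {}"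
    "graph_elem H = c_v 0 ^ card (cycles_of \<tau> E)"
proof -
  have t': "\<tau> permutes E" using t by simp
  have R: "ribbon_graph H" using E t by (simp add: H_def ribbon_graph_def permutes_id)
  have cl: "closed_in H A \<longleftrightarrow> A \<subseteq> E \<and> \<tau> ` A \<subseteq> A" for A by (auto simp: H_def closed_in_def)
  have comps: "components H = cycles_of \<tau> E"
  proof (rule components_eqI[OF R])
    fix c assume "c \<in> cycles_of \<tau> E"
    then obtain z where z: "z \<in> E" "c = orbit \<tau> z" by (auto simp: cycles_of_def)
    show "c \<noteq> {}" using z orbit_nonempty by simp
    show "closed_in H c" unfolding cl using permutes_orbit_subset[OF t' z(1)] z by (auto intro: orbit.step)
  next
    show "\<Union>(cycles_of \<tau> E) = half_edges H" using Union_cycles_of[OF t' E] by (simp add: H_def)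
  next
    fix c A x assume c: "c \<in> cycles_of \<tau> E" and A: "closed_in H A" "x \<in> A" "x \<in> c"
    then have "c = orbit \<tau> x" using orbit_sym(2)[OF t' E] by (auto simp: cycles_of_def)
    then show "c \<subseteq> A" using orbit_subset_closed[of \<tau> A x] A unfolding cl by simp
  qed
  have gen: "generating_graph 4 (component_graph H c) \<and> generator_of (component_graph H c) = generator_of vertex4"
    if c: "c \<in> cycles_of \<tau> E" for c
  proof -
    have "c \<in> components H" using c comps by simp
    note R' = ribbon_graph_component_graph[OF R component_closed[OF R this]]
    obtain z where z: "z \<in> E" "c = orbit \<tau> z" using c by (auto simp: cycles_of_def)
    have "\<tau> ` c \<subseteq> c" using z by (auto intro: orbit.step)
    then have o: "orbit (vrot (component_graph H c)) z = half_edges (component_graph H c)"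
      using z orbit_perm_restrict[of \<tau> c z] self_in_orbit[OF t' E, of z] by (simp add: H_def)
    have f: "flip (component_graph H c) = id" by (auto simp: H_def perm_restrict_def)
    have card: "card (half_edges vertex4) = card (half_edges (component_graph H c))"
      using c t half_edges_vertex4 by simp
    have 0: "0 \<in> half_edges vertex4" by (simp add: half_edges_vertex4)
    note ov = one_vertex[OF generating_graph_vertex4 half_edges_vertex4(2)]
    have Rv: "ribbon_graph vertex4" using generating_graph_vertex4 by (simp add: generating_graph_def)
    obtain F where "bij F" "component_graph H c = relabel F vertex4"
      using one_vertex_iso[OF Rv ov(1) ov(2)[OF 0] R' f o card] by metis
    then show ?thesis using Rv generating_graph_vertex4 by (simp add: generating_relabel generator_of_relabel)
  qed
  then show "all_generators H" using R by (auto simp: all_generators_def comps is_generator_def)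
  show "generator_components 4 H = cycles_of \<tau> E"
    unfolding generator_components_def comps using gen by blast
  have "\<not> generating_graph 2 (component_graph H c)" if "c \<in> cycles_of \<tau> E" for c
    using gen[OF that] generating_graph_unique[of 4 "component_graph H c" 2] by auto
  then show "generator_components 2 H = {}"
    unfolding generator_components_def comps by blast
  have "monomial_of H = image_mset (\<lambda>c. generator_of vertex4) (mset_set (cycles_of \<tau> E))"
    unfolding monomial_of_def comps using gen finite_cycles_of[OF E] by (intro image_mset_cong) simp
  then show "graph_elem H = c_v 0 ^ card (cycles_of \<tau> E)"
    by (simp add: graph_elem_def c_v_0_power image_mset_const_eq)
qed

lemma card_cycles_quartic: "finite E \<Longrightarrow> quartic E \<tau> \<Longrightarrow> card E = 4 * card (cycles_of \<tau> E)"
  using sum_card_cycles_of[of \<tau> E] by simp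

text \<open>A 4-point generator has at least four half edges; \<open>a\<close> of them sharing
  \<open>4 a\<close> half edges have exactly four each, so each is a single vertex.\<close>

lemma unions_quartic:
  assumes E: "finite E" "card E = 4 * a"
  shows "unions E a 0 = (\<lambda>\<tau>. \<lparr>half_edges = E, vrot = \<tau>, flip = id\<rparr>) ` {\<tau>. quartic E \<tau>}"
proof (intro equalityI subsetI)
  fix H assume "H \<in> (\<lambda>\<tau>. \<lparr>half_edges = E, vrot = \<tau>, flip = id\<rparr>) ` {\<tau>. quartic E \<tau>}"
  then obtain \<tau> where t: "quartic E \<tau>" "H = \<lparr>half_edges = E, vrot = \<tau>, flip = id\<rparr>" by blast
  show "H \<in> unions E a 0"
    using skeleton[OF E(1) t(1)] card_cycles_quartic[OF E(1) t(1)] E(2) t(2) by (simp add: unions_def)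
next
  fix H assume "H \<in> unions E a 0"
  then have H: "all_generators H" "half_edges H = E" "card (generator_components 4 H) = a"
    "card (generator_components 2 H) = 0" by (auto simp: unions_def)
  have R: "ribbon_graph H" using H by (simp add: all_generators_def)
  have "generator_components 2 H = {}"
    using H finite_components[OF R] by (simp add: generator_components_def)
  then have gen: "generating_graph 4 (component_graph H C)" if "C \<in> components H" for C
    using that H(1) unfolding generator_components_def all_generators_def is_generator_def by blast
  then have "generator_components 4 H = components H" by (auto simp: generator_components_def)
  then have ca: "card (components H) = a" using H by simp
  have ge: "4 \<le> card C" if "C \<in> components H" for C
    using card_half_edges_generating[OF gen[OF that]] by simp
  have "card (\<Union>(components H)) = sum card (components H)"
  proof (rule card_Union_disjoint)
    show "pairwise disjnt (components H)"
      using components_disjoint[OF R] by (simp add: pairwise_def disjnt_def)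
    show "finite C" if "C \<in> components H" for C
      using component_subset[OF R that] E(1) H(2) finite_subset by metis
  qed
  then have "sum card (components H) = 4 * a" using Union_components[OF R] H(2) E by simp
  then have "(\<Sum>C\<in>components H. card C - 4) = 0"
    using ca ge by (simp add: sum_subtractf_nat)
  then have four: "card C = 4" if "C \<in> components H" for C
    using that ge[OF that] finite_components[OF R] by (auto simp: antisym)
  have 1: "flip H h = h \<and> card (orbit (vrot H) h) = 4" if h: "h \<in> E" for h
  proof -
    obtain C where C: "C \<in> components H" "h \<in> C" using component_ex[OF R] h H(2) by blast
    note o = one_vertex[OF gen[OF C(1)]]
    have c: "card (half_edges (component_graph H C)) = 4" using four[OF C(1)] by simp
    have "flip H h = h" using o(1)[OF c] C(2) by (metis component_graph_simps(3) id_apply perm_restrict_simps(1))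
    moreover have "orbit (vrot H) h = C"
      using o(2)[OF c, of h] C orbit_perm_restrict[of "vrot H" C h] component_closed[OF R C(1)]
      by (simp add: closed_in_def)
    ultimately show ?thesis using four[OF C(1)] by simp
  qed
  have "flip H = id"
    using 1 permutes_not_in[OF ribbonD(3)[OF R]] H(2) by (metis eq_id_iff)
  moreover have "quartic E (vrot H)" using 1 ribbonD(2)[OF R] H(2) by (auto simp: cycles_of_def)
  ultimately show "H \<in> (\<lambda>\<tau>. \<lparr>half_edges = E, vrot = \<tau>, flip = id\<rparr>) ` {\<tau>. quartic E \<tau>}"
    using H(2) by (intro image_eqI[of _ _ "vrot H"]) auto
qed

text \<open>A union of \<open>a\<close> 4-point generators with only \<open>4a\<close> half edges consists of single vertices, so that
  \<^const>\<open>union_sum\<close> counts these permutations.\<close>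

lemma card_quartic:
  fixes E :: "nat set"
  assumes E: "finite E" "card E = 4 * a"
  shows "card {\<tau>. quartic E \<tau>} * (fact a * 4 ^ a) = fact (4 * a)"
proof -
  let ?m = "card {\<tau>. quartic E \<tau>}"
  have "union_sum E a 0 = (\<Sum>\<tau> | quartic E \<tau>. graph_elem \<lparr>half_edges = E, vrot = \<tau>, flip = id\<rparr>)"
    unfolding union_sum_def unions_quartic[OF E] by (subst sum.reindex) (auto simp: inj_on_def)
  also have "\<dots> = (\<Sum>\<tau> | quartic E \<tau>. c_v 0 ^ a)"
    using skeleton(4)[OF E(1)] card_cycles_quartic[OF E(1)] E(2) by (intro sum.cong refl) simp
  finally have u: "union_sum E a 0 = of_nat ?m * c_v 0 ^ a" by simp
  have "fps_nth (point_fps 4 ^ a * point_fps 2 ^ 0) a = c_v 0 ^ a"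
    by (simp add: point_fps_4 power_mult_distrib fps_X_power_mult_nth vertex_fps_power_nth_0)
  then have "of_nat (fact a * fact 0 * 4 ^ a * 2 ^ 0) * union_sum E a 0 = fact (4 * a) * c_v 0 ^ a"
    using union_sum_egf[of a 0] E unfolding egf_def by simp
  then have "of_nat (fact a * 4 ^ a * ?m) * c_v 0 ^ a = of_nat (fact (4 * a)) * c_v 0 ^ a"
    unfolding u by (simp add: mult_ac)
  \<comment> \<open>The coefficient of the monomial \<open>v^a\<close>, which is 1 in
    \<open>c_v 0 ^ a\<close>, turns the identity in the algebra into one between numbers.\<close>
  then have "Poly_Mapping.lookup (of_nat (fact a * 4 ^ a * ?m) * c_v 0 ^ a) (replicate_mset a (generator_of vertex4)) =
      Poly_Mapping.lookup (of_nat (fact (4 * a)) * c_v 0 ^ a) (replicate_mset a (generator_of vertex4))"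
    by simp
  then have "(of_nat (fact a * 4 ^ a * ?m) :: rat) = of_nat (fact (4 * a))"
    unfolding lookup_of_nat_mult c_v_0_power by simp
  then have "fact a * 4 ^ a * ?m = fact (4 * a)" by (simp only: of_nat_eq_iff)
  then show ?thesis by (simp add: mult_ac)
qed

section \<open>Sums over the contracted graphs\<close>

definition contraction_sum :: "nat \<Rightarrow> nat set \<Rightarrow> (nat \<Rightarrow> nat) \<Rightarrow> hck" where
  "contraction_sum p E \<tau> = (\<Sum>K\<in>planars p E \<tau>. graph_elem (delete_bivalent K))"

lemma contraction_sum_relabel:
  assumes F: "bij F"
  shows "contraction_sum p (F ` E) (conjugate F \<tau>) = contraction_sum p E \<tau>"
proof -
  have F': "bij (inv F)" using F by (rule bij_imp_bij_inv)
  have i: "relabel F (relabel (inv F) K) = K" for K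
    using relabel_inv[OF F'] by (simp add: inv_inv_eq[OF F])
  have "conjugate (inv F) (conjugate F \<tau>) = \<tau>"
    by (rule conjugate_eqI[OF F'], rule bij_preimageE[OF F]) (metis conjugate_apply[OF F] bij_inv_apply[OF F])
  moreover have "inv F ` F ` E = E" by (simp add: image_image bij_inv_apply[OF F])
  ultimately have *: "relabel (inv F) K \<in> planars p E \<tau>" if "K \<in> planars p (F ` E) (conjugate F \<tau>)" for K
    using that planar_relabel[OF F', of K p] by (auto simp: planars_def planar_ribbon_def)
  have **: "relabel F K \<in> planars p (F ` E) (conjugate F \<tau>)" if "K \<in> planars p E \<tau>" for K
    using that planar_relabel[OF F, of K p] by (auto simp: planars_def planar_ribbon_def)
  show ?thesis
    unfolding contraction_sum_def
  proof (rule sum.reindex_bij_witness[of _ "relabel F" "relabel (inv F)"])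
    fix K assume K: "K \<in> planars p (F ` E) (conjugate F \<tau>)"
    then have R: "ribbon_graph K" by (simp add: planars_def planar_ribbon_def)
    show "relabel F (relabel (inv F) K) = K" by (rule i)
    show "relabel (inv F) K \<in> planars p E \<tau>" by (rule *[OF K])
    show "graph_elem (delete_bivalent (relabel (inv F) K)) = graph_elem (delete_bivalent K)"
      by (simp only: delete_bivalent_relabel[OF F'] graph_elem_relabel[OF ribbon_graph_delete_bivalent[OF R] F'])
  next
    fix K assume K: "K \<in> planars p E \<tau>"
    show "relabel (inv F) (relabel F K) = K" by (rule relabel_inv[OF F])
    show "relabel F K \<in> planars p (F ` E) (conjugate F \<tau>)" by (rule **[OF K])
  qed
qed

text \<open>All admissible rotations are conjugate, so each contributes the same part of the sum over all
  graphs on \<open>E\<close>.\<close>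

lemma contraction_sum_quartic:
  assumes E: "finite E" "card E = 4 * a" and t: "quartic E \<tau>" and p: "p = 2 \<or> p = 4"
  shows "of_nat p * contraction_sum p E \<tau> = of_nat (4 ^ a * fact a) * fps_nth (point_fps p) a"
proof -
  let ?\<Theta> = "{\<tau>. quartic E \<tau>}"
  have indep: "contraction_sum p E \<tau>' = contraction_sum p E \<tau>" if t': "quartic E \<tau>'" for \<tau>'
  proof -
    let ?R = "\<lparr>half_edges = E, vrot = \<tau>, flip = id\<rparr>" and ?R' = "\<lparr>half_edges = E, vrot = \<tau>', flip = id\<rparr>"
    obtain F where F: "bij_betw F E E" "\<forall>z\<in>E. F (\<tau> z) = \<tau>' (F z)"
      using cycles_conjugate[of \<tau> E \<tau>' E 4] t t' E(1) by auto
    have "ribbon_graph ?R" "ribbon_graph ?R'" using t t' E(1) by (simp_all add: ribbon_graph_def permutes_id)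
    moreover have "ribbon_iso F ?R ?R'" using F by (simp add: ribbon_iso_def)
    ultimately obtain F' where "bij F'" "relabel F' ?R = ?R'" by (rule ribbon_iso_imp_relabel)
    then show ?thesis using contraction_sum_relabel[of F' p E \<tau>] by (simp add: relabel_def)
  qed
  have finT: "finite ?\<Theta>" by (rule finite_subset[OF _ finite_permutations[OF E(1)]]) auto
  have V: "vertices K = cycles_of \<tau>' E" if "K \<in> planars p E \<tau>'" for K \<tau>'
    using that by (simp add: planars_def vertices_def)
  \<comment> \<open>Without bivalent vertices the search for the new partner ends after one
    step.\<close>
  have id: "delete_bivalent K = K" if K: "K \<in> planars p E \<tau>'" and q: "quartic E \<tau>'" for K \<tau>'
  proof -
    have R: "ribbon_graph K" using K by (simp add: planars_def planar_ribbon_def)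
    have b: "bivalent K = {}" unfolding bivalent_def V[OF K] using q by auto
    have "delete_outside (flip K) (half_edges K) h = flip K h" for h
    proof (cases "h \<in> half_edges K")
      case True
      then show ?thesis by (intro delete_outside_step1) (simp_all add: flip_in[OF R])
    next
      case False
      then show ?thesis using permutes_not_in[OF ribbonD(3)[OF R]] by (simp add: delete_outside_def)
    qed
    then have "delete_outside (flip K) (half_edges K) = flip K" by (rule ext)
    then show ?thesis
      unfolding delete_bivalent_def b by (simp add: ribbonD(2)[OF R])
  qed
  have "generating_graphs p E = (\<Union>\<tau>'\<in>?\<Theta>. planars p E \<tau>')"
    by (auto simp: generating_graphs_def generating_graph_iff planars_def vertices_def planar_ribbon_def
        ribbon_graph_def)
  then have "(\<Sum>G\<in>generating_graphs p E. graph_elem G) = (\<Sum>\<tau>'\<in>?\<Theta>. \<Sum>K\<in>planars p E \<tau>'. graph_elem K)"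
    using finT finite_planars[OF E(1)] by (simp only:, subst sum.UNION_disjoint) (auto simp: planars_def)
  also have "\<dots> = (\<Sum>\<tau>'\<in>?\<Theta>. contraction_sum p E \<tau>)"
  proof (rule sum.cong[OF refl])
    fix \<tau>' assume q: "\<tau>' \<in> ?\<Theta>"
    have "(\<Sum>K\<in>planars p E \<tau>'. graph_elem K) = contraction_sum p E \<tau>'"
      unfolding contraction_sum_def using id q by (intro sum.cong refl) auto
    then show "(\<Sum>K\<in>planars p E \<tau>'. graph_elem K) = contraction_sum p E \<tau>" using indep q by simp
  qed
  finally have "of_nat p * (\<Sum>G\<in>generating_graphs p E. graph_elem G) =
      of_nat (card ?\<Theta>) * (of_nat p * contraction_sum p E \<tau>)" by (simp add: mult_ac)
  moreover have "of_nat p * (\<Sum>G\<in>generating_graphs p E. graph_elem G) = fact (4 * a) * fps_nth (point_fps p) a"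
    using egf_generating[OF p] E unfolding egf_def by simp
  \<comment> \<open>By \<open>card_quartic\<close> the factor \<open>(4 a)!\<close> contains the
    number of rotations, which then cancels.\<close>
  ultimately have eq: "of_nat (card ?\<Theta>) * (of_nat p * contraction_sum p E \<tau>) =
      of_nat (card ?\<Theta> * (fact a * 4 ^ a)) * fps_nth (point_fps p) a"
    unfolding card_quartic[OF E] by simp
  have "card ?\<Theta> > 0" using finT t by (auto simp: card_gt_0_iff)
  moreover have "of_nat (card ?\<Theta>) * (of_nat p * contraction_sum p E \<tau>) =
      of_nat (card ?\<Theta>) * (of_nat (4 ^ a * fact a) * fps_nth (point_fps p) a)"
    unfolding eq by (simp only: of_nat_mult mult_ac)
  ultimately show ?thesis by (simp only: of_nat_mult_cancel[of "card ?\<Theta>"])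
qed

text \<open>For \<open>p = 2\<close> both half edges of the only vertex are external, and deleting
  the vertex leaves the open edge, that is the unit. For \<open>p = 4\<close> there are too few half
  edges.\<close>

lemma contraction_sum_bigon:
  assumes t: "\<tau> permutes {x, y}" and xy: "x \<noteq> y" "\<tau> x = y" "\<tau> y = x" and p: "p = 2 \<or> p = 4"
  shows "contraction_sum p {x, y} \<tau> = (if p = 2 then 1 else 0)"
proof -
  let ?O = "\<lparr>half_edges = {x, y}, vrot = \<tau>, flip = id\<rparr>"
  have fin: "finite {x, y}" by simp
  have R: "ribbon_graph ?O" using t by (simp add: ribbon_graph_def permutes_id)
  note o = orbit_swapped_pair[OF t fin xy(2,3)]
  have v: "vertices ?O = {{x, y}}" by (simp add: vertices_def cycles_of_def o)
  have f: "faces ?O = {{x, y}}" by (simp add: faces_eq[OF R] cycles_of_def o)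
  have e: "external ?O = {x, y}" by (auto simp: external_def)
  have i: "internal_edges ?O = {}" by (auto simp: internal_edges_eq[OF R])
  have "connected_ribbon ?O"
    unfolding connected_ribbon_iff[OF R]
  proof (intro allI impI)
    fix A assume A: "closed_in ?O A" "A \<noteq> {}"
    then have "A \<subseteq> {x, y}" "\<And>z. z \<in> A \<Longrightarrow> \<tau> z \<in> A" by (auto simp: closed_in_def)
    then have "x \<in> A" "y \<in> A" using A(2) xy by (metis insertE singletonD subsetD ex_in_conv)+
    then show "A = half_edges ?O" using \<open>A \<subseteq> {x, y}\<close> by auto
  qed
  moreover have "bridgeless ?O" by (simp add: bridgeless_def i)
  moreover have "boundaries ?O = {{x, y}}" unfolding boundaries_def f e by auto
  ultimately have P: "planar_ribbon 2 ?O"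
    using R xy by (simp add: planar_ribbon_def genus_eq_0_iff v f i e)
  show ?thesis
  proof (cases "p = 2")
    case True
    have "planars 2 {x, y} \<tau> = {?O}"
    proof (intro equalityI subsetI)
      fix K assume "K \<in> planars 2 {x, y} \<tau>"
      then have K: "planar_ribbon 2 K" "half_edges K = {x, y}" "vrot K = \<tau>" by (auto simp: planars_def)
      then have "flip K = id" using xy by (intro flip_eq_id) (auto simp: planar_ribbon_def)
      then show "K \<in> {?O}" using K by simp
    qed (use P in \<open>simp add: planars_def\<close>)
    moreover have "card {x, y} = 2" using xy by simp
    then have "{w \<in> {{x, y}}. card w = 2} = {{x, y}}" by blast
    then have "bivalent ?O = {x, y}" unfolding bivalent_def v by simp
    then have "components (delete_bivalent ?O) = {}" by (simp add: delete_bivalent_def components_def)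
    then have "graph_elem (delete_bivalent ?O) = 1" by (simp add: graph_elem_def monomial_of_def)
    ultimately show ?thesis using True by (simp add: contraction_sum_def)
  next
    case False
    have "planars p {x, y} \<tau> = {}"
    proof (rule equals0I)
      fix K assume "K \<in> planars p {x, y} \<tau>"
      then have K: "card (external K) = p" "half_edges K = {x, y}" by (auto simp: planars_def planar_ribbon_def)
      then have "external K \<subseteq> {x, y}" by (auto simp: external_def)
      then have "card (external K) \<le> card {x, y}" by (intro card_mono) auto
      then show False using K xy False p by simp
    qed
    then show ?thesis using False by (simp add: contraction_sum_def)
  qed
qed

text \<open>The successive numbers of edges on which the next of \<open>b\<close> bivalent vertices can be placed.\<close>

definition insertion_count :: "nat \<Rightarrow> nat \<Rightarrow> nat" where
  "insertion_count k b = (\<Prod>i<b. k + i)"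

text \<open>Induction on the number of bivalent vertices. Removing one gives a factor equal to twice
  the number of internal edges of the smaller graph. With no bivalent vertex there are
  \<open>(4 a - p) / 2 = 2 a - p div 2\<close> internal edges, and every vertex placed on an edge
  adds one.\<close>

lemma contraction_sum_eq:
  assumes p: "p = 2 \<or> p = 4" and E: "finite E" and t: "\<tau> permutes E"
    and c: "\<And>c. c \<in> cycles_of \<tau> E \<Longrightarrow> card c = 4 \<or> card c = 2"
    and a: "card {c \<in> cycles_of \<tau> E. card c = 4} = a" and b: "card {c \<in> cycles_of \<tau> E. card c = 2} = b"
  shows "a > 0 \<Longrightarrow> of_nat p * contraction_sum p E \<tau> =
      of_nat (4 ^ a * fact a * 2 ^ b * insertion_count (2 * a - p div 2) b) * fps_nth (point_fps p) a"
    and "a = 0 \<Longrightarrow> contraction_sum p E \<tau> = (if b = 1 \<and> p = 2 then 1 else 0)"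
proof -
  have card_E: "card E = 4 * card {c \<in> cycles_of \<tau> E. card c = 4} + 2 * card {c \<in> cycles_of \<tau> E. card c = 2}"
    if E: "finite E" and t: "\<tau> permutes E" and c: "\<forall>c\<in>cycles_of \<tau> E. card c = 4 \<or> card c = 2"
    for E :: "nat set" and \<tau>
  proof -
    let ?A = "{c \<in> cycles_of \<tau> E. card c = 4}" and ?B = "{c \<in> cycles_of \<tau> E. card c = 2}"
    have "cycles_of \<tau> E = ?A \<union> ?B" using c by blast
    then have "sum card (cycles_of \<tau> E) = sum card (?A \<union> ?B)" by simp
    also have "\<dots> = sum card ?A + sum card ?B"
      using finite_cycles_of[OF E, of \<tau>] by (intro sum.union_disjoint) auto
    finally show ?thesis using sum_card_cycles_of[OF t E] by simp
  qed
  have "(a > 0 \<longrightarrow> of_nat p * contraction_sum p E \<tau> =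
      of_nat (4 ^ a * fact a * 2 ^ b * insertion_count (2 * a - p div 2) b) * fps_nth (point_fps p) a) \<and>
    (a = 0 \<longrightarrow> contraction_sum p E \<tau> = (if b = 1 \<and> p = 2 then 1 else 0))"
    using E t c a b
  proof (induction b arbitrary: E \<tau>)
    case 0
    have "finite (cycles_of \<tau> E)" using 0(1) by (rule finite_cycles_of)
    then have "{c \<in> cycles_of \<tau> E. card c = 2} = {}" using 0(5) by simp
    then have all4: "\<forall>c\<in>cycles_of \<tau> E. card c = 4" using 0(3) by blast
    have cE: "card E = 4 * a" using card_E[OF 0(1,2)] 0(3,4,5) by simp
    have "contraction_sum p E \<tau> = 0" if "a = 0"
    proof -
      have "E = {}" using cE that 0(1) by simp
      then have "planars p E \<tau> = {}" using planar_ribbon_nonempty by (auto simp: planars_def)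
      then show ?thesis by (simp add: contraction_sum_def)
    qed
    moreover have "of_nat p * contraction_sum p E \<tau> = of_nat (4 ^ a * fact a) * fps_nth (point_fps p) a"
      using contraction_sum_quartic[OF 0(1) cE _ p] 0(2) all4 by blast
    ultimately show ?case by (simp add: insertion_count_def)
  next
    case (Suc b)
    note fin = Suc.prems(1) and t = Suc.prems(2)
    obtain w where w: "w \<in> cycles_of \<tau> E" "card w = 2"
      using Suc.prems(5) by (metis (mono_tags, lifting) card.empty empty_Collect_eq nat.distinct(1))
    then obtain x where x: "x \<in> E" "w = orbit \<tau> x" by (auto simp: cycles_of_def)
    define y where "y = \<tau> x"
    have wxy: "w = {x, y}" "\<tau> y = x" using orbit_card_2[OF t fin, of x] w x by (simp_all add: y_def)
    have xy: "x \<noteq> y" using w(2) wxy by auto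
    let ?E = "E - w"
    let ?\<tau> = "perm_restrict \<tau> ?E"
    have yE: "y \<in> E" using x t by (simp add: y_def permutes_in_image)
    have E: "E = insert x (insert y ?E)" using wxy x yE by auto
    have cyc: "cycles_of ?\<tau> ?E = cycles_of \<tau> E - {w}" by (rule cycles_of_Diff_cycle[OF t fin w(1)])
    have fc: "finite (cycles_of \<tau> E)" by (rule finite_cycles_of[OF fin])
    have t': "?\<tau> permutes ?E" by (rule perm_restrict_Diff_cycle[OF t fin w(1)])
    have c': "card c = 4 \<or> card c = 2" if "c \<in> cycles_of ?\<tau> ?E" for c
      using that Suc.prems(3) by (simp add: cyc)
    have "{c \<in> cycles_of ?\<tau> ?E. card c = 4} = {c \<in> cycles_of \<tau> E. card c = 4}"
      using w(2) by (auto simp: cyc)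
    then have a': "card {c \<in> cycles_of ?\<tau> ?E. card c = 4} = a" using Suc.prems(4) by simp
    have "{c \<in> cycles_of ?\<tau> ?E. card c = 2} = {c \<in> cycles_of \<tau> E. card c = 2} - {w}"
      by (auto simp: cyc)
    then have b': "card {c \<in> cycles_of ?\<tau> ?E. card c = 2} = b"
      using Suc.prems(5) w fc by (simp add: card_Diff_singleton)
    have cE': "card ?E = 4 * a + 2 * b" using card_E[OF _ t'] fin c' a' b' by simp
    note IH = Suc.IH[OF _ t' c' a' b']
    \<comment> \<open>The removal step requires something to be left; if nothing is, the graph was a
      single bigon.\<close>
    show ?case
    proof (cases "?E = {}")
      case True
      have "a = 0" "b = 0" using cE' unfolding True by simp_all
      moreover have Exy: "E = {x, y}" using E unfolding True .
      have "\<tau> permutes {x, y}" using t unfolding Exy .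
      then have "contraction_sum p {x, y} \<tau> = (if p = 2 then 1 else 0)"
        using xy y_def wxy(2) p by (intro contraction_sum_bigon) simp_all
      then have "contraction_sum p E \<tau> = (if p = 2 then 1 else 0)" unfolding Exy .
      ultimately show ?thesis by simp
    next
      case False
      have "contraction_sum p E \<tau> = of_nat (card ?E - p) * contraction_sum p ?E ?\<tau>"
      proof -
        have "\<tau> permutes insert x (insert y ?E)" using t by (subst E[symmetric])
        then have "(\<Sum>K\<in>planars p (insert x (insert y ?E)) \<tau>. graph_elem (delete_bivalent K)) =
            of_nat (card ?E - p) * (\<Sum>K\<in>planars p ?E ?\<tau>. graph_elem (delete_bivalent K))"
          using fin xy wxy y_def False by (intro sum_planars_bivalent) simp_all
        moreover have "planars p E \<tau> = planars p (insert x (insert y ?E)) \<tau>"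
          by (rule arg_cong[OF E])
        ultimately show ?thesis unfolding contraction_sum_def by (simp only:)
      qed
      then have step: "contraction_sum p E \<tau> = of_nat (4 * a + 2 * b - p) * contraction_sum p ?E ?\<tau>"
        using cE' by simp
      have "contraction_sum p E \<tau> = 0" if "a = 0"
      \<comment> \<open>A lone bigon has two half edges, both external, hence no internal edge on
        which a second one could sit: the factor is \<open>2 - 2\<close>. In all other cases the
        smaller sum is already zero.\<close>
      proof (cases "b = 1 \<and> p = 2")
        case True then show ?thesis using step that by simp
      next
        case F: False
        then show ?thesis using step IH that fin by simp
      qed
      moreover have "Suc b \<noteq> 1" if "a = 0" using cE' False that fin by auto
      moreover have "of_nat p * contraction_sum p E \<tau> =
          of_nat (4 ^ a * fact a * 2 ^ Suc b * insertion_count (2 * a - p div 2) (Suc b)) * fps_nth (point_fps p) a"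
        if "a > 0"
      proof -
        \<comment> \<open>Twice the number of internal edges of a graph with \<open>a\<close>
          quartic and \<open>b\<close> bivalent vertices.\<close>
        have "4 * a + 2 * b - p = 2 * (2 * a - p div 2 + b)" using that p by auto
        then have "of_nat p * contraction_sum p E \<tau> =
            of_nat (2 * (2 * a - p div 2 + b)) * (of_nat p * contraction_sum p ?E ?\<tau>)"
          using step by (simp only: mult_ac)
        also have "of_nat p * contraction_sum p ?E ?\<tau> =
            of_nat (4 ^ a * fact a * 2 ^ b * insertion_count (2 * a - p div 2) b) * fps_nth (point_fps p) a"
          using IH that fin by blast
        also have "of_nat (2 * (2 * a - p div 2 + b)) * (of_nat (4 ^ a * fact a * 2 ^ b *
              insertion_count (2 * a - p div 2) b) * fps_nth (point_fps p) a) =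
            of_nat ((2 * (2 * a - p div 2 + b)) * (4 ^ a * fact a * 2 ^ b *
              insertion_count (2 * a - p div 2) b)) * fps_nth (point_fps p) a"
          by (simp only: of_nat_mult mult.assoc)
        also have "(2 * (2 * a - p div 2 + b)) * (4 ^ a * fact a * 2 ^ b * insertion_count (2 * a - p div 2) b) =
            4 ^ a * fact a * 2 ^ Suc b * insertion_count (2 * a - p div 2) (Suc b)"
          by (simp add: insertion_count_def mult_ac)
        finally show ?thesis .
      qed
      ultimately show ?thesis by (cases "a = 0") simp_all
    qed
  qed
  then show "a > 0 \<Longrightarrow> of_nat p * contraction_sum p E \<tau> =
      of_nat (4 ^ a * fact a * 2 ^ b * insertion_count (2 * a - p div 2) b) * fps_nth (point_fps p) a"
    and "a = 0 \<Longrightarrow> contraction_sum p E \<tau> = (if b = 1 \<and> p = 2 then 1 else 0)" by blast+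
qed

section \<open>The polynomials \<open>Q\<^sup>v\<close> and \<open>Q\<^sup>e\<close>\<close>

text \<open>A power of a series sums over the ways to distribute the order among its factors; the
  induction splits off the last index.\<close>

lemma Q_v_eq: "Q_v k j = fps_nth (vertex_fps ^ k) j"
proof (induction k arbitrary: j)
  case 0
  \<comment> \<open>Over the empty index set \<open>PiE\<close> has the single element
    \<open>\<lambda>_. undefined\<close>, which accounts for the unit.\<close>
  have "{l :: nat \<Rightarrow> nat. l \<in> {1..0} \<rightarrow>\<^sub>E UNIV \<and> (\<Sum>i=1..0. l i) = j} = (if j = 0 then {\<lambda>_. undefined} else {})"
    by auto
  then show ?case by (simp add: Q_v_def)
next
  case (Suc k)
  let ?L = "\<lambda>k j. {l :: nat \<Rightarrow> nat. l \<in> {1..k} \<rightarrow>\<^sub>E UNIV \<and> (\<Sum>i=1..k. l i) = j}"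
  have I: "{1..Suc k} = insert (Suc k) {1..k}" by auto
  have fin: "finite (?L k j)" for j
  proof (rule finite_subset)
    show "?L k j \<subseteq> {1..k} \<rightarrow>\<^sub>E {..j}"
    proof
      fix l assume l: "l \<in> ?L k j"
      have "l i \<le> j" if "i \<in> {1..k}" for i
        using l member_le_sum[of i "{1..k}" l] that by auto
      then show "l \<in> {1..k} \<rightarrow>\<^sub>E {..j}" using l by (auto simp: PiE_iff)
    qed
  qed (auto intro: finite_PiE)
  have upd: "(\<Sum>i=1..k. (l(Suc k := x)) i) = (\<Sum>i=1..k. l i)"
    "(\<Prod>i=1..k. c_v ((l(Suc k := x)) i)) = (\<Prod>i=1..k. c_v (l i))" for l :: "nat \<Rightarrow> nat" and x
    by (auto intro!: sum.cong prod.cong)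
  have "Q_v (Suc k) j = (\<Sum>(i, l)\<in>(SIGMA i:{0..j}. ?L k (j - i)). c_v i * (\<Prod>i=1..k. c_v (l i)))"
    unfolding Q_v_def
  proof (rule sum.reindex_bij_witness[of _ "\<lambda>(i, l). l(Suc k := i)" "\<lambda>l. (l (Suc k), l(Suc k := undefined))"])
    fix l assume l: "l \<in> ?L (Suc k) j"
    then have s: "l (Suc k) + (\<Sum>i=1..k. l i) = j" by (simp add: I)
    have "l(Suc k := undefined) \<in> {1..k} \<rightarrow>\<^sub>E UNIV" using l by (auto simp: PiE_iff extensional_def)
    then show "(l (Suc k), l(Suc k := undefined)) \<in> (SIGMA i:{0..j}. ?L k (j - i))"
      using s upd(1)[of l undefined] by auto
    show "(case (l (Suc k), l(Suc k := undefined)) of (i, l) \<Rightarrow> c_v i * (\<Prod>i=1..k. c_v (l i))) =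
        (\<Prod>i=1..Suc k. c_v (l i))"
      using upd(2)[of l undefined] by (simp add: I)
  next
    fix b assume b: "b \<in> (SIGMA i:{0..j}. ?L k (j - i))"
    obtain i l where il: "b = (i, l)" by force
    then have l: "l \<in> {1..k} \<rightarrow>\<^sub>E UNIV" "(\<Sum>i=1..k. l i) = j - i" "i \<le> j" using b by auto
    have "l (Suc k) = undefined" using l(1) by (auto simp: PiE_iff extensional_def)
    then show "((case b of (i, l) \<Rightarrow> l(Suc k := i)) (Suc k), (case b of (i, l) \<Rightarrow> l(Suc k := i))(Suc k := undefined)) = b"
      by (auto simp: il fun_upd_idem)
    have "l(Suc k := i) \<in> {1..Suc k} \<rightarrow>\<^sub>E UNIV" using l(1) by (auto simp: PiE_iff extensional_def)
    then show "(case b of (i, l) \<Rightarrow> l(Suc k := i)) \<in> ?L (Suc k) j"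
      using l upd(1)[of l i] by (simp add: il I)
  qed auto
  also have "\<dots> = (\<Sum>i=0..j. \<Sum>l\<in>?L k (j - i). c_v i * (\<Prod>i=1..k. c_v (l i)))"
    using fin by (subst sum.Sigma) auto
  also have "\<dots> = (\<Sum>i=0..j. c_v i * Q_v k (j - i))"
    by (simp add: Q_v_def sum_distrib_left)
  finally show ?case by (simp add: fps_mult_nth Suc vertex_fps_def)
qed

lemma fps_power_nth_cong:
  fixes f g :: "'a::comm_ring_1 fps"
  assumes "\<And>i. i \<le> j \<Longrightarrow> fps_nth f i = fps_nth g i"
  shows "i \<le> j \<Longrightarrow> fps_nth (f ^ b) i = fps_nth (g ^ b) i"
proof (induction b arbitrary: i)
  case (Suc b)
  then show ?case using assms by (auto simp: fps_mult_nth intro!: sum.cong)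
qed simp

lemma scalar_mult: "scalar q * scalar r = scalar (q * r)"
  by (simp add: mult_single)

definition exponents :: "nat \<Rightarrow> nat \<Rightarrow> (nat \<Rightarrow> nat) set" where
  "exponents m j = {s. s \<in> {1..m} \<rightarrow>\<^sub>E UNIV \<and> (\<Sum>i=1..m. i * s i) = j}"

lemma exponents_le: "s \<in> exponents m j \<Longrightarrow> i \<in> {1..m} \<Longrightarrow> s i \<le> j"
proof -
  assume s: "s \<in> exponents m j" and i: "i \<in> {1..m}"
  have "i * s i \<le> (\<Sum>i=1..m. i * s i)" using i by (intro member_le_sum) auto
  moreover have "s i \<le> i * s i" using i by (cases i) simp_all
  moreover have "(\<Sum>i=1..m. i * s i) = j" using s by (simp add: exponents_def)
  ultimately show ?thesis by linarith
qed

lemma finite_exponents: "finite (exponents m j)"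
proof (rule finite_subset)
  show "exponents m j \<subseteq> {1..m} \<rightarrow>\<^sub>E {..j}"
  proof
    fix s assume s: "s \<in> exponents m j"
    then have "s \<in> {1..m} \<rightarrow>\<^sub>E UNIV" by (simp add: exponents_def)
    then show "s \<in> {1..m} \<rightarrow>\<^sub>E {..j}" using exponents_le[OF s] by (auto simp: PiE_iff)
  qed
qed (auto intro: finite_PiE)

text \<open>The multinomial theorem sorted by total weight. The binomial theorem splits off the last
  variable, and \<open>b choose r\<close> times the smaller multinomial coefficient, divided by the
  matching factorials, is the larger one.\<close>

lemma multinomial_fps:
  fixes c :: "nat \<Rightarrow> hck"
  shows "fps_nth ((\<Sum>i=1..m. fps_const (c i) * fps_X ^ i) ^ b) j =
    (\<Sum>s | s \<in> exponents m j \<and> (\<Sum>i=1..m. s i) = b.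
       scalar (fact b / (\<Prod>i=1..m. fact (s i))) * (\<Prod>i=1..m. c i ^ s i))"
proof (induction m arbitrary: b j)
  case 0
  have "{s. s \<in> exponents 0 j \<and> (\<Sum>i=1..0. s i) = b} = (if j = 0 \<and> b = 0 then {\<lambda>_. undefined} else {})"
    by (auto simp: exponents_def)
  then show ?case by (cases b) simp_all
next
  case (Suc m)
  let ?f = "\<Sum>i=1..m. fps_const (c i) * fps_X ^ i"
  let ?S = "\<lambda>m b j. {s. s \<in> exponents m j \<and> (\<Sum>i=1..m. s i) = b}"
  let ?t = "\<lambda>m b s. scalar (fact b / (\<Prod>i=1..m. fact (s i))) * (\<Prod>i=1..m. c i ^ s i)"
  let ?R = "{r \<in> {0..b}. Suc m * r \<le> j}"
  have I: "{1..Suc m} = insert (Suc m) {1..m}" by auto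
  have "fps_nth ((\<Sum>i=1..Suc m. fps_const (c i) * fps_X ^ i) ^ b) j =
      fps_nth ((fps_const (c (Suc m)) * fps_X ^ Suc m + ?f) ^ b) j" by (simp add: add.commute)
  also have "\<dots> = (\<Sum>r\<le>b. fps_nth (of_nat (b choose r) * (fps_const (c (Suc m)) * fps_X ^ Suc m) ^ r * ?f ^ (b - r)) j)"
    by (simp add: binomial_ring fps_sum_nth)
  also have "\<dots> = (\<Sum>r\<in>{0..b}. if Suc m * r \<le> j then
      of_nat (b choose r) * c (Suc m) ^ r * fps_nth (?f ^ (b - r)) (j - Suc m * r) else 0)"
  proof (rule sum.cong)
    fix r assume "r \<in> {0..b}"
    have "of_nat (b choose r) * (fps_const (c (Suc m)) * fps_X ^ Suc m) ^ r * ?f ^ (b - r) =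
        fps_const (of_nat (b choose r) * c (Suc m) ^ r) * (fps_X ^ (Suc m * r) * ?f ^ (b - r))"
      by (simp only: power_mult_distrib fps_const_power power_mult[symmetric] fps_of_nat[symmetric]
          fps_const_mult[symmetric] mult_ac)
    then show "fps_nth (of_nat (b choose r) * (fps_const (c (Suc m)) * fps_X ^ Suc m) ^ r * ?f ^ (b - r)) j =
        (if Suc m * r \<le> j then of_nat (b choose r) * c (Suc m) ^ r * fps_nth (?f ^ (b - r)) (j - Suc m * r) else 0)"
      by (simp only: fps_mult_left_const_nth fps_X_power_mult_nth) auto
  qed (auto simp: atMost_atLeast0)
  also have "\<dots> = (\<Sum>r\<in>?R. of_nat (b choose r) * c (Suc m) ^ r * fps_nth (?f ^ (b - r)) (j - Suc m * r))"
    by (rule sum.inter_filter[symmetric]) simp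
  also have "\<dots> = (\<Sum>r\<in>?R. \<Sum>s\<in>?S m (b - r) (j - Suc m * r). of_nat (b choose r) * c (Suc m) ^ r * ?t m (b - r) s)"
    by (simp only: Suc.IH sum_distrib_left)
  also have "\<dots> = (\<Sum>(r, s)\<in>(SIGMA r:?R. ?S m (b - r) (j - Suc m * r)). of_nat (b choose r) * c (Suc m) ^ r * ?t m (b - r) s)"
    using finite_exponents by (subst sum.Sigma) auto
  also have "\<dots> = (\<Sum>s\<in>?S (Suc m) b j. ?t (Suc m) b s)"
  proof (rule sum.reindex_bij_witness[of _ "\<lambda>s. (s (Suc m), s(Suc m := undefined))" "\<lambda>(r, s). s(Suc m := r)"])
    have upd: "(\<Sum>i=1..m. (s(Suc m := x)) i) = (\<Sum>i=1..m. s i)"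
      "(\<Sum>i=1..m. i * (s(Suc m := x)) i) = (\<Sum>i=1..m. i * s i)"
      "(\<Prod>i=1..m. fact ((s(Suc m := x)) i) :: rat) = (\<Prod>i=1..m. fact (s i))"
      "(\<Prod>i=1..m. c i ^ ((s(Suc m := x)) i)) = (\<Prod>i=1..m. c i ^ s i)" for s :: "nat \<Rightarrow> nat" and x
      by (auto intro!: sum.cong prod.cong)
    {
      fix s assume s: "s \<in> ?S (Suc m) b j"
      then have s': "Suc m * s (Suc m) + (\<Sum>i=1..m. i * s i) = j" "s (Suc m) + (\<Sum>i=1..m. s i) = b"
        by (auto simp: exponents_def I)
      have "s(Suc m := undefined) \<in> {1..m} \<rightarrow>\<^sub>E UNIV"
        using s by (auto simp: exponents_def PiE_iff extensional_def)
      then show "(s (Suc m), s(Suc m := undefined)) \<in> (SIGMA r:?R. ?S m (b - r) (j - Suc m * r))"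
        using s' upd(1,2)[of s undefined] by (auto simp: exponents_def)
      show "(case (s (Suc m), s(Suc m := undefined)) of (r, s) \<Rightarrow> s(Suc m := r)) = s" by simp
    }
    fix x assume x: "x \<in> (SIGMA r:?R. ?S m (b - r) (j - Suc m * r))"
    obtain r s where rs: "x = (r, s)" by force
    then have r: "r \<le> b" "Suc m * r \<le> j" and s: "s \<in> {1..m} \<rightarrow>\<^sub>E UNIV"
      "(\<Sum>i=1..m. i * s i) = j - Suc m * r" "(\<Sum>i=1..m. s i) = b - r"
      using x by (auto simp: exponents_def)
    have "s (Suc m) = undefined" using s(1) by (auto simp: PiE_iff extensional_def)
    then show "((case x of (r, s) \<Rightarrow> s(Suc m := r)) (Suc m), (case x of (r, s) \<Rightarrow> s(Suc m := r))(Suc m := undefined)) = x"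
      by (auto simp: rs fun_upd_idem)
    have "s(Suc m := r) \<in> {1..Suc m} \<rightarrow>\<^sub>E UNIV" using s(1) by (auto simp: PiE_iff extensional_def)
    then show "(case x of (r, s) \<Rightarrow> s(Suc m := r)) \<in> ?S (Suc m) b j"
      using s r upd(1,2)[of s r] by (simp add: rs I exponents_def)
    have "?t (Suc m) b (s(Suc m := r)) = scalar (fact b / (fact r * (\<Prod>i=1..m. fact (s i)))) *
        (c (Suc m) ^ r * (\<Prod>i=1..m. c i ^ s i))"
      using upd(3,4)[of s r] by (simp add: mult.commute)
    also have "fact b / (fact r * (\<Prod>i=1..m. fact (s i))) =
        (of_nat (b choose r) * (fact (b - r) / (\<Prod>i=1..m. fact (s i))) :: rat)"
      using binomial_fact[OF r(1), where 'a = rat] by (simp add: field_simps)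
    also have "scalar \<dots> = of_nat (b choose r) * scalar (fact (b - r) / (\<Prod>i=1..m. fact (s i)))"
      by (simp only: scalar_mult[symmetric] single_of_nat)
    finally show "?t (Suc m) b (case x of (r, s) \<Rightarrow> s(Suc m := r)) =
        (case x of (r, s) \<Rightarrow> of_nat (b choose r) * c (Suc m) ^ r * ?t m (b - r) s)"
      by (simp add: rs mult_ac)
  qed
  finally show ?case .
qed

text \<open>As \<open>insertion_count k b / b!\<close> is the binomial coefficient
  \<open>(k + b - 1 choose b)\<close>, for \<open>k = 0\<close> read as 1 at \<open>b = 0\<close>
  and 0 otherwise, this is the coefficient of order \<open>m\<close> in
  \<open>(1 - edge_fps)^(-k)\<close>: each of \<open>k\<close> edges is replaced by a chain of
  2-point graphs. Stopping at \<open>b = m\<close> loses nothing by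
  \<open>edge_fps_power_nth_0\<close>.\<close>

definition edge_sum :: "nat \<Rightarrow> nat \<Rightarrow> hck" where
  "edge_sum k m = (\<Sum>b\<le>m. scalar (of_nat (insertion_count k b) / fact b) * fps_nth (edge_fps ^ b) m)"

lemma edge_fps_power_nth_0: "m < b \<Longrightarrow> fps_nth (edge_fps ^ b) m = 0"
proof (induction b arbitrary: m)
  case (Suc b)
  have "fps_nth edge_fps i * fps_nth (edge_fps ^ b) (m - i) = 0" if "i \<in> {0..m}" for i
  proof (cases "i = 0")
    case False
    then show ?thesis using Suc that by (subst Suc.IH) auto
  qed (simp add: edge_fps_def)
  then show ?case by (simp add: fps_mult_nth)
qed simp

lemma edge_sum_eq:
  "m \<le> M \<Longrightarrow> edge_sum k m = (\<Sum>b\<le>M. scalar (of_nat (insertion_count k b) / fact b) * fps_nth (edge_fps ^ b) m)"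
  unfolding edge_sum_def by (rule sum.mono_neutral_left) (auto simp: edge_fps_power_nth_0)

lemma insertion_count_fact: "k > 0 \<Longrightarrow> insertion_count k b * fact (k - 1) = fact (b + k - 1)"
proof (induction b)
  case (Suc b)
  have "fact (Suc b + k - 1) = (k + b) * fact (b + k - 1)"
    using Suc.prems by (cases k) (simp_all add: add.commute)
  then show ?case using Suc by (simp add: insertion_count_def mult_ac)
qed (simp add: insertion_count_def)

text \<open>Exponent vectors are grouped by their total \<open>b\<close>. The quotient of factorials
  is \<open>insertion_count k b / b!\<close> times a multinomial coefficient, and the multinomial
  terms add up to a coefficient of the \<open>b\<close>-th power.\<close>

lemma Q_e_eq:
  assumes k: "k > 0" shows "Q_e k j = edge_sum k j"
proof -
  let ?m = "\<lambda>s. \<Sum>i=1..j. s i :: nat"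
  let ?f = "\<Sum>i=1..j. fps_const (c_e i) * fps_X ^ i"
  \<comment> \<open>Only coefficients up to order \<open>j\<close> matter, so the series may be cut
    down to a polynomial.\<close>
  have coeff: "fps_nth (edge_fps ^ b) j = fps_nth (?f ^ b) j" for b
  proof (rule fps_power_nth_cong[OF _ order.refl])
    fix i assume "i \<le> j"
    have fi: "fps_nth ?f i = (\<Sum>i'=1..j. if i = i' then c_e i' else 0)"
      unfolding fps_sum_nth by (rule sum.cong[OF refl]) auto
    then show "fps_nth edge_fps i = fps_nth ?f i"
      unfolding fi using \<open>i \<le> j\<close> by (auto simp: edge_fps_def)
  qed
  have bound: "?m s \<le> j" if "s \<in> exponents j j" for s
  proof -
    have "?m s \<le> (\<Sum>i=1..j. i * s i)" by (rule sum_mono) simp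
    then show ?thesis using that by (simp add: exponents_def)
  qed
  have "Q_e k j = (\<Sum>s\<in>exponents j j. scalar (fact (?m s + k - 1) / ((\<Prod>i=1..j. fact (s i)) * fact (k - 1)))
       * (\<Prod>i=1..j. c_e i ^ s i))"
    by (simp add: Q_e_def exponents_def)
  also have "\<dots> = (\<Sum>b\<in>{..j}. \<Sum>s | s \<in> exponents j j \<and> ?m s = b.
       scalar (fact (?m s + k - 1) / ((\<Prod>i=1..j. fact (s i)) * fact (k - 1))) * (\<Prod>i=1..j. c_e i ^ s i))"
    using finite_exponents bound by (intro sum.group[symmetric]) auto
  also have "\<dots> = (\<Sum>b\<in>{..j}. scalar (of_nat (insertion_count k b) / fact b) * fps_nth (?f ^ b) j)"
  proof (rule sum.cong[OF refl])
    fix b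
    have "scalar (fact (?m s + k - 1) / ((\<Prod>i=1..j. fact (s i)) * fact (k - 1))) =
        scalar (of_nat (insertion_count k b) / fact b) * scalar (fact b / (\<Prod>i=1..j. fact (s i)))"
      if "?m s = b" for s
    proof -
      have "(of_nat (fact (b + k - 1)) :: rat) = of_nat (insertion_count k b * fact (k - 1))"
        by (simp only: insertion_count_fact[OF k])
      then have "fact (b + k - 1) = (of_nat (insertion_count k b) * fact (k - 1) :: rat)"
        by (simp only: of_nat_mult of_nat_fact)
      then show ?thesis unfolding that scalar_mult by (simp add: field_simps)
    qed
    then show "(\<Sum>s | s \<in> exponents j j \<and> ?m s = b.
       scalar (fact (?m s + k - 1) / ((\<Prod>i=1..j. fact (s i)) * fact (k - 1))) * (\<Prod>i=1..j. c_e i ^ s i)) =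
       scalar (of_nat (insertion_count k b) / fact b) * fps_nth (?f ^ b) j"
      unfolding multinomial_fps sum_distrib_left by (intro sum.cong refl) (auto simp: mult.assoc)
  qed
  finally show ?thesis by (simp add: edge_sum_def coeff)
qed

text \<open>With no edge to insert into only \<open>b = 0\<close> survives. This makes
  \<open>P_v n n = c_v n\<close> an instance of the general formula.\<close>

lemma edge_sum_0_left: "edge_sum 0 m = (if m = 0 then 1 else 0)"
proof -
  have "edge_sum 0 m = (\<Sum>b\<in>{..m}. if b = 0 then fps_nth 1 m else 0)"
    unfolding edge_sum_def
  proof (rule sum.cong[OF refl])
    fix b
    have "insertion_count 0 b = (if b = 0 then 1 else 0)"
      by (cases b) (auto simp: insertion_count_def prod.lessThan_Suc_shift)
    then show "scalar (of_nat (insertion_count 0 b) / fact b) * fps_nth (edge_fps ^ b) m =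
        (if b = 0 then fps_nth 1 m else 0)" by simp
  qed
  then show ?thesis by simp
qed

lemma edge_sum_0_right: "edge_sum k 0 = 1"
  by (simp add: edge_sum_def insertion_count_def)

section \<open>The coproduct\<close>

lemma labelled_representative:
  assumes "L \<in> labelled_graphs p n"
  shows "generating_graph p (fst (SOME x. x \<in> L))" "loop_number (fst (SOME x. x \<in> L)) = n"
proof -
  obtain G h where G: "generating_graph p G" "loop_number G = n" "h \<in> external G" "L = labelled_class G h"
    using assms by (auto simp: labelled_graphs_def)
  have R: "ribbon_graph G" using G by (simp add: generating_graph_def)
  have h: "h \<in> half_edges G" using G by (simp add: external_def)
  have L: "L = {(relabel F G, F h) | F. bij F}" unfolding G(4) by (rule labelled_class_eq[OF R h])
  have "(relabel id G, id h) \<in> L" unfolding L using bij_id by blast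
  then have "(SOME x. x \<in> L) \<in> L" by (rule someI)
  then show "generating_graph p (fst (SOME x. x \<in> L))" "loop_number (fst (SOME x. x \<in> L)) = n"
    unfolding L using R G by (auto simp: generating_relabel loop_number_relabel)
qed

lemma lookup_coproduct_labelled_sum:
  assumes p: "p = 2 \<or> p = 4"
  shows "Poly_Mapping.lookup (\<Delta> (labelled_sum p n)) k =
    (\<Sum>L\<in>labelled_graphs p n. Poly_Mapping.lookup (coproduct_graph (fst (SOME x. x \<in> L))) k)"
proof -
  let ?r = "\<lambda>L :: (nat ribbon \<times> nat) set. fst (SOME x. x \<in> L)"
  have gen: "is_generator (?r L)" if "L \<in> labelled_graphs p n" for L
    using labelled_representative(1)[OF that] p by (auto simp: is_generator_def)
  have "labelled_sum p n = (\<Sum>L\<in>labelled_graphs p n. Poly_Mapping.single {#generator_of (?r L)#} 1)"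
    unfolding labelled_sum_def by (rule sum.cong[OF refl]) (rule graph_elem_generator[OF gen])
  moreover have "Poly_Mapping.lookup (\<Delta> (\<Sum>L\<in>labelled_graphs p n. Poly_Mapping.single {#generator_of (?r L)#} 1)) k =
    (\<Sum>L\<in>labelled_graphs p n. Poly_Mapping.lookup (coproduct_graph (monomial_graph {#generator_of (?r L)#})) k)"
    \<comment> \<open>Over an infinite index set all sums are 0 by convention, and the coproduct of
      0 is 0.\<close>
    by (cases "finite (labelled_graphs p n)", rule lookup_coproduct_sum, assumption)
      (simp add: coproduct_def)
  ultimately show ?thesis by (simp add: coproduct_graph_monomial_graph[OF gen])
qed

context generator_union
begin

lemma generator_components_cases:
  assumes "C \<in> components H"
  shows "C \<in> generator_components 4 H \<or> C \<in> generator_components 2 H"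
  using gen[OF assms] assms by (auto simp: generator_components_def is_generator_def)

text \<open>The number of external half edges distinguishes the two types of components, and it is
  also the length of the corresponding cycle of \<open>\<tau>\<close>.\<close>

lemma card_Int_E:
  assumes C: "C \<in> components H" and q: "q = 2 \<or> q = 4"
  shows "card (C \<inter> E) = q \<longleftrightarrow> C \<in> generator_components q H"
proof -
  obtain r where r: "generating_graph r (component_graph H C)" "r = 2 \<or> r = 4"
    using gen[OF C] by (auto simp: is_generator_def)
  have "card (external (component_graph H C)) = r"
    using r(1) by (simp add: generating_graph_iff planar_ribbon_def)
  then have "card (C \<inter> E) = r"
    by (simp add: external_component_graph[OF H component_closed[OF H C]] Int_commute)
  moreover have "C \<in> generator_components q H \<longleftrightarrow> r = q"
    using r(1) C generating_graph_unique[of r "component_graph H C" q] by (auto simp: generator_components_def)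
  ultimately show ?thesis by simp
qed

lemma card_tau_cycles:
  assumes q: "q = 2 \<or> q = 4"
  shows "card {c \<in> cycles_of \<tau> E. card c = q} = card (generator_components q H)"
proof -
  have "bij_betw (\<lambda>C. C \<inter> E) (generator_components q H) {c \<in> cycles_of \<tau> E. card c = q}"
  proof (rule bij_betw_subset[OF bij_betw_components_cycles])
    show "generator_components q H \<subseteq> components H" by (auto simp: generator_components_def)
    have "{c \<in> cycles_of \<tau> E. card c = q} = (\<lambda>C. C \<inter> E) ` {C \<in> components H. card (C \<inter> E) = q}"
      unfolding bij_betw_imp_surj_on[OF bij_betw_components_cycles, symmetric] by blast
    also have "{C \<in> components H. card (C \<inter> E) = q} = generator_components q H"
      using card_Int_E[OF _ q] by (auto simp: generator_components_def)
    finally show "(\<lambda>C. C \<inter> E) ` generator_components q H = {c \<in> cycles_of \<tau> E. card c = q}" by (rule sym)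
  qed
  from bij_betw_same_card[OF this] show ?thesis by (rule sym)
qed

lemma tau_cycle_card: "c \<in> cycles_of \<tau> E \<Longrightarrow> card c = 4 \<or> card c = 2"
  using card_Int_E[of _ 4] card_Int_E[of _ 2] generator_components_cases
  unfolding bij_betw_imp_surj_on[OF bij_betw_components_cycles, symmetric] by auto

lemma vertex_card: "w \<in> vertices H \<Longrightarrow> card w = 4"
proof -
  assume "w \<in> vertices H"
  then obtain x where x: "x \<in> X" "w = orbit (vrot H) x" by (auto simp: vertices_def cycles_of_def)
  then obtain C where C: "C \<in> components H" "x \<in> C" using component_ex[OF H] by blast
  have "w \<in> vertices (component_graph H C)"
    unfolding vertices_component_graph[OF H component_closed[OF H C(1)]] using x C by (auto simp: cycles_of_def)
  then show "card w = 4" using gen[OF C(1)] by (auto simp: is_generator_def generating_graph_iff)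
qed

end

text \<open>The two sums are exchanged: the subgraph is chosen first, then the graph containing it.\<close>

lemma sum_coproduct_graphs:
  assumes X: "finite X"
  shows "(\<Sum>G\<in>generating_graphs p X. Poly_Mapping.lookup (coproduct_graph G) (s, t)) =
    (\<Sum>H | all_generators H \<and> half_edges H = X. Poly_Mapping.lookup (graph_elem H) s *
       Poly_Mapping.lookup (contraction_sum p (external H) (delete_outside (flip H \<circ> vrot H) (external H))) t)"
proof -
  let ?A = "{H :: nat ribbon. all_generators H \<and> half_edges H = X}"
  let ?f = "\<lambda>G H. Poly_Mapping.lookup (graph_elem H) s *
      Poly_Mapping.lookup (graph_elem (delete_bivalent (contract G H))) t"
  have finA: "finite ?A"
    by (rule finite_subset[OF _ finite_ribbon_graphs[OF X]]) (auto simp: all_generators_def)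
  have "(\<Sum>G\<in>generating_graphs p X. Poly_Mapping.lookup (coproduct_graph G) (s, t)) =
      (\<Sum>G\<in>generating_graphs p X. \<Sum>H\<in>{H \<in> ?A. subribbon H G}. ?f G H)"
  proof (rule sum.cong[OF refl])
    fix G assume "G \<in> generating_graphs p X"
    then have "half_edges G = X" by (simp add: generating_graphs_def)
    then have "{H. subribbon H G \<and> all_generators H} = {H \<in> ?A. subribbon H G}"
      by (auto simp: subribbon_def)
    then show "Poly_Mapping.lookup (coproduct_graph G) (s, t) = (\<Sum>H\<in>{H \<in> ?A. subribbon H G}. ?f G H)"
      by (simp add: coproduct_graph_def lookup_sum lookup_tensor)
  qed
  also have "\<dots> = (\<Sum>H\<in>?A. \<Sum>G\<in>{G \<in> generating_graphs p X. subribbon H G}. ?f G H)"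
    by (rule sum.swap_restrict[OF finite_generating_graphs[OF X] finA])
  also have "\<dots> = (\<Sum>H\<in>?A. Poly_Mapping.lookup (graph_elem H) s *
       Poly_Mapping.lookup (contraction_sum p (external H) (delete_outside (flip H \<circ> vrot H) (external H))) t)"
  proof (rule sum.cong[OF refl])
    fix H assume HA: "H \<in> ?A"
    interpret generator_union H using HA by unfold_locales simp
    \<comment> \<open>\<open>G\<close> has the rotation of \<open>H\<close>, so its vertices have
      degree 4 and planarity makes it a generating graph.\<close>
    have "planar_ribbon p G \<and> subribbon H G \<longrightarrow> generating_graph p G \<and> half_edges G = X" for G
      using vertex_card HA by (auto simp: generating_graph_iff subribbon_def vertices_def)
    then have "{G \<in> generating_graphs p X. subribbon H G} = {G. planar_ribbon p G \<and> subribbon H G}"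
      by (auto simp: generating_graphs_def generating_graph_iff)
    then have "(\<Sum>G\<in>{G \<in> generating_graphs p X. subribbon H G}. ?f G H) =
        Poly_Mapping.lookup (graph_elem H) s *
          (\<Sum>G\<in>{G. planar_ribbon p G \<and> subribbon H G}. Poly_Mapping.lookup (graph_elem (delete_bivalent (contract G H))) t)"
      by (simp add: sum_distrib_left)
    also have "(\<Sum>G\<in>{G. planar_ribbon p G \<and> subribbon H G}. Poly_Mapping.lookup (graph_elem (delete_bivalent (contract G H))) t) =
        (\<Sum>K\<in>planars p E \<tau>. Poly_Mapping.lookup (graph_elem (delete_bivalent K)) t)"
      unfolding planars_def by (rule sum.reindex_bij_betw[OF bij_betw_contract])
    finally show "(\<Sum>G\<in>{G \<in> generating_graphs p X. subribbon H G}. ?f G H) =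
      Poly_Mapping.lookup (graph_elem H) s * Poly_Mapping.lookup (contraction_sum p E \<tau>) t"
      by (simp add: contraction_sum_def lookup_sum)
  qed
  finally show ?thesis .
qed

text \<open>Of the \<open>V\<close> vertices \<open>a\<close> are spent on the factors
  \<open>fps_X\<close>; the rest is loop order, shared between the 4-point and the 2-point
  components.\<close>

lemma point_fps_mult_nth:
  "fps_nth (point_fps 4 ^ a * point_fps 2 ^ b) V =
    (if V < a then 0 else \<Sum>j=0..V - a. fps_nth (vertex_fps ^ a) j * fps_nth (edge_fps ^ b) (V - a - j))"
proof -
  have "point_fps 4 ^ a * point_fps 2 ^ b = fps_X ^ a * (vertex_fps ^ a * edge_fps ^ b)"
    by (simp add: point_fps_4 point_fps_2 power_mult_distrib mult.assoc)
  then show ?thesis by (simp only: fps_X_power_mult_nth) (simp add: fps_mult_nth)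
qed

text \<open>The coefficient of order \<open>m\<close> in
  \<open>vertex_fps^a (1 - edge_fps)^(-k)\<close>. With the right indices it is \<open>P_v\<close>
  or \<open>P_e\<close>, including the trivial cases that have \<open>a > 0\<close>.\<close>

definition insertion_sum :: "nat \<Rightarrow> nat \<Rightarrow> nat \<Rightarrow> hck" where
  "insertion_sum a k m = (\<Sum>j=0..m. fps_nth (vertex_fps ^ a) j * edge_sum k (m - j))"

lemma insertion_sum_eq:
  assumes "V \<le> M"
  shows "(\<Sum>b\<le>M. scalar (of_nat (insertion_count k b) / fact b) * fps_nth (point_fps 4 ^ a * point_fps 2 ^ b) V) =
    (if V < a then 0 else insertion_sum a k (V - a))"
proof (cases "V < a")
  case False
  have "(\<Sum>b\<le>M. scalar (of_nat (insertion_count k b) / fact b) * fps_nth (point_fps 4 ^ a * point_fps 2 ^ b) V) =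
      (\<Sum>j=0..V - a. \<Sum>b\<le>M. fps_nth (vertex_fps ^ a) j *
        (scalar (of_nat (insertion_count k b) / fact b) * fps_nth (edge_fps ^ b) (V - a - j)))"
    unfolding point_fps_mult_nth using False by (subst sum.swap) (simp add: sum_distrib_left mult_ac)
  also have "\<dots> = insertion_sum a k (V - a)"
    unfolding insertion_sum_def using assms False
    by (intro sum.cong refl) (simp add: sum_distrib_left[symmetric] edge_sum_eq[of _ M])
  finally show ?thesis using False by simp
qed (simp add: point_fps_mult_nth)

lemma lookup_scalar_mult: "Poly_Mapping.lookup (scalar q * x) m = q * Poly_Mapping.lookup x m"
  by (subst mult_map_scale_conv_mult[symmetric]) (rule lookup_scale)

text \<open>\<open>V\<close> is the number of vertices. After multiplication by
  \<open>(4 V)!\<close> the left side is a sum over all graphs on one fixed set. The weights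
  \<open>a! b! 4^a 2^b\<close> of the unions and \<open>4^a a! 2^b\<close> of the contractions
  cancel up to \<open>b!\<close>, and the sum over \<open>b\<close> produces
  \<open>insertion_sum\<close>.\<close>

lemma lookup_coproduct:
  assumes p: "p = 2 \<or> p = 4" and n: "n \<ge> 1" and V: "4 * V + 4 = 4 * n + 2 * p"
  shows "Poly_Mapping.lookup (\<Delta> (labelled_sum p n)) (s, t) =
    (\<Sum>a=1..V. Poly_Mapping.lookup (insertion_sum a (2 * a - p div 2) (V - a)) s *
       Poly_Mapping.lookup (fps_nth (point_fps p) a) t) +
    (if p = 2 then Poly_Mapping.lookup (c_e n) s * Poly_Mapping.lookup 1 t else 0)"
proof -
  define X where "X = {0..<4 * V}"
  \<comment> \<open>A crude bound for the numbers of components: there are at most as many as half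
    edges.\<close>
  define M where "M = 4 * V"
  have X: "finite X" "card X = 4 * V" by (simp_all add: X_def)
  let ?l = "Poly_Mapping.lookup"
  let ?A = "{H :: nat ribbon. all_generators H \<and> half_edges H = X}"
  let ?g = "\<lambda>H :: nat ribbon. (card (generator_components 4 H), card (generator_components 2 H))"
  \<comment> \<open>The value of \<open>p\<close> times the sum over contracted graphs, as a
    function of the two numbers of components; \<open>a = 0\<close> is the lone bigon.\<close>
  define cs where "cs = (\<lambda>(a, b). if a = 0 then (if b = 1 \<and> p = 2 then of_nat p * ?l 1 t else 0)
    else of_nat (4 ^ a * fact a * 2 ^ b * insertion_count (2 * a - p div 2) b) * ?l (fps_nth (point_fps p) a) t)"
  have finA: "finite ?A"
    by (rule finite_subset[OF _ finite_ribbon_graphs[OF X(1)]]) (auto simp: all_generators_def)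
  have cs: "of_nat p * ?l (contraction_sum p (external H) (delete_outside (flip H \<circ> vrot H) (external H))) t = cs (?g H)"
    if H: "H \<in> ?A" for H
  proof -
    interpret generator_union H using H by unfold_locales simp
    have finE: "finite E" using fin E_subset finite_subset by blast
    note c = contraction_sum_eq[OF p finE tau_permutes tau_cycle_card card_tau_cycles card_tau_cycles]
    show ?thesis
    proof (cases "card (generator_components 4 H) = 0")
      case True
      then show ?thesis using c(2) by (simp add: cs_def)
    next
      case False
      then have "?l (of_nat p * contraction_sum p E \<tau>) t = ?l (of_nat (4 ^ card (generator_components 4 H) *
          fact (card (generator_components 4 H)) * 2 ^ card (generator_components 2 H) *
          insertion_count (2 * card (generator_components 4 H) - p div 2) (card (generator_components 2 H))) *
          fps_nth (point_fps p) (card (generator_components 4 H))) t"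
        using c(1) by simp
      then show ?thesis using False unfolding lookup_of_nat_mult by (simp add: cs_def)
    qed
  qed
  have bound: "?g ` ?A \<subseteq> {..M} \<times> {..M}"
  proof
    fix ab assume "ab \<in> ?g ` ?A"
    then obtain H where H: "H \<in> ?A" "ab = ?g H" by blast
    have R: "ribbon_graph H" using H by (simp add: all_generators_def)
    have "card (components H) \<le> card X" unfolding components_def using H X(1) by (auto intro: card_image_le)
    moreover have "card (generator_components q H) \<le> card (components H)" for q
      using finite_components[OF R] by (intro card_mono) (auto simp: generator_components_def)
    ultimately show "ab \<in> {..M} \<times> {..M}" using H(2) X(2) by (auto simp: M_def intro: le_trans)
  qed
  have N: "(fact (4 * V) :: rat) \<noteq> 0" by simp
  have us: "?l (union_sum X a b) s = fact (4 * V) / of_nat (fact a * fact b * 4 ^ a * 2 ^ b) *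
      ?l (fps_nth (point_fps 4 ^ a * point_fps 2 ^ b) V) s" for a b
  proof -
    have "of_nat (fact a * fact b * 4 ^ a * 2 ^ b) * union_sum X a b =
        of_nat (fact (4 * V)) * fps_nth (point_fps 4 ^ a * point_fps 2 ^ b) V"
      using union_sum_egf[of a b] X unfolding egf_def by simp
    then have "of_nat (fact a * fact b * 4 ^ a * 2 ^ b) * ?l (union_sum X a b) s =
        of_nat (fact (4 * V)) * ?l (fps_nth (point_fps 4 ^ a * point_fps 2 ^ b) V) s"
      unfolding lookup_of_nat_mult[symmetric] by simp
    moreover have "(of_nat (fact a * fact b * 4 ^ a * 2 ^ b) :: rat) \<noteq> 0" by simp
    ultimately show ?thesis
      by (metis (no_types, lifting) nonzero_mult_div_cancel_left of_nat_fact times_divide_eq_left)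
  qed
  have "fact (4 * V) * ?l (\<Delta> (labelled_sum p n)) (s, t) =
      of_nat p * (\<Sum>G\<in>generating_graphs p X. ?l (coproduct_graph G) (s, t))"
    unfolding lookup_coproduct_labelled_sum[OF p] generating_graphs_def
    using rooted_count[OF X(1), of n p "\<lambda>G. ?l (coproduct_graph G) (s, t)"] X(2) V
    by (simp add: coproduct_graph_relabel)
  also have "\<dots> = (\<Sum>H\<in>?A. ?l (graph_elem H) s * cs (?g H))"
    unfolding sum_coproduct_graphs[OF X(1)] sum_distrib_left
    by (rule sum.cong[OF refl]) (simp add: cs[symmetric] mult_ac)
  also have "\<dots> = (\<Sum>ab\<in>{..M} \<times> {..M}. \<Sum>H | H \<in> ?A \<and> ?g H = ab. ?l (graph_elem H) s * cs (?g H))"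
    by (rule sum.group[OF finA _ bound, symmetric]) simp
  also have "\<dots> = (\<Sum>(a, b)\<in>{..M} \<times> {..M}. ?l (union_sum X a b) s * cs (a, b))"
  proof (rule sum.cong[OF refl], clarify)
    fix a b
    have "{H. H \<in> ?A \<and> ?g H = (a, b)} = unions X a b" by (auto simp: unions_def)
    then have "(\<Sum>H | H \<in> ?A \<and> ?g H = (a, b). ?l (graph_elem H) s * cs (?g H)) =
        (\<Sum>H\<in>unions X a b. ?l (graph_elem H) s * cs (a, b))"
      by (intro sum.cong) (auto simp: unions_def)
    then show "(\<Sum>H | H \<in> ?A \<and> ?g H = (a, b). ?l (graph_elem H) s * cs (?g H)) = ?l (union_sum X a b) s * cs (a, b)"
      by (simp add: union_sum_def lookup_sum sum_distrib_right)
  qed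
  also have "\<dots> = (\<Sum>a\<le>M. \<Sum>b\<le>M. ?l (union_sum X a b) s * cs (a, b))"
    by (simp add: sum.cartesian_product)
  also have "\<dots> = (\<Sum>a\<le>M. fact (4 * V) * (if a = 0 then (if p = 2 then ?l (c_e n) s * ?l 1 t else 0)
      else ?l (if V < a then 0 else insertion_sum a (2 * a - p div 2) (V - a)) s * ?l (fps_nth (point_fps p) a) t))"
  proof (rule sum.cong[OF refl])
    fix a
    show "(\<Sum>b\<le>M. ?l (union_sum X a b) s * cs (a, b)) =
      fact (4 * V) * (if a = 0 then (if p = 2 then ?l (c_e n) s * ?l 1 t else 0)
        else ?l (if V < a then 0 else insertion_sum a (2 * a - p div 2) (V - a)) s * ?l (fps_nth (point_fps p) a) t)"
    proof (cases "a = 0")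
      case True
      \<comment> \<open>With \<open>a = 0\<close> only one 2-point component can contribute:
        \<open>H\<close> is the whole graph, and the factor \<open>p = 2\<close> cancels against
        \<open>2^b\<close>.\<close>
      have "(\<Sum>b\<le>M. ?l (union_sum X a b) s * cs (a, b)) =
          (\<Sum>b\<le>M. if b = 1 then (if p = 2 then ?l (union_sum X 0 1) s * (2 * ?l 1 t) else 0) else 0)"
        using True by (intro sum.cong refl) (auto simp: cs_def)
      also have "\<dots> = (if p = 2 then ?l (union_sum X 0 1) s * (2 * ?l 1 t) else 0)"
        using V n p by (auto simp: M_def)
      also have "\<dots> = (if p = 2 then fact (4 * V) * (?l (c_e n) s * ?l 1 t) else 0)"
      proof (cases "p = 2")
        case True
        then have "V = n" using V by simp
        then have "fps_nth (point_fps 4 ^ 0 * point_fps 2 ^ 1) V = c_e n"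
          using n by (simp add: point_fps_2 edge_fps_def)
        then show ?thesis unfolding us using True by simp
      qed simp
      finally show ?thesis using True by simp
    next
      case False
      let ?k = "2 * a - p div 2"
      have "?l (union_sum X a b) s * cs (a, b) = fact (4 * V) * (?l (scalar (of_nat (insertion_count ?k b) / fact b) *
          fps_nth (point_fps 4 ^ a * point_fps 2 ^ b) V) s * ?l (fps_nth (point_fps p) a) t)" for b
        using False unfolding us lookup_scalar_mult by (simp add: cs_def)
      then have "(\<Sum>b\<le>M. ?l (union_sum X a b) s * cs (a, b)) = fact (4 * V) *
          (?l (\<Sum>b\<le>M. scalar (of_nat (insertion_count ?k b) / fact b) *
          fps_nth (point_fps 4 ^ a * point_fps 2 ^ b) V) s * ?l (fps_nth (point_fps p) a) t)"
        by (simp add: lookup_sum sum_distrib_left sum_distrib_right)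
      also have "(\<Sum>b\<le>M. scalar (of_nat (insertion_count ?k b) / fact b) *
          fps_nth (point_fps 4 ^ a * point_fps 2 ^ b) V) = (if V < a then 0 else insertion_sum a ?k (V - a))"
        by (rule insertion_sum_eq) (simp add: M_def)
      finally show ?thesis using False by simp
    qed
  qed
  finally have "?l (\<Delta> (labelled_sum p n)) (s, t) =
      (\<Sum>a\<le>M. if a = 0 then (if p = 2 then ?l (c_e n) s * ?l 1 t else 0)
      else ?l (if V < a then 0 else insertion_sum a (2 * a - p div 2) (V - a)) s * ?l (fps_nth (point_fps p) a) t)"
    using N unfolding sum_distrib_left[symmetric] by simp
  \<comment> \<open>For \<open>a > V\<close> there are too few vertices and the terms
    vanish.\<close>
  also have "{..M} = insert 0 ({1..V} \<union> {V<..M})" by (auto simp: M_def)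
  also have "(\<Sum>a\<in>insert 0 ({1..V} \<union> {V<..M}). if a = 0 then (if p = 2 then ?l (c_e n) s * ?l 1 t else 0)
      else ?l (if V < a then 0 else insertion_sum a (2 * a - p div 2) (V - a)) s * ?l (fps_nth (point_fps p) a) t) =
      (if p = 2 then ?l (c_e n) s * ?l 1 t else 0) +
      (\<Sum>a\<in>{1..V}. ?l (insertion_sum a (2 * a - p div 2) (V - a)) s * ?l (fps_nth (point_fps p) a) t)"
    by (subst sum.insert, simp, simp, subst sum.union_disjoint) (auto intro!: sum.cong sum.neutral)
  finally show ?thesis by simp
qed

text \<open>For \<open>k = 0\<close> the edge factor is 1 and a power of the vertex remains; for
  \<open>k = n\<close> the edge index is 0 and a single vertex correction remains; in between the
  edge index is positive, as \<open>Q_e_eq\<close> requires.\<close>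

lemma insertion_sum_P_v:
  assumes k: "k \<le> n" and n: "n \<ge> 1"
  shows "insertion_sum (n - k + 1) (2 * (n - k)) k = P_v n k"
proof -
  consider "k = 0" | "k = n" "k > 0" | "0 < k" "k < n" using k by linarith
  then show ?thesis
  proof cases
    case 1
    then show ?thesis
      by (simp add: vertex_fps_power_nth_0 insertion_sum_def edge_sum_0_right P_v_def del: power_Suc fps_mult_nth_0)
  next
    case 2
    have "insertion_sum 1 0 n = (\<Sum>j=0..n. if j = n then c_v n else 0)"
      unfolding insertion_sum_def by (rule sum.cong[OF refl]) (simp add: edge_sum_0_left vertex_fps_def)
    then show ?thesis using 2 by (simp add: P_v_def)
  next
    case 3
    then show ?thesis by (simp add: insertion_sum_def P_v_def Q_v_eq Q_e_eq)
  qed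
qed

text \<open>The range stops before \<open>k = n\<close>, where there would be no 4-point component;
  that term is the separate summand of \<open>lookup_coproduct\<close>.\<close>

lemma insertion_sum_P_e:
  assumes k: "k < n"
  shows "insertion_sum (n - k) (2 * (n - k) - 1) k = P_e n k"
proof (cases "k = 0")
  case True
  then show ?thesis by (simp add: vertex_fps_power_nth_0 insertion_sum_def edge_sum_0_right P_e_def)
next
  case False
  then show ?thesis using k by (simp add: insertion_sum_def P_e_def Q_v_eq Q_e_eq)
qed

lemma coproduct_c_v:
  assumes n: "n \<ge> 1" shows "\<Delta> (c_v n) = (\<Sum>k=0..n. P_v n k \<otimes> c_v (n - k))"
proof (rule poly_mapping_eqI, clarify)
  fix s t
  let ?l = "Poly_Mapping.lookup"
  have "?l (\<Delta> (c_v n)) (s, t) = (\<Sum>a=1..n + 1. ?l (insertion_sum a (2 * a - 2) (n + 1 - a)) s *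
      ?l (fps_nth (point_fps 4) a) t)"
    unfolding c_v_eq using lookup_coproduct[of 4 n "n + 1" s t] n by simp
  also have "\<dots> = (\<Sum>k=0..n. ?l (P_v n k) s * ?l (c_v (n - k)) t)"
  \<comment> \<open>A 4-point quotient with \<open>a\<close> vertices has \<open>a - 1\<close>
    loops, which leaves \<open>k = n + 1 - a\<close> for the subgraph.\<close>
  proof (rule sum.reindex_bij_witness[of _ "\<lambda>k. n + 1 - k" "\<lambda>a. n + 1 - a"])
    fix a assume a: "a \<in> {1..n + 1}"
    have "insertion_sum (n - (n + 1 - a) + 1) (2 * (n - (n + 1 - a))) (n + 1 - a) = P_v n (n + 1 - a)"
      by (rule insertion_sum_P_v) (use a n in auto)
    moreover have "n - (n + 1 - a) + 1 = a" "2 * (n - (n + 1 - a)) = 2 * a - 2" "n - (n + 1 - a) = a - 1"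
      using a by auto
    moreover have "fps_nth (point_fps 4) a = c_v (a - 1)"
      using a by (simp add: point_fps_4 vertex_fps_def)
    ultimately show "?l (P_v n (n + 1 - a)) s * ?l (c_v (n - (n + 1 - a))) t =
        ?l (insertion_sum a (2 * a - 2) (n + 1 - a)) s * ?l (fps_nth (point_fps 4) a) t"
      by simp
  qed auto
  finally show "?l (\<Delta> (c_v n)) (s, t) = ?l (\<Sum>k=0..n. P_v n k \<otimes> c_v (n - k)) (s, t)"
    by (simp add: lookup_sum lookup_tensor)
qed

lemma coproduct_c_e:
  assumes n: "n \<ge> 1" shows "\<Delta> (c_e n) = (\<Sum>k=0..n. P_e n k \<otimes> c_e (n - k))"
proof (rule poly_mapping_eqI, clarify)
  fix s t
  let ?l = "Poly_Mapping.lookup"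
  have "c_e n = labelled_sum 2 n" using n by (simp add: c_e_def)
  then have "?l (\<Delta> (c_e n)) (s, t) = (\<Sum>a=1..n. ?l (insertion_sum a (2 * a - 1) (n - a)) s *
      ?l (fps_nth (point_fps 2) a) t) + ?l (c_e n) s * ?l 1 t"
    using lookup_coproduct[of 2 n n s t] n by simp
  also have "(\<Sum>a=1..n. ?l (insertion_sum a (2 * a - 1) (n - a)) s * ?l (fps_nth (point_fps 2) a) t) =
      (\<Sum>k=0..<n. ?l (P_e n k) s * ?l (c_e (n - k)) t)"
  \<comment> \<open>A 2-point quotient with \<open>a\<close> vertices has \<open>a\<close> loops,
    hence \<open>k = n - a\<close>.\<close>
  proof (rule sum.reindex_bij_witness[of _ "\<lambda>k. n - k" "\<lambda>a. n - a"])
    fix a assume a: "a \<in> {1..n}"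
    have "insertion_sum (n - (n - a)) (2 * (n - (n - a)) - 1) (n - a) = P_e n (n - a)"
      by (rule insertion_sum_P_e) (use a in auto)
    moreover have "n - (n - a) = a" using a by auto
    moreover have "fps_nth (point_fps 2) a = c_e a" using a by (simp add: point_fps_2 edge_fps_def)
    ultimately show "?l (P_e n (n - a)) s * ?l (c_e (n - (n - a))) t =
        ?l (insertion_sum a (2 * a - 1) (n - a)) s * ?l (fps_nth (point_fps 2) a) t"
      by simp
  qed auto
  \<comment> \<open>The separate summand is the term \<open>k = n\<close>, by the conventions
    \<open>P_e n n = c_e n\<close> and \<open>c_e 0 = 1\<close>.\<close>
  also have "\<dots> + ?l (c_e n) s * ?l 1 t = (\<Sum>k=0..n. ?l (P_e n k) s * ?l (c_e (n - k)) t)"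
    using n by (simp add: sum.last_plus P_e_def c_e_def[of 0] atLeastLessThanSuc_atLeastAtMost[symmetric])
  finally show "?l (\<Delta> (c_e n)) (s, t) = ?l (\<Sum>k=0..n. P_e n k \<otimes> c_e (n - k)) (s, t)"
    by (simp add: lookup_sum lookup_tensor)
qed

section \<open>Polynomiality and loop order of the coefficients\<close>

lemma c_polynomials_sum: "(\<And>i. i \<in> I \<Longrightarrow> f i \<in> c_polynomials) \<Longrightarrow> sum f I \<in> c_polynomials"
proof (induction I rule: infinite_finite_induct)
  case (insert x I)
  then show ?case by (simp add: c_polynomials.intros)
qed (use c_polynomials.intros(1)[of 0] in simp_all)

lemma c_polynomials_prod: "(\<And>i. i \<in> I \<Longrightarrow> f i \<in> c_polynomials) \<Longrightarrow> prod f I \<in> c_polynomials"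
proof (induction I rule: infinite_finite_induct)
  case (insert x I)
  then show ?case by (simp add: c_polynomials.intros)
qed (use c_polynomials.intros(1)[of 1] in simp_all)

lemma c_polynomials_power: "x \<in> c_polynomials \<Longrightarrow> x ^ n \<in> c_polynomials"
  using c_polynomials_prod[of "{..<n}" "\<lambda>_. x"] by simp

lemma Q_polynomials: "Q_v k j \<in> c_polynomials" "Q_e k j \<in> c_polynomials"
  unfolding Q_v_def Q_e_def
  by (intro c_polynomials_sum c_polynomials_prod c_polynomials_power c_polynomials.intros)+

lemma P_polynomials: "P_v n k \<in> c_polynomials" "P_e n k \<in> c_polynomials"
  using c_polynomials_power[OF c_polynomials.intros(2), of 0]
  unfolding P_v_def P_e_def
  by (auto intro!: c_polynomials_sum Q_polynomials intro: c_polynomials.intros simp del: power_Suc)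

lemma has_loop_order_sum: "(\<And>i. i \<in> I \<Longrightarrow> has_loop_order k (f i)) \<Longrightarrow> has_loop_order k (sum f I)"
proof (induction I rule: infinite_finite_induct)
  case (insert x I)
  then show ?case using keys_add[of "f x" "sum f I"] unfolding has_loop_order_def by auto
qed (simp_all add: has_loop_order_def)

lemma has_loop_order_mult:
  assumes "has_loop_order k x" "has_loop_order l y" shows "has_loop_order (k + l) (x * y)"
  using assms keys_mult[of x y] unfolding has_loop_order_def by fastforce

lemma has_loop_order_1: "has_loop_order 0 1" "has_loop_order 0 (scalar q)"
  by (simp_all add: has_loop_order_def)

lemma has_loop_order_power: "has_loop_order k x \<Longrightarrow> has_loop_order (n * k) (x ^ n)"
  by (induction n) (auto simp: has_loop_order_1 intro: has_loop_order_mult)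

lemma has_loop_order_prod:
  "finite I \<Longrightarrow> (\<And>i. i \<in> I \<Longrightarrow> has_loop_order (k i) (f i)) \<Longrightarrow> has_loop_order (sum k I) (prod f I)"
  by (induction I rule: finite_induct) (auto simp: has_loop_order_1 intro: has_loop_order_mult)

text \<open>Each summand is one generator, and the representative picked from its class in
  \<open>has_loop_order\<close> has the loop number of every graph in that class.\<close>

lemma has_loop_order_labelled_sum:
  assumes p: "p = 2 \<or> p = 4" shows "has_loop_order n (labelled_sum p n)"
  unfolding labelled_sum_def
proof (rule has_loop_order_sum)
  fix L assume "L \<in> labelled_graphs p n"
  note r = labelled_representative[OF this]
  then have "is_generator (fst (SOME x. x \<in> L))" using p by (auto simp: is_generator_def)
  then show "has_loop_order n (graph_elem (fst (SOME x. x \<in> L)))"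
    using r(2) by (simp add: has_loop_order_def graph_elem_generator loop_number_generator_of)
qed

lemma has_loop_order_c: "has_loop_order n (c_v n)" "has_loop_order n (c_e n)"
  unfolding c_v_eq c_e_def by (simp_all add: has_loop_order_labelled_sum has_loop_order_1)

lemma has_loop_order_Q_v: "has_loop_order j (Q_v k j)"
  unfolding Q_v_def
proof (rule has_loop_order_sum)
  fix l assume "l \<in> {l :: nat \<Rightarrow> nat. l \<in> {1..k} \<rightarrow>\<^sub>E UNIV \<and> (\<Sum>i=1..k. l i) = j}"
  moreover have "has_loop_order (\<Sum>i=1..k. l i) (\<Prod>i=1..k. c_v (l i))"
    by (rule has_loop_order_prod) (simp_all add: has_loop_order_c)
  ultimately show "has_loop_order j (\<Prod>i=1..k. c_v (l i))" by simp
qed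

lemma has_loop_order_Q_e: "has_loop_order j (Q_e k j)"
  unfolding Q_e_def
proof (rule has_loop_order_sum)
  fix s assume s: "s \<in> {s :: nat \<Rightarrow> nat. s \<in> {1..j} \<rightarrow>\<^sub>E UNIV \<and> (\<Sum>i=1..j. i * s i) = j}"
  let ?q = "fact ((\<Sum>i=1..j. s i) + k - 1) / ((\<Prod>i=1..j. fact (s i)) * fact (k - 1)) :: rat"
  have "has_loop_order (\<Sum>i=1..j. s i * i) (\<Prod>i=1..j. c_e i ^ s i)"
    by (intro has_loop_order_prod has_loop_order_power has_loop_order_c) simp
  then have "has_loop_order (0 + (\<Sum>i=1..j. s i * i)) (scalar ?q * (\<Prod>i=1..j. c_e i ^ s i))"
    by (intro has_loop_order_mult has_loop_order_1)
  then show "has_loop_order j (scalar ?q * (\<Prod>i=1..j. c_e i ^ s i))" using s by (simp add: mult.commute)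
qed

lemma has_loop_order_P: "has_loop_order k (P_v n k)" "has_loop_order k (P_e n k)"
proof -
  have Q: "has_loop_order k (\<Sum>j=0..k. Q_v a j * Q_e b (k - j))" for a b
  proof (rule has_loop_order_sum)
    fix j assume "j \<in> {0..k}"
    then show "has_loop_order k (Q_v a j * Q_e b (k - j))"
      using has_loop_order_mult[OF has_loop_order_Q_v has_loop_order_Q_e, of j "k - j" a b] by simp
  qed
  have v: "has_loop_order 0 (c_v 0 ^ m)" for m
    using has_loop_order_power[OF has_loop_order_c(1), of m 0] by simp
  show "has_loop_order k (P_v n k)" "has_loop_order k (P_e n k)"
    unfolding P_v_def P_e_def using Q v has_loop_order_c by (auto simp del: power_Suc)
qed

text \<open>Deleting all edges leaves one copy of the single vertex for each vertex, and their
  number is determined by the loop number and \<open>p\<close>.\<close>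

lemma graph_elem_skl:
  fixes G :: "nat ribbon"
  assumes G: "generating_graph p G" and V: "4 * V + 4 = 4 * loop_number G + 2 * p"
  shows "graph_elem (skl G) = c_v 0 ^ V"
proof -
  have R: "ribbon_graph G" and v: "\<forall>w\<in>vertices G. card w = 4" using G by (auto simp: generating_graph_def)
  have q: "quartic (half_edges G) (vrot G)" using v ribbonD(2)[OF R] by (simp add: vertices_def)
  have "skl G = \<lparr>half_edges = half_edges G, vrot = vrot G, flip = id\<rparr>" by (simp add: skl_def)
  then have "graph_elem (skl G) = c_v 0 ^ card (cycles_of (vrot G) (half_edges G))"
    using skeleton(4)[OF ribbonD(1)[OF R] q] by simp
  moreover have "card (half_edges G) = 4 * card (cycles_of (vrot G) (half_edges G))"
    by (rule card_cycles_quartic[OF ribbonD(1)[OF R] q])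
  moreover from this have "card (cycles_of (vrot G) (half_edges G)) = V"
    using card_half_edges_generating[OF G] V by linarith
  ultimately show ?thesis by simp
qed

theorem theorem17:
  fixes n :: nat
  assumes "n \<ge> 1"
  shows "\<Delta> (c_v n) = (\<Sum>k=0..n. P_v n k \<otimes> c_v (n - k)) \<and>
    \<Delta> (c_e n) = (\<Sum>k=0..n. P_e n k \<otimes> c_e (n - k)) \<and>
    (\<forall>k\<le>n. P_v n k \<in> c_polynomials \<and> has_loop_order k (P_v n k) \<and>
            P_e n k \<in> c_polynomials \<and> has_loop_order k (P_e n k)) \<and>
    (\<forall>G. generating_graph 4 G \<and> loop_number G = n \<longrightarrow> graph_elem (skl G) = P_v n 0) \<and>
    (\<forall>G. generating_graph 2 G \<and> loop_number G = n \<longrightarrow> graph_elem (skl G) = P_e n 0)"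
proof (intro conjI allI impI)
  show "\<Delta> (c_v n) = (\<Sum>k=0..n. P_v n k \<otimes> c_v (n - k))" by (rule coproduct_c_v[OF assms])
  show "\<Delta> (c_e n) = (\<Sum>k=0..n. P_e n k \<otimes> c_e (n - k))" by (rule coproduct_c_e[OF assms])
  show "graph_elem (skl G) = P_v n 0" if "generating_graph 4 G \<and> loop_number G = n" for G
    using graph_elem_skl[of 4 G "n + 1"] that by (simp add: P_v_def)
  show "graph_elem (skl G) = P_e n 0" if "generating_graph 2 G \<and> loop_number G = n" for G
    using graph_elem_skl[of 2 G n] that by (simp add: P_e_def)
qed (rule P_polynomials has_loop_order_P)+

end
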